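(* Let $n\geq 2$ and let $P\subset\mathbb{R}^n$ be an $n$-dimensional simple lattice polytope of degree $d<n$. (i) If $d<n-d$ (equivalently, $d\leq\frac{n-1}{2}$, respectively $\mathrm{codeg}(P)\geq\frac{n+3}{2}$), then $c(P)=0$. (ii) If $d\geq n-d$, then $$\sum_{j=0}^n(-1)^j\sum_{F\in\mathcal{F}(P)_j}\Big((n-d)\,h^*_{n-d}(F)+(j+1)\sum_{k=0}^{n-d-1}h^*_k(F)\Big)=0.$$
   Context: A lattice polytope in $\mathbb{R}^n$ is the convex hull of finitely many points of $\mathbb{Z}^n$. An $n$-dimensional polytope is simple if every vertex is contained in precisely $n$ facets. For an $n$-dimensional lattice polytope $P\subset\mathbb{R}^n$, $\mathrm{codeg}(P)=\min\{k\geq 1 : (kP)^\circ\cap\mathbb{Z}^n\neq\emptyset\}$, where $k$ ranges over positive integers and $(\cdot)^\circ$ is the interior; the degree of $P$ is $\deg(P)=n+1-\mathrm{codeg}(P)$. $\mathcal{F}(P)_j$ denotes the set of $j$-dimensional faces of $P$ ($P$ itself being the only $n$-dimensional face), and $c(P)=\sum_{j=0}^n(-1)^{n-j}(j+1)\sum_{F\in\mathcal{F}(P)_j}\mathrm{Vol}_{\mathbb{Z}}(F)$, where $\mathrm{Vol}_{\mathbb{Z}}(F)$ is the volume on the affine span $\mathrm{aff}(F)$ normalized so that a fundamental parallelepiped of $\mathrm{aff}(F)\cap\mathbb{Z}^n$ has volume $\dim(F)!$. For a face $F$ of dimension $j$, the numbers $h^*_k(F)$ are the coefficients of the $h^*$-polynomial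 of $F$, defined by $\sum_{k\geq 0}|(kF)\cap\mathbb{Z}^n|\,t^k=\frac{h^*_0(F)+h^*_1(F)t+\cdots+h^*_j(F)t^j}{(1-t)^{j+1}}$, and $h^*_k(F)=0$ for $k>j$. *)

theory Defs
  imports "HOL-Analysis.Analysis" "HOL-Computational_Algebra.Computational_Algebra"
begin

definition integer_points :: "(real ^ 'n) set" where
  "integer_points = {x. \<forall>i. x $ i \<in> \<int>}"

definition lattice_polytope :: "(real ^ 'n) set \<Rightarrow> bool" where
  "lattice_polytope P \<longleftrightarrow> (\<exists>S. finite S \<and> S \<subseteq> integer_points \<and> P = convex hull S)"

definition simple_polytope :: "(real ^ 'n) set \<Rightarrow> bool" where
  "simple_polytope P \<longleftrightarrow>
     (\<forall>v. v extreme_point_of P \<longrightarrow> card {F. F facet_of P \<and> v \<in> F} = CARD('n))"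

definition dilate :: "nat \<Rightarrow> (real ^ 'n) set \<Rightarrow> (real ^ 'n) set" where
  "dilate k P = (\<lambda>x. real k *\<^sub>R x) ` P"

definition codeg :: "(real ^ 'n) set \<Rightarrow> nat" where
  "codeg P = (LEAST k. 1 \<le> k \<and> interior (dilate k P) \<inter> integer_points \<noteq> {})"

(* The subtraction does not truncate when P is a full-dimensional lattice polytope:
   see codeg_le below. *)
definition lattice_deg :: "(real ^ 'n) set \<Rightarrow> nat" where
  "lattice_deg P = CARD('n) + 1 - codeg P"

lemma codeg_le:
  fixes P :: "(real ^ 'n) set"
  assumes "lattice_polytope P" "aff_dim P = int CARD('n)"
  shows "codeg P \<le> CARD('n) + 1"
proof -
  obtain S where S: "finite S" "S \<subseteq> integer_points" "P = convex hull S"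
    using assms(1) by (auto simp: lattice_polytope_def)
  obtain B where B: "B \<subseteq> S" "\<not> affine_dependent B" "affine hull S = affine hull B"
    using affine_basis_exists[of S] by auto
  have "aff_dim B = int CARD('n)"
    using assms(2) S(3) B(3) by (metis aff_dim_affine_hull aff_dim_convex_hull)
  hence card: "card B = CARD('n) + 1"
    using aff_dim_affine_independent[OF B(2)] by simp
  have finB: "finite B" using B(1) S(1) finite_subset by blast
  define m where "m = CARD('n) + 1"
  define y where "y = (\<Sum>x\<in>B. (1 / real m) *\<^sub>R x)"
  have "y \<in> interior (convex hull B)"
    unfolding interior_convex_hull_explicit_minimal[OF B(2)] y_def
    using card by (auto simp: m_def intro!: exI[of _ "\<lambda>_. 1 / real m"])
  hence "y \<in> interior P"
    using interior_mono[OF hull_mono[OF B(1)]] S(3) by blast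
  moreover have mpos: "real m \<noteq> 0" by (simp add: m_def)
  ultimately have "real m *\<^sub>R y \<in> interior (dilate m P)"
    unfolding dilate_def by (subst interior_injective_linear_image) (auto simp: inj_on_def)
  moreover have "real m *\<^sub>R y = (\<Sum>x\<in>B. x)"
    using mpos by (simp add: y_def scaleR_sum_right)
  moreover have "(\<Sum>x\<in>B. x) \<in> integer_points"
    using B(1) S(2) by (auto simp: integer_points_def intro!: Ints_sum)
  ultimately have "1 \<le> m \<and> interior (dilate m P) \<inter> integer_points \<noteq> {}"
    by (auto simp: m_def)
  thus ?thesis unfolding codeg_def m_def by (rule Least_le)
qed

definition faces_of_dim :: "(real ^ 'n) set \<Rightarrow> nat \<Rightarrow> (real ^ 'n) set set" where
  "faces_of_dim P j = {F. F face_of P \<and> aff_dim F = int j}"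

(* B is a Z-basis of the group of translations of the affine lattice aff(F) \<inter> Z^n. *)
definition is_lattice_basis :: "(real ^ 'n) set \<Rightarrow> (real ^ 'n) set \<Rightarrow> bool" where
  "is_lattice_basis F B \<longleftrightarrow> independent B \<and>
     {\<Sum>b\<in>B. of_int (m b) *\<^sub>R b | m :: real ^ 'n \<Rightarrow> int. True} =
     {x - y | x y. x \<in> affine hull F \<inter> integer_points \<and> y \<in> affine hull F \<inter> integer_points}"

(* Volume of F in the affine coordinates t \<mapsto> p + (\<Sum>b\<in>B. t b *\<^sub>R b) of aff(F), where t ranges
   over R^B with Lebesgue measure.  The fundamental parallelepiped spanned by B at p
   corresponds to the unit cube, so it has volume 1 before multiplication by dim(F)!.  The
   result does not depend on p and B, since changing
   them amounts to a unimodular integer affine change of the coordinates t. *)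
definition Vol_Z :: "(real ^ 'n) set \<Rightarrow> real" where
  "Vol_Z F =
     (let p = (SOME p. p \<in> affine hull F \<inter> integer_points);
          B = (SOME B. is_lattice_basis F B);
          M = Pi\<^sub>M B (\<lambda>_. lborel)
      in fact (nat (aff_dim F)) * measure M {t \<in> space M. p + (\<Sum>b\<in>B. t b *\<^sub>R b) \<in> F})"

definition c_inv :: "(real ^ 'n) set \<Rightarrow> real" where
  "c_inv P = (\<Sum>j=0..CARD('n). (-1) ^ (CARD('n) - j) * (real j + 1) *
            (\<Sum>F\<in>faces_of_dim P j. Vol_Z F))"

definition ehrhart_series :: "(real ^ 'n) set \<Rightarrow> int fps" where
  "ehrhart_series F = Abs_fps (\<lambda>k. int (card (dilate k F \<inter> integer_points)))"

definition h_star_poly :: "(real ^ 'n) set \<Rightarrow> int poly" where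
  "h_star_poly F =
     (THE h. degree h \<le> nat (aff_dim F) \<and>
             ehrhart_series F * (1 - fps_X) ^ (nat (aff_dim F) + 1) = fps_of_poly h)"

definition h_star :: "(real ^ 'n) set \<Rightarrow> nat \<Rightarrow> int" where
  "h_star F k = coeff (h_star_poly F) k"

end

theory Submission
  imports Defs "HOL-Real_Asymp.Real_Asymp"
begin

text \<open>
  Write \<open>m = n - d = codeg P - 1\<close> and let \<open>E\<^sub>k = \<Sum>\<^sub>F |kF \<inter> \<int>\<^sup>n| (X - 1)\<^bsup>dim F\<^esup>\<close>, summed over the
  nonempty faces. For \<open>k \<ge> 1\<close> count by lattice points \<open>x\<close> of \<open>kP\<close>: if \<open>x\<close> lies in exactly \<open>c\<close> facets,
  then by simplicity the faces containing it correspond to the subsets of these facets, so \<open>x\<close>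
  contributes \<open>(X - 1)\<^bsup>n - c\<^esup> X\<^bsup>c\<^esup>\<close>. Adding to \<open>x\<close> a vertex off each of the \<open>c\<close> facets gives an interior
  point of \<open>(k + c)P\<close>, so \<open>c \<ge> m + 1 - k\<close> and \<open>X\<^bsup>m + 1 - k\<^esup>\<close> divides \<open>E\<^sub>k\<close>. Comparing low-order coefficients
  in \<open>\<Sum>\<^sub>F (-1)\<^bsup>dim F\<^esup> h\<^sup>*(F)\<close> and its variant weighted by dimension, only \<open>E\<^sub>0\<close> contributes, and its
  contributions cancel, which gives the identity of (ii) in both cases.

  A half-open triangulation shows that a nonzero \<open>h\<^sup>*\<^sub>k(F)\<close> produces a relative interior lattice point of
  \<open>(dim F + 1 - k)F\<close>; the same vertex-adding argument then gives \<open>k \<le> d\<close>. So if \<open>d < n - d\<close> the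
  identity only involves \<open>\<Sum>\<^sub>k h\<^sup>*\<^sub>k(F) = Vol(F)\<close> and becomes (i).
\<close>

section \<open>Half-open decomposition of a polyhedral cone\<close>

text \<open>Since 0F is the origin for every nonempty face, \<open>E_0\<close> is the sum of (X -
  1)^(dim F), and no interior point argument constrains it. The weights in (ii) remove it whatever
  its coefficients are: the weight dim F comes from differentiating (X - 1)^(dim F), the sum over k
  < m telescopes the factor 1 - X, and m times h*_m cancels what remains. The bound k \<le> d needs
  every nonzero h*_k(F) to exhibit an actual lattice point. Inclusion-exclusion over a triangulation
  would lose this through cancellation, so a generic direction \<open>q\<close> assigns each wall
  between simplicial cones to one side and the pieces become disjoint. The triangulation is regular,
  with infinitesimal heights compared lexicographically, so no real heights have to be perturbed.
  The same rational series shows that the definite description behind h* is met, and its growth is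
  compared with a lattice count in the coordinates used by \<open>Vol_Z\<close>.\<close>

lemma eventually_avoid_finite:
  fixes B :: "real set"
  assumes "finite B"
  shows "\<forall>\<^sub>F t in at_right x. t \<notin> B"
proof -
  have "open (- (B - {x}))" using assms by (intro open_Compl finite_imp_closed) auto
  then show ?thesis unfolding eventually_at_topological
    by (intro exI[of _ "- (B - {x})"]) auto
qed

section \<open>Lexicographic triangulation of a finitely generated cone\<close>

locale finite_generators =
  fixes A :: "'a::euclidean_space set"
  assumes finite_A: "finite A"
begin

abbreviation lc :: "('a \<Rightarrow> real) \<Rightarrow> 'a" where
  "lc c \<equiv> \<Sum>a\<in>A. c a *\<^sub>R a"

definition cone_points :: "'a set" where
  "cone_points = {lc c | c. \<forall>a\<in>A. 0 \<le> c a}"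

definition pos_points :: "'a set" where
  "pos_points = {lc c | c. \<forall>a\<in>A. 0 < c a}"

text \<open>This is the sign of the sum of \<open>\<mu> a\<close> times \<epsilon> to the power
  \<open>to_nat_on A a\<close> for infinitesimal \<epsilon> > 0: the generators carry heights that
  decrease infinitely fast along the enumeration, which makes the height function generic.\<close>

definition lexneg :: "('a \<Rightarrow> real) \<Rightarrow> bool" where
  "lexneg \<mu> \<longleftrightarrow> (\<exists>a\<in>A. \<mu> a < 0 \<and> (\<forall>b\<in>A. to_nat_on A b < to_nat_on A a \<longrightarrow> \<mu> b = 0))"

text \<open>Optimal bases of the linear programme that writes a point as a nonnegative combination
  of \<open>A\<close> of least lexicographic height: a dependency that lowers the height must turn
  negative at a generator outside \<open>I\<close>. Their cones are the maximal cones of the regular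
  triangulation given by these heights.\<close>

definition lex_bases :: "'a set set" where
  "lex_bases = {I. I \<subseteq> A \<and> independent I \<and> span I = span A \<and>
     (\<forall>\<mu>. lc \<mu> = 0 \<longrightarrow> lexneg \<mu> \<longrightarrow> (\<exists>a\<in>A - I. \<mu> a < 0))}"

definition generic :: "'a \<Rightarrow> bool" where
  "generic z \<longleftrightarrow> (\<forall>J\<subseteq>A. span J \<noteq> span A \<longrightarrow> z \<notin> span J)"

lemma inj_idx: "inj_on (to_nat_on A) A"
  using finite_A by (simp add: countable_finite inj_on_to_nat_on)

lemma lexneg_total:
  assumes "a \<in> A" "\<mu> a \<noteq> 0"
  shows "lexneg \<mu> \<or> lexneg (\<lambda>x. - \<mu> x)"
proof -
  let ?N = "{a\<in>A. \<mu> a \<noteq> 0}"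
  obtain m where m: "m \<in> ?N" "\<And>b. b \<in> ?N \<Longrightarrow> to_nat_on A m \<le> to_nat_on A b"
    using ex_has_least_nat[of "\<lambda>x. x \<in> ?N" a "to_nat_on A"] assms by auto
  have "\<forall>b\<in>A. to_nat_on A b < to_nat_on A m \<longrightarrow> \<mu> b = 0"
    using m(2) by (force simp: not_less)
  then show ?thesis
    using m(1) unfolding lexneg_def by (cases "\<mu> m < 0") force+
qed

lemma lexneg_not_both:
  assumes "lexneg \<mu>" "lexneg (\<lambda>x. - \<mu> x)"
  shows False
proof -
  obtain a where a: "a \<in> A" "\<mu> a < 0" "\<forall>b\<in>A. to_nat_on A b < to_nat_on A a \<longrightarrow> \<mu> b = 0"
    using assms(1) unfolding lexneg_def by auto
  obtain b where b: "b \<in> A" "- \<mu> b < 0" "\<forall>c\<in>A. to_nat_on A c < to_nat_on A b \<longrightarrow> - \<mu> c = 0"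
    using assms(2) unfolding lexneg_def by auto
  have "to_nat_on A a = to_nat_on A b"
    using a b by (metis less_irrefl linorder_neqE_nat neg_equal_0_iff_equal)
  then have "a = b" using a b inj_idx by (auto dest: inj_onD)
  then show False using a b by auto
qed

lemma lexneg_add:
  assumes "lexneg \<mu>" "lexneg \<nu>"
  shows "lexneg (\<lambda>x. \<mu> x + \<nu> x)"
proof -
  obtain a where a: "a \<in> A" "\<mu> a < 0" "\<forall>b\<in>A. to_nat_on A b < to_nat_on A a \<longrightarrow> \<mu> b = 0"
    using assms(1) unfolding lexneg_def by auto
  obtain b where b: "b \<in> A" "\<nu> b < 0" "\<forall>c\<in>A. to_nat_on A c < to_nat_on A b \<longrightarrow> \<nu> c = 0"
    using assms(2) unfolding lexneg_def by auto
  consider "to_nat_on A a < to_nat_on A b" | "to_nat_on A b < to_nat_on A a" | "a = b"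
    using a b inj_idx by (metis inj_onD linorder_neqE_nat)
  then show ?thesis
  proof cases
    case 1 then show ?thesis unfolding lexneg_def using a b by (intro bexI[of _ a]) auto
  next
    case 2 then show ?thesis unfolding lexneg_def using a b by (intro bexI[of _ b]) auto
  next
    case 3 then show ?thesis unfolding lexneg_def using a b by (intro bexI[of _ a]) auto
  qed
qed

lemma lexneg_scale: "lexneg \<mu> \<Longrightarrow> t > 0 \<Longrightarrow> lexneg (\<lambda>x. t * \<mu> x)"
  unfolding lexneg_def by (auto simp: mult_less_0_iff)

lemma lexneg_cong: "(\<And>a. a \<in> A \<Longrightarrow> \<mu> a = \<nu> a) \<Longrightarrow> lexneg \<mu> \<longleftrightarrow> lexneg \<nu>"
  unfolding lexneg_def by auto

lemma lc_add: "lc (\<lambda>x. c x + d x) = lc c + lc d"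
  by (simp add: scaleR_add_left sum.distrib)

lemma lc_scale: "lc (\<lambda>x. t * c x) = t *\<^sub>R lc c"
  by (simp add: scaleR_sum_right)

text \<open>Moving along a lexicographically negative dependency until a coefficient vanishes.\<close>
lemma basic_reduction:
  assumes "\<forall>a\<in>A. 0 \<le> c a"
  shows "\<exists>c'. (\<forall>a\<in>A. 0 \<le> c' a) \<and> lc c' = lc c \<and> independent {a\<in>A. c' a \<noteq> 0} \<and>
    (c' = c \<or> lexneg (\<lambda>x. c' x - c x))"
  using assms
proof (induction "card {a\<in>A. c a \<noteq> 0}" arbitrary: c rule: less_induct)
  case less
  let ?S = "{a\<in>A. c a \<noteq> 0}"
  show ?case
  proof (cases "independent ?S")
    case True
    then show ?thesis using less.prems by blast
  next
    case False
    have finS: "finite ?S" using finite_A by auto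
    obtain u v where u: "v \<in> ?S" "u v \<noteq> 0" "(\<Sum>a\<in>?S. u a *\<^sub>R a) = 0"
      using False dependent_finite[OF finS] by blast
    define \<mu>0 where "\<mu>0 = (\<lambda>a. if a \<in> ?S then u a else 0)"
    have \<mu>0: "lc \<mu>0 = 0"
    proof -
      have "lc \<mu>0 = (\<Sum>a\<in>?S. u a *\<^sub>R a)"
        using finite_A unfolding \<mu>0_def by (intro sum.mono_neutral_cong_right) auto
      then show ?thesis using u(3) by simp
    qed
    have ne: "v \<in> A" "\<mu>0 v \<noteq> 0" using u by (auto simp: \<mu>0_def)
    define \<mu> where "\<mu> = (if lexneg \<mu>0 then \<mu>0 else (\<lambda>x. - \<mu>0 x))"
    have neg: "lexneg \<mu>" using lexneg_total[of v \<mu>0] ne by (auto simp: \<mu>_def)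
    have lc0: "lc \<mu> = 0" using \<mu>0 by (auto simp: \<mu>_def sum_negf)
    have supp: "\<mu> a = 0" if "c a = 0" for a using that by (auto simp: \<mu>_def \<mu>0_def)
    let ?N = "{a\<in>A. \<mu> a < 0}"
    have "?N \<noteq> {}" using neg unfolding lexneg_def by auto
    moreover have finN: "finite ?N" using finite_A by auto
    ultimately have "Min ((\<lambda>a. c a / (- \<mu> a)) ` ?N) \<in> (\<lambda>a. c a / (- \<mu> a)) ` ?N"
      and Min: "\<And>a. a \<in> ?N \<Longrightarrow> Min ((\<lambda>a. c a / (- \<mu> a)) ` ?N) \<le> c a / (- \<mu> a)"
      by (metis (no_types, lifting) Min_in finite_imageI image_is_empty,
          metis (no_types, lifting) Min_le finN finite_imageI imageI)
    then obtain m where "m \<in> ?N" "Min ((\<lambda>a. c a / (- \<mu> a)) ` ?N) = c m / (- \<mu> m)"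
      by (metis (no_types, lifting) imageE)
    then have m: "m \<in> A" "\<mu> m < 0" "\<And>a. a \<in> ?N \<Longrightarrow> c m / (- \<mu> m) \<le> c a / (- \<mu> a)"
      using Min by auto
    \<comment> \<open>The ratio test of the simplex method: \<open>m\<close> is a generator whose
      coefficient reaches 0 first. As \<open>\<mu>\<close> lives on the support of \<open>c\<close>,
      the support shrinks strictly.\<close>
    define t where "t = c m / (- \<mu> m)"
    have "c m > 0" using m less.prems supp[of m] by (metis less_irrefl less_le)
    then have t: "t > 0" using m \<open>c m > 0\<close> unfolding t_def by (intro divide_pos_pos) auto
    define c1 where "c1 = (\<lambda>a. c a + t * \<mu> a)"
    have c1: "\<forall>a\<in>A. 0 \<le> c1 a"
    proof
      fix a assume a: "a \<in> A"
      show "0 \<le> c1 a"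
      proof (cases "\<mu> a < 0")
        case True
        then have "t \<le> c a / (- \<mu> a)" using m(3) a by (auto simp: t_def)
        then show ?thesis using True by (simp add: c1_def field_simps)
      next
        case False
        then show ?thesis using t less.prems a by (simp add: c1_def)
      qed
    qed
    have "{a\<in>A. c1 a \<noteq> 0} \<subset> ?S"
    proof
      show "{a\<in>A. c1 a \<noteq> 0} \<subseteq> ?S" using supp by (auto simp: c1_def)
      have "m \<in> ?S" using \<open>c m > 0\<close> m by auto
      moreover have "c1 m = 0" using m by (simp add: c1_def t_def)
      ultimately show "{a\<in>A. c1 a \<noteq> 0} \<noteq> ?S" by auto
    qed
    then have "card {a\<in>A. c1 a \<noteq> 0} < card ?S" using finS by (rule psubset_card_mono[rotated])
    from less.hyps[OF this c1] obtain c' where c':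
      "\<forall>a\<in>A. 0 \<le> c' a" "lc c' = lc c1" "independent {a\<in>A. c' a \<noteq> 0}"
      "c' = c1 \<or> lexneg (\<lambda>x. c' x - c1 x)" by blast
    have lc1: "lc c1 = lc c" unfolding c1_def lc_add lc_scale lc0 by simp
    have n1: "lexneg (\<lambda>x. c1 x - c x)" using lexneg_scale[OF neg t] by (simp add: c1_def)
    have "lexneg (\<lambda>x. c' x - c x)"
      using c'(4)
    proof
      assume "lexneg (\<lambda>x. c' x - c1 x)"
      from lexneg_add[OF this n1] show ?thesis by simp
    qed (use n1 in auto)
    then show ?thesis using c' lc1 by auto
  qed
qed

lemma lex_basesD:
  assumes "I \<in> lex_bases"
  shows "I \<subseteq> A" "independent I" "span I = span A" "finite I"
    "lc \<mu> = 0 \<Longrightarrow> lexneg \<mu> \<Longrightarrow> \<exists>a\<in>A - I. \<mu> a < 0"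
  using assms finite_A finite_subset unfolding lex_bases_def by auto

text \<open>The difference of the two representations is a dependency, and one of its signs is
  lexicographically negative. Optimality of the subtracted basis demands a negative entry outside
  that basis, where only the other, nonnegative representation is left.\<close>

lemma lex_bases_pos_unique:
  assumes "I \<in> lex_bases" "J \<in> lex_bases"
    and c: "\<And>a. a \<in> I \<Longrightarrow> 0 < c a" "\<And>a. a \<notin> I \<Longrightarrow> c a = 0"
    and d: "\<And>a. a \<in> J \<Longrightarrow> 0 < d a" "\<And>a. a \<notin> J \<Longrightarrow> d a = 0"
    and eq: "lc c = lc d"
  shows "I = J"
proof (rule ccontr)
  assume "I \<noteq> J"
  then obtain a where a: "c a \<noteq> d a" using c d by (metis less_irrefl subsetI subset_antisym)
  have sub: "I \<subseteq> A" "J \<subseteq> A" using assms by (auto simp: lex_bases_def)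
  then have "a \<in> A" using a c(2) d(2) by (metis subsetD)
  moreover have "lc (\<lambda>x. d x - c x) = 0" "lc (\<lambda>x. - (d x - c x)) = 0"
    using eq by (simp_all add: scaleR_diff_left sum_subtractf)
  ultimately consider "lexneg (\<lambda>x. d x - c x)" "lc (\<lambda>x. d x - c x) = 0"
    | "lexneg (\<lambda>x. - (d x - c x))" "lc (\<lambda>x. - (d x - c x)) = 0"
    using lexneg_total[of a "\<lambda>x. d x - c x"] a by auto
  then show False
  proof cases
    case 1
    then obtain b where "b \<in> A - I" "d b - c b < 0" using lex_basesD(5)[OF assms(1) 1(2,1)] by blast
    then show False using c(2)[of b] d[of b] by (cases "b \<in> J") auto
  next
    case 2
    then obtain b where "b \<in> A - J" "- (d b - c b) < 0" using lex_basesD(5)[OF assms(2) 2(2,1)] by blast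
    then show False using d(2)[of b] c[of b] by (cases "b \<in> I") auto
  qed
qed

text \<open>Among the finitely many nonnegative representations of \<open>z\<close> with independent
  support, a lexicographically least one is taken. Genericity forces its support to span, and a
  violation of optimality would produce a smaller representation.\<close>

lemma generic_lex_basis:
  assumes z: "z \<in> cone_points" and gen: "generic z"
  shows "\<exists>I\<in>lex_bases. \<exists>c. (\<forall>a\<in>I. 0 < c a) \<and> (\<forall>a. a \<notin> I \<longrightarrow> c a = 0) \<and> lc c = z"
proof -
  define B where "B = {c. (\<forall>a\<in>A. 0 \<le> c a) \<and> (\<forall>a. a \<notin> A \<longrightarrow> c a = 0) \<and> lc c = z \<and>
    independent {a\<in>A. c a \<noteq> 0}}"
  have reduce: "\<exists>c'\<in>B. (\<forall>a\<in>A. c' a = c a) \<or> lexneg (\<lambda>x. c' x - c x)"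
    if c: "\<forall>a\<in>A. 0 \<le> c a" "lc c = z" for c
  proof -
    from basic_reduction[OF c(1)] obtain c' where c': "\<forall>a\<in>A. 0 \<le> c' a" "lc c' = lc c"
      "independent {a\<in>A. c' a \<noteq> 0}" "c' = c \<or> lexneg (\<lambda>x. c' x - c x)" by blast
    define c2 where "c2 = (\<lambda>a. if a \<in> A then c' a else 0)"
    have "{a\<in>A. c2 a \<noteq> 0} = {a\<in>A. c' a \<noteq> 0}" by (auto simp: c2_def)
    moreover have "lc c2 = z" using c'(2) c(2) by (simp add: c2_def)
    ultimately have "c2 \<in> B" using c' by (auto simp: B_def c2_def)
    moreover have "(\<forall>a\<in>A. c2 a = c a) \<or> lexneg (\<lambda>x. c2 x - c x)"
      using c'(4) lexneg_cong[of "\<lambda>x. c2 x - c x" "\<lambda>x. c' x - c x"] by (auto simp: c2_def)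
    ultimately show ?thesis by auto
  qed
  \<comment> \<open>An independent support determines its coefficients, so \<open>B\<close> is no
    larger than the power set of \<open>A\<close>.\<close>
  have "inj_on (\<lambda>c. {a\<in>A. c a \<noteq> 0}) B"
  proof (rule inj_onI)
    fix c d assume c: "c \<in> B" and d: "d \<in> B" and eq: "{a\<in>A. c a \<noteq> 0} = {a\<in>A. d a \<noteq> 0}"
    let ?S = "{a\<in>A. c a \<noteq> 0}"
    have fin: "finite ?S" using finite_A by auto
    have "(\<Sum>a\<in>?S. (c a - d a) *\<^sub>R a) = lc (\<lambda>a. c a - d a)"
      using finite_A eq by (intro sum.mono_neutral_left) auto
    also have "\<dots> = 0" using c d by (simp add: B_def scaleR_diff_left sum_subtractf)
    finally have sum0: "(\<Sum>a\<in>?S. (c a - d a) *\<^sub>R a) = 0" .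
    have ind: "independent ?S" using c by (simp add: B_def)
    have nz: "c a - d a = 0" if a: "a \<in> ?S" for a
      by (rule independentD[OF ind fin order_refl sum0 a])
    have "c a = d a" if "a \<in> A" for a
    proof (cases "c a = 0")
      case True
      then have "d a = 0" using that eq by blast
      then show ?thesis using True by simp
    next
      case False
      then show ?thesis using nz[of a] that by auto
    qed
    then show "c = d" using c d by (fastforce simp: B_def)
  qed
  moreover have "finite ((\<lambda>c. {a\<in>A. c a \<noteq> 0}) ` B)"
    by (rule finite_subset[of _ "Pow A"]) (auto simp: finite_A)
  ultimately have finB: "finite B" using finite_imageD by blast
  obtain c0 where "\<forall>a\<in>A. 0 \<le> c0 a" "lc c0 = z" using z unfolding cone_points_def by blast
  from reduce[OF this] have "B \<noteq> {}" by auto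
  have "transp_on B (\<lambda>c d. lexneg (\<lambda>x. c x - d x))"
  proof (rule transp_onI)
    fix c d e assume "lexneg (\<lambda>x. c x - d x)" "lexneg (\<lambda>x. d x - e x)"
    from lexneg_add[OF this] show "lexneg (\<lambda>x. c x - e x)" by simp
  qed
  moreover have "asymp_on B (\<lambda>c d. lexneg (\<lambda>x. c x - d x))"
  proof (rule asymp_onI)
    fix c d assume 1: "lexneg (\<lambda>x. c x - d x)"
    show "\<not> lexneg (\<lambda>x. d x - c x)"
      using lexneg_not_both[OF 1] by auto
  qed
  ultimately obtain c where c: "c \<in> B" and cmin: "\<And>d. d \<in> B \<Longrightarrow> d \<noteq> c \<Longrightarrow> \<not> lexneg (\<lambda>x. d x - c x)"
    using Finite_Set.bex_min_element[OF finB _ _ \<open>B \<noteq> {}\<close>, of "\<lambda>c d. lexneg (\<lambda>x. c x - d x)"] by blast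
  define I where "I = {a\<in>A. c a \<noteq> 0}"
  have nl0: "\<not> lexneg (\<lambda>x. 0)" by (auto simp: lexneg_def)
  have "I \<subseteq> A" by (auto simp: I_def)
  have zI: "z \<in> span I"
  proof -
    have "z = (\<Sum>a\<in>I. c a *\<^sub>R a)"
      using c finite_A unfolding B_def I_def by (auto intro!: sum.mono_neutral_right)
    then show ?thesis by (auto intro: span_sum span_scale span_base)
  qed
  have "I \<in> lex_bases"
    unfolding lex_bases_def
  proof (intro CollectI conjI allI impI)
    show "I \<subseteq> A" by fact
    show "independent I" using c by (auto simp: B_def I_def)
    show "span I = span A" using gen zI \<open>I \<subseteq> A\<close> unfolding generic_def by blast
    fix \<mu> assume \<mu>: "lc \<mu> = 0" "lexneg \<mu>"
    show "\<exists>a\<in>A - I. \<mu> a < 0"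
    proof (rule ccontr)
      assume "\<not> ?thesis"
      then have pos: "\<And>a. a \<in> A \<Longrightarrow> a \<notin> I \<Longrightarrow> 0 \<le> \<mu> a" by (meson DiffI not_less)
      \<comment> \<open>The coefficients on \<open>I\<close> are strictly positive and absorb a
        small multiple of \<open>\<mu>\<close>; off \<open>I\<close> the assumed failure keeps
        \<open>\<mu>\<close> nonnegative. The representation \<open>d\<close> reached is then
        reduced back into \<open>B\<close>, below the minimum.\<close>
      have "\<exists>t>0. \<forall>a\<in>I. 0 \<le> c a + t * \<mu> a"
      proof -
        have "\<forall>\<^sub>F t in at_right 0. \<forall>a\<in>I. 0 < c a + t * \<mu> a"
        proof (intro eventually_ball_finite ballI)
          show "finite I" using finite_A \<open>I \<subseteq> A\<close> finite_subset by auto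
          fix a assume "a \<in> I"
          then have "c a > 0" using c by (force simp: B_def I_def)
          moreover have "((\<lambda>t. c a + t * \<mu> a) \<longlongrightarrow> c a + 0 * \<mu> a) (at_right 0)"
            by (intro tendsto_intros)
          ultimately show "\<forall>\<^sub>F t in at_right 0. 0 < c a + t * \<mu> a"
            by (intro order_tendstoD(1)[of _ "c a"]) auto
        qed
        then have "\<forall>\<^sub>F t in at_right 0. (\<forall>a\<in>I. 0 < c a + t * \<mu> a) \<and> 0 < t"
          by (intro eventually_conj eventually_at_right_less)
        then obtain t where "\<forall>a\<in>I. 0 < c a + t * \<mu> a" "0 < t"
          using eventually_happens[of _ "at_right (0::real)"] by force
        then show ?thesis by (intro exI[of _ t]) force
      qed
      then obtain t where t: "t > 0" "\<And>a. a \<in> I \<Longrightarrow> 0 \<le> c a + t * \<mu> a" by auto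
      define d where "d = (\<lambda>a. c a + t * \<mu> a)"
      have "0 \<le> d a" if "a \<in> A" for a
        using t pos[OF that] c that by (cases "a \<in> I") (auto simp: d_def B_def)
      moreover have "lc d = z" unfolding d_def lc_add lc_scale \<mu>(1) using c by (simp add: B_def)
      ultimately obtain e where e: "e \<in> B" "(\<forall>a\<in>A. e a = d a) \<or> lexneg (\<lambda>x. e x - d x)"
        using reduce[of d] by auto
      have dc: "lexneg (\<lambda>x. d x - c x)" using lexneg_scale[OF \<mu>(2) t(1)] by (simp add: d_def)
      have "lexneg (\<lambda>x. e x - c x)"
        using e(2)
      proof
        assume "\<forall>a\<in>A. e a = d a"
        then show ?thesis using dc lexneg_cong[of "\<lambda>x. e x - c x" "\<lambda>x. d x - c x"] by auto
      next
        assume "lexneg (\<lambda>x. e x - d x)"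
        from lexneg_add[OF this dc] show ?thesis by simp
      qed
      then show False using cmin[OF e(1)] nl0 by (cases "e = c") auto
    qed
  qed
  moreover have "\<forall>a\<in>I. 0 < c a" "\<forall>a. a \<notin> I \<longrightarrow> c a = 0" "lc c = z"
    using c by (force simp: B_def I_def)+
  ultimately show ?thesis by blast
qed

lemma cone_pointsI: "x = lc c \<Longrightarrow> \<forall>a\<in>A. 0 \<le> c a \<Longrightarrow> x \<in> cone_points"
  unfolding cone_points_def by blast

lemma pos_pointsI: "x = lc c \<Longrightarrow> \<forall>a\<in>A. 0 < c a \<Longrightarrow> x \<in> pos_points"
  unfolding pos_points_def by blast

lemma finite_lex_bases: "finite lex_bases"
  by (rule finite_subset[of _ "Pow A"]) (auto simp: finite_A dest: lex_basesD(1))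

lemma lc_in_span: "lc c \<in> span A"
  by (auto intro: span_sum span_scale span_base)

lemma representation_lc:
  assumes "I \<in> lex_bases" "\<And>a. a \<notin> I \<Longrightarrow> c a = 0"
  shows "representation I (lc c) = c"
proof (rule representation_eqI)
  note I = lex_basesD[OF assms(1)]
  show "independent I" by (rule I)
  show "lc c \<in> span I" using I(3) lc_in_span by simp
  show "b \<in> I" if "c b \<noteq> 0" for b using assms(2) that by blast
  then have sub: "{b. c b \<noteq> 0} \<subseteq> I" by blast
  then show "finite {b. c b \<noteq> 0}" using I(4) finite_subset by blast
  show "(\<Sum>b | c b \<noteq> 0. c b *\<^sub>R b) = lc c"
    using sub I(1) finite_A by (intro sum.mono_neutral_left) auto
qed

lemma lc_representation:
  assumes "I \<in> lex_bases" "x \<in> span A"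
  shows "lc (representation I x) = x"
  using lex_basesD[OF assms(1)] assms(2) finite_A by (intro sum_representation_eq) auto

text \<open>Otherwise \<open>q\<close> would lie in the span of \<open>I\<close> without
  \<open>a\<close>. Hence \<open>q\<close> is strictly on one side of every wall of every basis
  cone, which settles to which side the wall is assigned.\<close>

lemma generic_representation:
  assumes "I \<in> lex_bases" "generic q" "q \<in> span A" "a \<in> I"
  shows "representation I q a \<noteq> 0"
proof
  assume 0: "representation I q a = 0"
  note I = lex_basesD[OF assms(1)]
  have "q = (\<Sum>b\<in>I. representation I q b *\<^sub>R b)"
    using I assms(3) by (simp add: sum_representation_eq)
  also have "\<dots> = (\<Sum>b\<in>I - {a}. representation I q b *\<^sub>R b)"
    using 0 I(4) by (intro sum.mono_neutral_right) auto
  also have "\<dots> \<in> span (I - {a})"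
    by (rule span_sum, rule span_scale, rule span_base)
  finally have "q \<in> span (I - {a})" .
  moreover have "span (I - {a}) \<noteq> span A"
    using I(1,2) assms(4) by (metis dependent_def span_base subsetD)
  ultimately show False using assms(2) I(1) unfolding generic_def by blast
qed

text \<open>A positive combination along the moment curve avoids the finitely many proper subspaces.\<close>
lemma generic_pos_point: "\<exists>q\<in>pos_points. generic q"
proof -
  define q where "q t = lc (\<lambda>a. t ^ to_nat_on A a)" for t
  have fin: "finite {t. q t \<in> span J}" if J: "J \<subseteq> A" "span J \<noteq> span A" for J
  proof -
    have "span J \<subset> span A" using J by (simp add: psubset_eq span_mono)
    then obtain w where w: "w \<noteq> 0" "w \<in> span A" "\<And>y. y \<in> span J \<Longrightarrow> orthogonal w y"
      using orthogonal_to_subspace_exists_gen by metis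
    have "\<exists>a\<in>A. w \<bullet> a \<noteq> 0"
    proof (rule ccontr)
      assume "\<not> ?thesis"
      then have "orthogonal w w"
        by (intro orthogonal_to_span[OF w(2)]) (auto simp: orthogonal_def)
      then show False using w(1) by (simp add: orthogonal_def)
    qed
    then obtain a0 where a0: "a0 \<in> A" "w \<bullet> a0 \<noteq> 0" by blast
    \<comment> \<open>\<open>poly p t\<close> is \<open>w \<bullet> q t\<close>. Distinct indices
      put the numbers \<open>w \<bullet> a\<close> into distinct degrees, so a single nonzero one
      makes \<open>p\<close> nonzero.\<close>
    define p where "p = (\<Sum>a\<in>A. monom (w \<bullet> a) (to_nat_on A a))"
    have "coeff p (to_nat_on A a0) = (\<Sum>a\<in>A. if a = a0 then w \<bullet> a else 0)"
      unfolding p_def coeff_sum using a0(1) inj_idx by (intro sum.cong) (auto dest: inj_onD)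
    then have "coeff p (to_nat_on A a0) \<noteq> 0"
      using a0 finite_A by simp
    then have "p \<noteq> 0" by auto
    then have "finite {t. poly p t = 0}" by (rule poly_roots_finite)
    moreover have "poly p t = 0" if "q t \<in> span J" for t
    proof -
      have "poly p t = w \<bullet> q t"
        by (simp add: p_def q_def poly_sum poly_monom inner_sum_right mult.commute)
      then show ?thesis using w(3)[OF that] by (simp add: orthogonal_def)
    qed
    ultimately show ?thesis
      using finite_subset[of "{t. q t \<in> span J}" "{t. poly p t = 0}"] by blast
  qed
  have "finite (\<Union>J\<in>{J. J \<subseteq> A \<and> span J \<noteq> span A}. {t. q t \<in> span J})"
    using finite_A fin by (intro finite_UN_I) auto
  then obtain t where t: "t \<in> {0<..} - (\<Union>J\<in>{J. J \<subseteq> A \<and> span J \<noteq> span A}. {t. q t \<in> span J})"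
    using Diff_infinite_finite[OF _ infinite_Ioi[of "0::real"]] infinite_imp_nonempty by blast
  have "q t \<in> pos_points" using t unfolding pos_points_def q_def by auto
  moreover have "generic (q t)" using t by (auto simp: generic_def)
  ultimately show ?thesis by blast
qed

text \<open>Membership in the half-open cone over a basis: the coordinates of \<open>x + \<epsilon> q\<close> are
  positive for all small \<open>\<epsilon> > 0\<close>.\<close>

definition pos_after :: "real \<Rightarrow> real \<Rightarrow> bool" where
  "pos_after s v \<longleftrightarrow> 0 < v \<or> v = 0 \<and> 0 < s"

definition half_open :: "'a \<Rightarrow> 'a set \<Rightarrow> 'a set" where
  "half_open q I = {x \<in> span A. \<forall>a\<in>I. pos_after (representation I q a) (representation I x a)}"

lemma half_open_sub_cone:
  assumes "I \<in> lex_bases" "x \<in> half_open q I"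
  shows "x \<in> cone_points"
proof -
  have "lc (representation I x) = x"
    using assms lc_representation by (auto simp: half_open_def)
  moreover have "0 \<le> representation I x a" for a
    using assms(2) representation_ne_zero[of I x a]
    by (cases "representation I x a = 0") (auto simp: half_open_def pos_after_def)
  ultimately show ?thesis
    unfolding cone_points_def by (intro CollectI exI[of _ "representation I x"]) auto
qed

text \<open>For small t > 0 the point x + t q is generic and still in the cone, hence interior to
  the cone of exactly one basis; \<open>half_open q I\<close> records precisely the sign conditions
  on the coordinates of that point.\<close>

lemma half_open_partition:
  assumes q: "q \<in> pos_points" "generic q" and x: "x \<in> cone_points"
  shows "\<exists>!I. I \<in> lex_bases \<and> x \<in> half_open q I"
proof -
  obtain d where d: "\<forall>a\<in>A. 0 < d a" "q = lc d" using q unfolding pos_points_def by blast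
  obtain c where c: "\<forall>a\<in>A. 0 \<le> c a" "x = lc c" using x unfolding cone_points_def by blast
  have span: "q \<in> span A" "x \<in> span A" using d c lc_in_span by auto
  define Bad where "Bad = (\<Union>J\<in>{J. J \<subseteq> A \<and> span J \<noteq> span A}. {t. x + t *\<^sub>R q \<in> span J})"
  \<comment> \<open>A line in direction \<open>q\<close> meets a proper span at most once, since two
    meeting points would put \<open>q\<close> itself into it.\<close>
  have "finite {t. x + t *\<^sub>R q \<in> span J}" if J: "J \<subseteq> A" "span J \<noteq> span A" for J
  proof -
    have "s = t" if "x + s *\<^sub>R q \<in> span J" "x + t *\<^sub>R q \<in> span J" for s t
    proof (rule ccontr)
      assume "s \<noteq> t"
      have "(x + s *\<^sub>R q) - (x + t *\<^sub>R q) \<in> span J" using that by (rule span_diff)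
      then have "(s - t) *\<^sub>R q \<in> span J" by (simp add: scaleR_diff_left)
      then have "q \<in> span J" using \<open>s \<noteq> t\<close> span_scale[of "(s - t) *\<^sub>R q" J "inverse (s - t)"] by simp
      then show False using q(2) J unfolding generic_def by blast
    qed
    then have "{t. x + t *\<^sub>R q \<in> span J} \<subseteq> {t0}" if "x + t0 *\<^sub>R q \<in> span J" for t0
      using that by blast
    then show ?thesis
      by (metis (no_types, lifting) Collect_empty_eq finite.emptyI finite.insertI finite_subset)
  qed
  then have "finite Bad" using finite_A unfolding Bad_def by (intro finite_UN_I) auto
  note finT = finite_lex_bases
  let ?r = representation
  have "\<forall>\<^sub>F t in at_right 0. \<forall>I\<in>lex_bases. \<forall>a\<in>I.
     (?r I x a > 0 \<longrightarrow> ?r I x a + t * ?r I q a > 0) \<and> (?r I x a < 0 \<longrightarrow> ?r I x a + t * ?r I q a < 0)"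
  proof (intro eventually_ball_finite ballI finT eventually_conj)
    fix I a assume I: "I \<in> lex_bases" "a \<in> I"
    have lim: "((\<lambda>t. ?r I x a + t * ?r I q a) \<longlongrightarrow> ?r I x a + 0 * ?r I q a) (at_right 0)"
      by (intro tendsto_intros)
    show "\<forall>\<^sub>F t in at_right 0. ?r I x a > 0 \<longrightarrow> ?r I x a + t * ?r I q a > 0"
      using order_tendstoD(1)[OF lim, of 0] by (cases "?r I x a > 0") auto
    show "\<forall>\<^sub>F t in at_right 0. ?r I x a < 0 \<longrightarrow> ?r I x a + t * ?r I q a < 0"
      using order_tendstoD(2)[OF lim, of 0] by (cases "?r I x a < 0") auto
  qed (use lex_basesD(4) in auto)
  moreover have "\<forall>\<^sub>F t in at_right 0. t \<notin> Bad" by (rule eventually_avoid_finite) fact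
  moreover have "\<forall>\<^sub>F t in at_right (0::real). 0 < t" by (rule eventually_at_right_less)
  ultimately have "\<forall>\<^sub>F t in at_right 0. (\<forall>I\<in>lex_bases. \<forall>a\<in>I.
     (?r I x a > 0 \<longrightarrow> ?r I x a + t * ?r I q a > 0) \<and> (?r I x a < 0 \<longrightarrow> ?r I x a + t * ?r I q a < 0))
     \<and> t \<notin> Bad \<and> 0 < t" by (intro eventually_conj)
  from eventually_happens'[OF _ this] obtain t where
    t: "\<And>I a. I \<in> lex_bases \<Longrightarrow> a \<in> I \<Longrightarrow> ?r I x a > 0 \<Longrightarrow> ?r I x a + t * ?r I q a > 0"
       "\<And>I a. I \<in> lex_bases \<Longrightarrow> a \<in> I \<Longrightarrow> ?r I x a < 0 \<Longrightarrow> ?r I x a + t * ?r I q a < 0"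
       "t \<notin> Bad" "0 < t" by auto
  define z where "z = x + t *\<^sub>R q"
  have rz: "?r I z a = ?r I x a + t * ?r I q a" if "I \<in> lex_bases" for I a
    using lex_basesD(2,3)[OF that] span
    by (simp add: z_def representation_add representation_scale span_scale)
  \<comment> \<open>With \<open>t\<close> this small a nonzero coordinate of \<open>x\<close> keeps
    its sign, and a zero coordinate takes the sign of the coordinate of \<open>q\<close>.\<close>
  have half: "x \<in> half_open q I \<longleftrightarrow> (\<forall>a\<in>I. 0 < ?r I z a)" if I: "I \<in> lex_bases" for I
  proof -
    have "pos_after (?r I q a) (?r I x a) \<longleftrightarrow> 0 < ?r I z a" if "a \<in> I" for a
      using t(1,2)[OF I that] t(4) rz[OF I, of a] unfolding pos_after_def
      by (cases "?r I x a" "0::real" rule: linorder_cases) (auto simp: zero_less_mult_iff)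
    then show ?thesis using span unfolding half_open_def by auto
  qed
  have "z = lc (\<lambda>a. c a + t * d a)" by (simp only: lc_add lc_scale z_def c(2) d(2))
  moreover have "\<forall>a\<in>A. 0 \<le> c a + t * d a" using c(1) d(1) t(4) by (simp add: less_imp_le)
  ultimately have zc: "z \<in> cone_points" by (rule cone_pointsI)
  have zg: "generic z" using t(3) unfolding generic_def Bad_def z_def by auto
  obtain I e where I: "I \<in> lex_bases" "\<forall>a\<in>I. 0 < e a" "\<forall>a. a \<notin> I \<longrightarrow> e a = 0" "lc e = z"
    using generic_lex_basis[OF zc zg] by blast
  have "?r I z = e" using representation_lc[OF I(1), of e] I by simp
  then have "x \<in> half_open q I" using half[OF I(1)] I(2) by simp
  moreover have "J = I" if J: "J \<in> lex_bases" "x \<in> half_open q J" for J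
  proof (rule lex_bases_pos_unique[OF J(1) I(1)])
    show "0 < ?r J z a" if "a \<in> J" for a using half[OF J(1)] J(2) that by blast
    show "?r J z a = 0" if "a \<notin> J" for a using representation_ne_zero[of J z a] that by blast
    show "lc (?r J z) = lc e" using lc_representation[OF J(1), of z] I(4) lc_in_span by auto
  qed (use I in auto)
  ultimately show ?thesis using I(1) by blast
qed

end

section \<open>Lattice points of the cone, graded by height\<close>

locale lattice_generators = finite_generators A for A :: "'a::euclidean_space set" +
  fixes L :: "'a set" and ht :: "'a \<Rightarrow> real"
  assumes A_nonempty: "A \<noteq> {}" and A_sub: "A \<subseteq> L"
    and L_add: "x \<in> L \<Longrightarrow> y \<in> L \<Longrightarrow> x + y \<in> L"
    and L_diff: "x \<in> L \<Longrightarrow> y \<in> L \<Longrightarrow> x - y \<in> L"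
    and L_discrete: "bounded X \<Longrightarrow> finite (X \<inter> L)"
    and linear_ht: "linear ht" and ht_A: "a \<in> A \<Longrightarrow> ht a = 1"
begin

text \<open>In the application \<open>A\<close> is a generating set of a lattice polytope F placed
  at height 1, and the slice at height k is a copy of the lattice points of kF.\<close>

definition slice :: "nat \<Rightarrow> 'a set" where
  "slice k = {x \<in> cone_points \<inter> L. ht x = real k}"

text \<open>The condition \<open>\<not> pos_after s (v - 1)\<close> puts \<open>v\<close> into the half-open unit interval,
  \<open>[0, 1)\<close> or \<open>(0, 1]\<close> according to the sign of \<open>s\<close>.\<close>

definition cell :: "'a \<Rightarrow> 'a set \<Rightarrow> 'a set \<Rightarrow> nat \<Rightarrow> 'a set" where
  "cell q I J k = {x \<in> half_open q I \<inter> L. ht x = real k \<and>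
     (\<forall>a\<in>J. \<not> pos_after (representation I q a) (representation I x a - 1))}"

lemma ht_lc: "ht (lc c) = sum c A"
  by (simp add: linear_sum[OF linear_ht] linear_cmul[OF linear_ht] ht_A)

lemma ht_nonneg: "x \<in> cone_points \<Longrightarrow> 0 \<le> ht x"
  unfolding cone_points_def by (auto simp: ht_lc intro!: sum_nonneg)

lemma ht_pos: "x \<in> pos_points \<Longrightarrow> 0 < ht x"
  unfolding pos_points_def using A_nonempty finite_A by (auto simp: ht_lc intro!: sum_pos)

lemma finite_slice: "finite (slice k)"
proof -
  have "norm x \<le> real k * (\<Sum>a\<in>A. norm a)" if x: "x \<in> cone_points" "ht x = real k" for x
  proof -
    obtain c where c: "\<forall>a\<in>A. 0 \<le> c a" "x = lc c" using x(1) unfolding cone_points_def by blast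
    have "c a \<le> real k" if "a \<in> A" for a
      using member_le_sum[of a A c] that c x(2) finite_A by (simp add: ht_lc)
    then have "norm x \<le> (\<Sum>a\<in>A. real k * norm a)"
      unfolding c(2) using c(1) by (intro sum_norm_le) (simp add: mult_right_mono)
    then show ?thesis by (simp add: sum_distrib_left)
  qed
  then have "bounded {x \<in> cone_points. ht x = real k}"
    unfolding bounded_iff by blast
  then have "finite ({x \<in> cone_points. ht x = real k} \<inter> L)" by (rule L_discrete)
  then show ?thesis by (rule rev_finite_subset) (auto simp: slice_def)
qed

lemma cell_sub_slice: "I \<in> lex_bases \<Longrightarrow> cell q I J k \<subseteq> slice k"
  using half_open_sub_cone by (auto simp: cell_def slice_def)

lemma finite_cell: "I \<in> lex_bases \<Longrightarrow> finite (cell q I J k)"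
  using cell_sub_slice finite_slice finite_subset by metis

lemma card_slice:
  assumes q: "q \<in> pos_points" "generic q"
  shows "card (slice k) = (\<Sum>I\<in>lex_bases. card (cell q I {} k))"
proof -
  have "slice k = (\<Union>I\<in>lex_bases. cell q I {} k)"
  proof
    show "slice k \<subseteq> (\<Union>I\<in>lex_bases. cell q I {} k)"
      using half_open_partition[OF q] by (fastforce simp: slice_def cell_def)
  qed (use cell_sub_slice in blast)
  also have "card \<dots> = (\<Sum>I\<in>lex_bases. card (cell q I {} k))"
  proof (rule card_UN_disjoint[OF finite_lex_bases])
    show "\<forall>I\<in>lex_bases. \<forall>J\<in>lex_bases. I \<noteq> J \<longrightarrow> cell q I {} k \<inter> cell q J {} k = {}"
    proof (intro ballI impI, rule ccontr)
      fix I J assume *: "I \<in> lex_bases" "J \<in> lex_bases" "I \<noteq> J" "cell q I {} k \<inter> cell q J {} k \<noteq> {}"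
      then obtain x where x: "x \<in> half_open q I" "x \<in> half_open q J" by (auto simp: cell_def)
      then have "x \<in> cone_points" using half_open_sub_cone *(1) by blast
      from half_open_partition[OF q this] show False using x * by blast
    qed
  qed (use finite_cell in blast)
  finally show ?thesis .
qed

lemma representation_shift:
  assumes "I \<in> lex_bases" "a \<in> I" "x \<in> span A"
  shows "representation I (x - a) b = representation I x b - (if b = a then 1 else 0)"
proof -
  note I = lex_basesD[OF assms(1)]
  have "representation I (x - a) = (\<lambda>b. representation I x b - representation I a b)"
    using I assms by (intro representation_diff) (auto intro: span_base)
  then show ?thesis using representation_basis[OF I(2) assms(2)] by simp
qed

text \<open>A point whose coordinate at \<open>a\<close> lies beyond the half-open unit interval
  stays in the half-open cone after subtracting \<open>a\<close> and drops by one in height; nothing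
  lies below height 0. On generating functions, cutting down to the unit interval is multiplication
  by 1 - X.\<close>

lemma card_cell_step:
  assumes I: "I \<in> lex_bases" and a: "a \<in> I" "a \<notin> J"
  shows "card (cell q I J k) =
    card (cell q I (insert a J) k) + (if k = 0 then 0 else card (cell q I J (k - 1)))"
proof -
  let ?r = "representation I"
  let ?U = "{x \<in> cell q I J k. pos_after (?r q a) (?r x a - 1)}"
  have aA: "a \<in> A" "a \<in> L" "ht a = 1" "a \<in> span A"
    using a lex_basesD(1)[OF I] A_sub ht_A by (auto intro: span_base)
  have hta: "ht (x - a) = ht x - 1" for x using aA by (simp add: linear_diff[OF linear_ht])
  have sh: "?r (x - a) b = ?r x b - (if b = a then 1 else 0)" if "x \<in> span A" for x b
    using representation_shift[OF I a(1) that] .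
  have down: "x - a \<in> half_open q I \<inter> L \<and> (\<forall>b\<in>J. \<not> pos_after (?r q b) (?r (x - a) b - 1))" if "x \<in> ?U" for x
    using that a aA unfolding cell_def half_open_def by (auto simp: sh L_diff span_diff)
  have "card ?U = (if k = 0 then 0 else card (cell q I J (k - 1)))"
  proof (cases "k = 0")
    case True
    have "?U = {}"
    proof (rule ccontr)
      assume "?U \<noteq> {}"
      then obtain x where x: "x \<in> ?U" by blast
      then have "0 \<le> ht (x - a)" using down half_open_sub_cone[OF I] ht_nonneg by blast
      moreover have "ht x = 0" using x True by (simp add: cell_def)
      ultimately show False by (simp add: hta)
    qed
    then show ?thesis using True by (metis card.empty)
  next
    case False
    have "bij_betw (\<lambda>x. x - a) ?U (cell q I J (k - 1))"
    proof (rule bij_betw_byWitness[where f' = "\<lambda>x. x + a"])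
      show "(\<lambda>x. x - a) ` ?U \<subseteq> cell q I J (k - 1)"
      proof (rule image_subsetI)
        fix x assume x: "x \<in> ?U"
        then have "ht (x - a) = real (k - 1)" using False by (simp add: hta cell_def of_nat_diff)
        then show "x - a \<in> cell q I J (k - 1)" using down[OF x] by (simp add: cell_def)
      qed
      show "(\<lambda>x. x + a) ` cell q I J (k - 1) \<subseteq> ?U"
      proof (rule image_subsetI)
        fix y assume y: "y \<in> cell q I J (k - 1)"
        define x where "x = y + a"
        have ys: "y \<in> span A" "y \<in> L" using y by (auto simp: cell_def half_open_def)
        have xs: "x \<in> span A" "x \<in> L" using ys aA by (auto simp: x_def span_add L_add)
        have r: "?r x b = ?r y b + (if b = a then 1 else 0)" for b
          using sh[OF xs(1), of b] by (simp add: x_def)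
        have "ht x = real k" using y False hta[of x] by (simp add: x_def cell_def of_nat_diff)
        moreover have "pos_after s (v + 1)" if "pos_after s v" for s v :: real
          using that by (auto simp: pos_after_def)
        ultimately have "x \<in> ?U" using y xs a unfolding cell_def half_open_def by (auto simp: r)
        then show "y + a \<in> ?U" by (simp only: x_def)
      qed
    qed auto
    then show ?thesis using False bij_betw_same_card by fastforce
  qed
  moreover have "cell q I J k = cell q I (insert a J) k \<union> ?U" "cell q I (insert a J) k \<inter> ?U = {}"
    by (auto simp: cell_def)
  then have "card (cell q I J k) = card (cell q I (insert a J) k) + card ?U"
    using finite_cell[OF I] by (metis (no_types, lifting) card_Un_disjoint finite_Un)
  ultimately show ?thesis by simp
qed

text \<open>Each generator in \<open>J\<close> contributes one factor; at \<open>J = I\<close> only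
  the lattice points of the half-open fundamental parallelepiped remain.\<close>

lemma cell_series:
  assumes I: "I \<in> lex_bases" and J: "finite J" "J \<subseteq> I"
  shows "Abs_fps (\<lambda>k. int (card (cell q I {} k))) * (1 - fps_X) ^ card J =
    Abs_fps (\<lambda>k. int (card (cell q I J k)))"
  using J
proof (induction J rule: finite_induct)
  case empty
  then show ?case by simp
next
  case (insert a J)
  have "Abs_fps (\<lambda>k. int (card (cell q I {} k))) * (1 - fps_X) ^ card (insert a J) =
      Abs_fps (\<lambda>k. int (card (cell q I J k))) * (1 - fps_X)"
    using insert by (simp add: mult.assoc mult.commute)
  also have "\<dots> = Abs_fps (\<lambda>k. int (card (cell q I (insert a J) k)))"
    using card_cell_step[OF I, of a J q] insert
    by (intro fps_ext) (auto simp: right_diff_distrib fps_X_mult_right_nth)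
  finally show ?case .
qed

text \<open>Reflection at the centre of the fundamental parallelepiped turns a lattice point of the
  half-open box into one with positive coefficients.\<close>
lemma cell_reflect:
  assumes q: "q \<in> pos_points" "generic q" and I: "I \<in> lex_bases" and x: "x \<in> cell q I I k"
  shows "\<exists>y\<in>pos_points \<inter> L. ht y = real (card I) - real k"
proof -
  let ?r = "representation I"
  note Ip = lex_basesD[OF I]
  obtain d where d: "\<forall>a\<in>A. 0 < d a" "q = lc d" using q unfolding pos_points_def by blast
  have qs: "q \<in> span A" using d lc_in_span by simp
  have xs: "x \<in> span A" "x \<in> L" "ht x = real k" using x by (auto simp: cell_def half_open_def)
  define y where "y = (\<Sum>a\<in>I. a) - x"
  have I_ne: "I \<noteq> {}"
  proof
    assume "I = {}"
    then have "A \<subseteq> {0}" using Ip(3) span_superset[of A] by simp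
    then have "ht 0 = 1" using A_nonempty ht_A by (metis subset_singletonD singletonI)
    then show False using linear_0[OF linear_ht] by simp
  qed
  have "0 \<in> L" using A_nonempty A_sub L_diff by (metis all_not_in_conv diff_self subsetD)
  have "sum f S \<in> L" if "finite S" "\<And>a. a \<in> S \<Longrightarrow> f a \<in> L" for S and f :: "'a \<Rightarrow> 'a"
    using that by (induction S rule: finite_induct) (auto intro: L_add \<open>0 \<in> L\<close>)
  from this[of I "\<lambda>a. a"] have "(\<Sum>a\<in>I. a) \<in> L" using Ip(1,4) A_sub by blast
  then have "y \<in> L" unfolding y_def using xs(2) by (rule L_diff)
  have "ht y = real (card I) - real k"
  proof -
    have "ht (\<Sum>a\<in>I. a) = (\<Sum>a\<in>I. 1)"
      unfolding linear_sum[OF linear_ht] using Ip(1) ht_A by (intro sum.cong) auto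
    then show ?thesis using xs by (simp add: y_def linear_diff[OF linear_ht])
  qed
  moreover have "y \<in> pos_points"
  proof -
    \<comment> \<open>The half-open condition allows the coordinate 1 only where \<open>q\<close>
      has a negative coordinate; there subtracting t q raises 1 - 1 = 0 to a positive value.\<close>
    have pos: "\<forall>\<^sub>F t in at_right 0. 0 < (1 - ?r x a) - t * ?r q a" if a: "a \<in> I" for a
    proof (cases "?r x a < 1")
      case True
      have "((\<lambda>t. (1 - ?r x a) - t * ?r q a) \<longlongrightarrow> (1 - ?r x a) - 0 * ?r q a) (at_right 0)"
        by (intro tendsto_intros)
      from order_tendstoD(1)[OF this, of 0] show ?thesis using True by simp
    next
      case False
      then have "?r x a = 1" "?r q a < 0"
        using x a generic_representation[OF I q(2) qs a]
        unfolding cell_def pos_after_def by force+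
      then have "0 < (1 - ?r x a) - t * ?r q a" if "0 < t" for t using that by (simp add: mult_pos_neg)
      then show ?thesis using eventually_at_right_less[of 0] by (auto elim: eventually_mono)
    qed
    have "\<forall>\<^sub>F t in at_right 0. \<forall>a\<in>I. 0 < (1 - ?r x a) - t * ?r q a"
      by (intro eventually_ball_finite ballI Ip(4) pos)
    then have "\<forall>\<^sub>F t in at_right 0. (\<forall>a\<in>I. 0 < (1 - ?r x a) - t * ?r q a) \<and> 0 < t"
      by (intro eventually_conj eventually_at_right_less)
    from eventually_happens'[OF _ this] obtain t where
      t: "\<And>a. a \<in> I \<Longrightarrow> 0 < (1 - ?r x a) - t * ?r q a" "0 < t" by auto
    \<comment> \<open>The coordinates of y - t q are positive on \<open>I\<close> only; adding back
      t q, a strictly positive combination of all of \<open>A\<close>, makes every coefficient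
      positive.\<close>
    define c where "c = (\<lambda>a. if a \<in> I then (1 - ?r x a) - t * ?r q a else 0)"
    have "lc c = (\<Sum>a\<in>I. c a *\<^sub>R a)"
      using finite_A Ip(1) by (intro sum.mono_neutral_right) (auto simp: c_def)
    also have "\<dots> = (\<Sum>a\<in>I. a) - (\<Sum>a\<in>I. ?r x a *\<^sub>R a) - t *\<^sub>R (\<Sum>a\<in>I. ?r q a *\<^sub>R a)"
      by (simp add: c_def scaleR_diff_left sum_subtractf scaleR_sum_right)
    also have "\<dots> = y - t *\<^sub>R q"
      using Ip xs qs by (simp add: y_def sum_representation_eq)
    finally have "y = lc (\<lambda>a. c a + t * d a)"
      by (simp only: lc_add lc_scale d(2)[symmetric] diff_add_cancel)
    moreover have "\<forall>a\<in>A. 0 < c a + t * d a"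
      using t d by (auto simp: c_def intro!: add_pos_pos)
    ultimately show ?thesis by (rule pos_pointsI)
  qed
  ultimately show ?thesis using \<open>y \<in> L\<close> by blast
qed

text \<open>\<open>h k\<close> counts the lattice points at height k in all the half-open boxes
  together, a sum without signs. A nonzero value therefore yields a box point; its reflection is the
  required interior point, and the positive height of that point bounds k.\<close>

theorem slice_series:
  shows "\<exists>h. Abs_fps (\<lambda>k. int (card (slice k))) * (1 - fps_X) ^ dim A = Abs_fps h \<and>
    (\<forall>k. h k \<noteq> 0 \<longrightarrow> k < dim A \<and> (\<exists>y\<in>pos_points \<inter> L. ht y = real (dim A) - real k))"
proof -
  obtain q where q: "q \<in> pos_points" "generic q" using generic_pos_point by blast
  have card_I: "card I = dim A" if "I \<in> lex_bases" for I
    using lex_basesD[OF that] by (metis dim_eq_card)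
  define h where "h k = (\<Sum>I\<in>lex_bases. int (card (cell q I I k)))" for k
  have "Abs_fps (\<lambda>k. int (card (slice k))) = (\<Sum>I\<in>lex_bases. Abs_fps (\<lambda>k. int (card (cell q I {} k))))"
    by (rule fps_ext) (simp add: card_slice[OF q] fps_sum_nth)
  also have "\<dots> * (1 - fps_X) ^ dim A = (\<Sum>I\<in>lex_bases. Abs_fps (\<lambda>k. int (card (cell q I I k))))"
    unfolding sum_distrib_right
    using cell_series[of _ _ q] lex_basesD(4) card_I by (intro sum.cong) (metis order_refl)+
  also have "\<dots> = Abs_fps h"
    by (rule fps_ext) (simp add: h_def fps_sum_nth)
  finally have "Abs_fps (\<lambda>k. int (card (slice k))) * (1 - fps_X) ^ dim A = Abs_fps h" .
  moreover have "k < dim A \<and> (\<exists>y\<in>pos_points \<inter> L. ht y = real (dim A) - real k)" if hk: "h k \<noteq> 0" for k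
  proof -
    obtain I where I: "I \<in> lex_bases" "int (card (cell q I I k)) \<noteq> 0"
      using hk unfolding h_def by (metis (no_types, lifting) sum.neutral)
    then obtain x where "x \<in> cell q I I k" by (metis card.empty ex_in_conv of_nat_0)
    from cell_reflect[OF q I(1) this] obtain y where
      y: "y \<in> pos_points \<inter> L" "ht y = real (dim A) - real k" using card_I[OF I(1)] by auto
    moreover have "0 < ht y" using y ht_pos by blast
    ultimately show ?thesis by auto
  qed
  ultimately show ?thesis by blast
qed

end

section \<open>Ehrhart series of lattice polytopes\<close>

lemma integer_points_add: "x \<in> integer_points \<Longrightarrow> y \<in> integer_points \<Longrightarrow> x + y \<in> integer_points"
  and integer_points_diff: "x \<in> integer_points \<Longrightarrow> y \<in> integer_points \<Longrightarrow> x - y \<in> integer_points"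
  and integer_points_scale: "r \<in> \<int> \<Longrightarrow> x \<in> integer_points \<Longrightarrow> r *\<^sub>R x \<in> integer_points"
  by (auto simp: integer_points_def)

lemma integer_points_sum:
  "(\<And>i. i \<in> I \<Longrightarrow> f i \<in> integer_points) \<Longrightarrow> sum f I \<in> integer_points"
  by (auto simp: integer_points_def intro!: Ints_sum)

lemma finite_bounded_integer_points:
  fixes X :: "(real ^ 'n) set"
  assumes "bounded X"
  shows "finite (X \<inter> integer_points)"
proof -
  obtain B where B: "\<And>x. x \<in> X \<Longrightarrow> norm x \<le> B" using assms unfolding bounded_iff by blast
  define N where "N = \<lceil>B\<rceil>"
  let ?G = "PiE (UNIV :: 'n set) (\<lambda>_. {- N..N})"
  have "finite ?G" by (intro finite_PiE) auto
  moreover have "X \<inter> integer_points \<subseteq> (\<lambda>f. \<chi> i. of_int (f i)) ` ?G"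
  proof
    fix x assume x: "x \<in> X \<inter> integer_points"
    then have xi: "of_int \<lfloor>x $ i\<rfloor> = x $ i" for i by (auto simp: integer_points_def elim: Ints_cases)
    have "\<bar>x $ i\<bar> \<le> B" for i using B[of x] x component_le_norm_cart[of x i] by auto
    moreover have "B \<le> of_int N" by (simp add: N_def)
    ultimately have "\<bar>x $ i\<bar> \<le> of_int N" for i by (meson order_trans)
    then have le: "\<bar>real_of_int \<lfloor>x $ i\<rfloor>\<bar> \<le> of_int N" for i by (simp only: xi)
    have "\<lfloor>x $ i\<rfloor> \<in> {- N..N}" for i
      using le[of i] by (simp only: of_int_abs[symmetric] of_int_le_iff) (simp add: abs_le_iff)
    then have "(\<lambda>i. \<lfloor>x $ i\<rfloor>) \<in> ?G" by auto
    moreover have "x = (\<chi> i. of_int \<lfloor>x $ i\<rfloor>)" by (simp only: vec_eq_iff vec_lambda_beta xi) simp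
    ultimately show "x \<in> (\<lambda>f. \<chi> i. of_int (f i)) ` ?G" by (intro image_eqI[of _ _ "\<lambda>i. \<lfloor>x $ i\<rfloor>"])
  qed
  ultimately show ?thesis by (meson finite_imageI finite_subset)
qed

text \<open>The lifted points lie in a hyperplane that misses the origin, so adjoining the origin
  raises the affine dimension by one and turns it into a linear dimension.\<close>

lemma dim_homogenize:
  fixes S :: "'a::euclidean_space set"
  assumes "S \<noteq> {}"
  shows "int (dim ((\<lambda>s. (s, 1::real)) ` S)) = aff_dim S + 1"
proof -
  let ?A = "(\<lambda>s. (s, 1::real)) ` S"
  have "?A = (+) (0, 1) ` (\<lambda>s. (s, 0)) ` S" by (auto simp: image_image)
  then have "aff_dim ?A = aff_dim ((\<lambda>s. (s, 0::real)) ` S)" by (simp only: aff_dim_translation_eq)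
  also have "\<dots> = aff_dim S"
    by (intro aff_dim_injective_linear_image) (auto simp: inj_def intro!: linearI)
  finally have aff: "aff_dim ?A = aff_dim S" .
  have "affine {z :: 'a \<times> real. snd z = 1}" unfolding affine_alt by (auto simp: algebra_simps)
  then have "affine hull ?A \<subseteq> {z. snd z = 1}" by (intro hull_minimal) auto
  then have "0 \<notin> affine hull ?A" by auto
  then have "aff_dim (insert 0 ?A) = aff_dim S + 1" using aff aff_dim_insert[of 0 ?A] by simp
  moreover have "aff_dim (insert 0 ?A) = int (dim (insert 0 ?A))"
    by (rule aff_dim_zero) (simp add: hull_inc)
  moreover have "dim (insert 0 ?A) = dim ?A" by (metis dim_span span_insert_0)
  ultimately show ?thesis by simp
qed

text \<open>Obtained from the cone over F at height 1. The relative interior point of (D + 1 - k) F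
  is kept as a combination with positive coefficients on all of \<open>S\<close>, because the later
  facet argument needs every generator to take part.\<close>

lemma ehrhart_series_rational:
  fixes S :: "(real ^ 'n) set"
  assumes S: "finite S" "S \<subseteq> integer_points" "S \<noteq> {}" and F: "F = convex hull S"
  defines "D \<equiv> nat (aff_dim F)"
  shows "\<exists>h. ehrhart_series F * (1 - fps_X) ^ (D + 1) = Abs_fps h \<and>
    (\<forall>k. h k \<noteq> 0 \<longrightarrow> k \<le> D \<and> (\<exists>c. (\<forall>s\<in>S. 0 < c s) \<and> sum c S = real (D + 1 - k) \<and>
      (\<Sum>s\<in>S. c s *\<^sub>R s) \<in> integer_points))"
proof -
  let ?e = "\<lambda>s :: real ^ 'n. (s, 1::real)"
  let ?L = "(integer_points :: (real ^ 'n) set) \<times> (\<int> :: real set)"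
  have inj: "inj_on ?e S" by (auto simp: inj_on_def)
  interpret finite_generators "?e ` S" using S(1) by unfold_locales auto
  interpret lattice_generators "?e ` S" ?L snd
  proof
    show "finite (X \<inter> ?L)" if X: "bounded X" for X
    proof -
      obtain N where N: "\<And>y. y \<in> snd ` X \<Longrightarrow> \<bar>y\<bar> \<le> N"
        using bounded_snd[OF X] unfolding bounded_iff by auto
      have "finite ((fst ` X \<inter> integer_points) \<times> {x \<in> \<int>. -N \<le> x \<and> x \<le> N})"
        using X by (intro finite_cartesian_product finite_bounded_integer_points bounded_fst
            finite_int_segment)
      then show ?thesis
        by (rule finite_subset[rotated]) (use N in \<open>force simp: abs_le_iff\<close>)
    qed
  qed (use S in \<open>auto simp: integer_points_add integer_points_diff intro!: linearI\<close>)
  have lc_eq: "lc c = ((\<Sum>s\<in>S. c (?e s) *\<^sub>R s), \<Sum>s\<in>S. c (?e s))" for c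
    using inj by (simp add: sum.reindex prod_eq_iff fst_sum snd_sum)
  have D: "dim (?e ` S) = D + 1"
  proof -
    have "0 \<le> aff_dim S" using S(3) aff_dim_negative_iff[of S] by linarith
    then show ?thesis using dim_homogenize[OF S(3)] unfolding D_def F by (simp add: aff_dim_convex_hull)
  qed
  have slice: "slice k = (\<lambda>x. (x, real k)) ` (dilate k F \<inter> integer_points)" for k
  proof -
    have "(x, real k) \<in> cone_points \<longleftrightarrow> x \<in> dilate k F" for x
    proof
      assume "(x, real k) \<in> cone_points"
      then obtain c where c: "\<forall>a\<in>?e ` S. 0 \<le> c a" "(x, real k) = lc c"
        unfolding cone_points_def by blast
      define u where "u s = c (?e s)" for s
      have u: "\<And>s. s \<in> S \<Longrightarrow> 0 \<le> u s" "x = (\<Sum>s\<in>S. u s *\<^sub>R s)" "real k = sum u S"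
        using c unfolding lc_eq u_def by auto
      show "x \<in> dilate k F"
      \<comment> \<open>At height 0 all coefficients vanish; the zeroth dilate is the single point 0
        because \<open>F\<close> is nonempty.\<close>
      proof (cases "k = 0")
        case True
        then have "\<forall>s\<in>S. u s = 0" using u S(1) by (simp add: sum_nonneg_eq_0_iff)
        then have "x = 0" using u by simp
        moreover have "F \<noteq> {}" using S(3) F by simp
        ultimately show ?thesis using True by (auto simp: dilate_def)
      next
        case False
        have "(\<Sum>s\<in>S. (u s / real k) *\<^sub>R s) \<in> F"
          unfolding F convex_hull_finite[OF S(1)] using u False
          by (auto simp: sum_divide_distrib[symmetric] intro!: exI[of _ "\<lambda>s. u s / real k"])
        moreover have "x = real k *\<^sub>R (\<Sum>s\<in>S. (u s / real k) *\<^sub>R s)"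
          using False u(2) by (simp add: scaleR_sum_right)
        ultimately show ?thesis unfolding dilate_def by blast
      qed
    next
      assume "x \<in> dilate k F"
      then obtain u where u: "\<forall>s\<in>S. 0 \<le> u s" "sum u S = 1" "x = real k *\<^sub>R (\<Sum>s\<in>S. u s *\<^sub>R s)"
        unfolding dilate_def F convex_hull_finite[OF S(1)] by blast
      show "(x, real k) \<in> cone_points"
      proof (rule cone_pointsI)
        show "(x, real k) = lc (\<lambda>z. real k * u (fst z))"
          unfolding lc_eq using u by (simp add: scaleR_sum_right sum_distrib_left[symmetric])
        show "\<forall>a\<in>?e ` S. 0 \<le> real k * u (fst a)" using u by auto
      qed
    qed
    then show ?thesis by (force simp: slice_def)
  qed
  have "card (slice k) = card (dilate k F \<inter> integer_points)" for k
    unfolding slice by (rule card_image) (auto simp: inj_on_def)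
  then have ser: "Abs_fps (\<lambda>k. int (card (slice k))) = ehrhart_series F"
    by (simp add: ehrhart_series_def)
  obtain h where h: "ehrhart_series F * (1 - fps_X) ^ (D + 1) = Abs_fps h"
    "\<And>k. h k \<noteq> 0 \<Longrightarrow> k < D + 1 \<and> (\<exists>y\<in>pos_points \<inter> ?L. snd y = real (D + 1) - real k)"
    using slice_series[unfolded ser D] by blast
  have "k \<le> D \<and> (\<exists>c. (\<forall>s\<in>S. 0 < c s) \<and> sum c S = real (D + 1 - k) \<and>
      (\<Sum>s\<in>S. c s *\<^sub>R s) \<in> integer_points)" if hk: "h k \<noteq> 0" for k
  proof -
    obtain y where y: "k < D + 1" "y \<in> pos_points" "y \<in> ?L" "snd y = real (D + 1) - real k"
      using h(2)[OF hk] by blast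
    then obtain c where "\<forall>a\<in>?e ` S. 0 < c a" "y = lc c" unfolding pos_points_def by blast
    then show ?thesis using y unfolding lc_eq
      by (intro conjI exI[of _ "\<lambda>s. c (?e s)"]) (auto simp: of_nat_diff)
  qed
  then show ?thesis using h(1) by blast
qed

text \<open>Resolves the definite description in \<open>h_star_poly\<close>: the numerator vanishes
  beyond \<open>D\<close>, hence is a polynomial of admissible degree, and injectivity of
  \<open>fps_of_poly\<close> makes it unique.\<close>

lemma
  fixes S :: "(real ^ 'n) set"
  assumes S: "finite S" "S \<subseteq> integer_points" "S \<noteq> {}" and F: "F = convex hull S"
  defines "D \<equiv> nat (aff_dim F)"
  shows h_star_series: "ehrhart_series F * (1 - fps_X) ^ (D + 1) = Abs_fps (h_star F)"
    and h_star_le: "h_star F k \<noteq> 0 \<Longrightarrow> k \<le> D"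
    and h_star_pos_point: "h_star F k \<noteq> 0 \<Longrightarrow> \<exists>c. (\<forall>s\<in>S. 0 < c s) \<and> sum c S = real (D + 1 - k) \<and>
      (\<Sum>s\<in>S. c s *\<^sub>R s) \<in> integer_points"
proof -
  obtain h where h: "ehrhart_series F * (1 - fps_X) ^ (D + 1) = Abs_fps h"
    "\<And>k. h k \<noteq> 0 \<Longrightarrow> k \<le> D \<and> (\<exists>c. (\<forall>s\<in>S. 0 < c s) \<and> sum c S = real (D + 1 - k) \<and>
      (\<Sum>s\<in>S. c s *\<^sub>R s) \<in> integer_points)"
    using ehrhart_series_rational[OF S F] unfolding D_def by blast
  define p where "p = (\<Sum>k\<le>D. monom (h k) k)"
  have cp: "coeff p k = h k" for k
    using h(2)[of k] by (auto simp: p_def coeff_sum)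
  have "degree p \<le> D" by (rule degree_le) (use h(2) cp in \<open>metis not_less\<close>)
  moreover have fp: "fps_of_poly p = Abs_fps h" by (rule fps_ext) (simp add: cp)
  ultimately have hp: "h_star_poly F = p"
    unfolding h_star_poly_def D_def[symmetric] h(1)
    by (intro the_equality) (auto simp: fps_of_poly_eq_iff)
  have hs: "h_star F = h" by (rule ext) (simp add: h_star_def hp cp)
  show "ehrhart_series F * (1 - fps_X) ^ (D + 1) = Abs_fps (h_star F)" using h(1) hs by simp
  show "k \<le> D" if "h_star F k \<noteq> 0" using h(2) hs that by simp
  show "\<exists>c. (\<forall>s\<in>S. 0 < c s) \<and> sum c S = real (D + 1 - k) \<and>
      (\<Sum>s\<in>S. c s *\<^sub>R s) \<in> integer_points" if "h_star F k \<noteq> 0" using h(2) hs that by simp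
qed

section \<open>Faces of simple polytopes\<close>

lemma interior_nonempty_full_dim:
  fixes P :: "'a::euclidean_space set"
  assumes "convex P" "aff_dim P = int DIM('a)"
  shows "interior P \<noteq> {}"
  using assms rel_interior_eq_empty[OF assms(1)] by (auto simp: interior_rel_interior_gen)

text \<open>A point outside \<open>P\<close> meeting all facet inequalities would be joined to an
  interior point by a segment that crosses the boundary in some facet. There the inequality is
  tight, although it is strict at the interior end and holds at the other.\<close>

lemma polytope_halfspaces:
  fixes P :: "'a::euclidean_space set"
  assumes P: "polytope P" and int: "interior P \<noteq> {}"
  obtains a b where
    "\<And>f x. f facet_of P \<Longrightarrow> x \<in> f \<longleftrightarrow> x \<in> P \<and> a f \<bullet> x = b f"
    "\<And>x. x \<in> P \<longleftrightarrow> (\<forall>f. f facet_of P \<longrightarrow> a f \<bullet> x \<le> b f)"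
proof -
  have poly: "polyhedron P" using P by (rule polytope_imp_polyhedron)
  have "\<forall>f. f facet_of P \<longrightarrow> (\<exists>a b. a \<noteq> 0 \<and> P \<subseteq> {x. a \<bullet> x \<le> b} \<and> f = P \<inter> {x. a \<bullet> x = b})"
  proof (intro allI impI)
    fix f assume "f facet_of P"
    from facet_of_polyhedron[OF poly this]
    show "\<exists>a b. a \<noteq> 0 \<and> P \<subseteq> {x. a \<bullet> x \<le> b} \<and> f = P \<inter> {x. a \<bullet> x = b}" by metis
  qed
  then obtain a b where ab: "\<And>f. f facet_of P \<Longrightarrow> a f \<noteq> 0 \<and> P \<subseteq> {x. a f \<bullet> x \<le> b f} \<and> f = P \<inter> {x. a f \<bullet> x = b f}"
    by metis
  have rel: "rel_interior P = interior P" using int by (rule rel_interior_nonempty_interior)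
  show thesis
  proof
    show "x \<in> f \<longleftrightarrow> x \<in> P \<and> a f \<bullet> x = b f" if "f facet_of P" for f x using ab[OF that] by blast
    show "x \<in> P \<longleftrightarrow> (\<forall>f. f facet_of P \<longrightarrow> a f \<bullet> x \<le> b f)" for x
    proof
      assume "x \<in> P" then show "\<forall>f. f facet_of P \<longrightarrow> a f \<bullet> x \<le> b f" using ab by blast
    next
      assume x: "\<forall>f. f facet_of P \<longrightarrow> a f \<bullet> x \<le> b f"
      show "x \<in> P"
      proof (rule ccontr)
        assume nx: "x \<notin> P"
        obtain z where z: "z \<in> interior P" using int by blast
        then have zP: "z \<in> P" using interior_subset by blast
        have "closed_segment z x \<inter> frontier P \<noteq> {}"
          using zP nx by (intro connected_Int_frontier) auto
        then obtain y where y: "y \<in> closed_segment z x" "y \<in> frontier P" by blast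
        have "frontier P = P - rel_interior P"
          using polytope_imp_closed[OF P] by (simp add: frontier_def rel)
        also have "\<dots> = \<Union> {f. f facet_of P}" by (rule rel_boundary_of_polyhedron[OF poly])
        finally obtain f where f: "f facet_of P" "y \<in> f" using y by blast
        have "z \<notin> f" using z rel rel_boundary_of_polyhedron[OF poly] f by blast
        then have az: "a f \<bullet> z < b f" using ab[OF f(1)] zP by fastforce
        obtain t where t: "y = (1 - t) *\<^sub>R z + t *\<^sub>R x" "0 \<le> t" "t \<le> 1"
          using y(1) by (auto simp: in_segment)
        have "a f \<bullet> y = b f" using ab[OF f(1)] f(2) by blast
        then have "(1 - t) * (a f \<bullet> z) + t * (a f \<bullet> x) = b f" unfolding t(1) by (simp add: inner_right_distrib)
        moreover have "t * (a f \<bullet> x) \<le> t * b f" using x f t by (intro mult_left_mono) auto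
        moreover have "t \<noteq> 1" using nx t(1) f(2) facet_of_imp_subset[OF f(1)] by auto
        then have "(1 - t) * (a f \<bullet> z) < (1 - t) * b f" using az t by (intro mult_strict_left_mono) auto
        ultimately show False by (simp add: algebra_simps)
      qed
    qed
  qed
qed

text \<open>At a vertex in exactly \<open>n\<close> facets the facet normals form a basis.\<close>
lemma aff_dim_Inter_facets:
  fixes P :: "(real ^ 'n) set"
  assumes P: "polytope P" and dim: "aff_dim P = int CARD('n)"
    and v: "v extreme_point_of P" "card {f. f facet_of P \<and> v \<in> f} = CARD('n)"
    and \<Psi>: "\<Psi> \<subseteq> {f. f facet_of P \<and> v \<in> f}"
  shows "aff_dim (P \<inter> \<Inter>\<Psi>) = int CARD('n) - int (card \<Psi>)"
proof -
  define \<Phi> where "\<Phi> = {f. f facet_of P \<and> v \<in> f}"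
  have int: "interior P \<noteq> {}"
    using dim by (intro interior_nonempty_full_dim polytope_imp_convex P) simp
  have poly: "polyhedron P" using P by (rule polytope_imp_polyhedron)
  have fin: "finite {f. f facet_of P}" using finite_polytope_facets[OF P] .
  have fin\<Phi>: "finite \<Phi>" using fin by (simp add: \<Phi>_def)
  obtain a b where f: "\<And>f x. f facet_of P \<Longrightarrow> x \<in> f \<longleftrightarrow> x \<in> P \<and> a f \<bullet> x = b f"
    and Peq: "\<And>x. x \<in> P \<longleftrightarrow> (\<forall>f. f facet_of P \<longrightarrow> a f \<bullet> x \<le> b f)"
    using polytope_halfspaces[OF P int] by metis
  have vP: "v \<in> P" using v(1) by (simp add: extreme_point_of_def)
  have v\<Phi>: "a f \<bullet> v = b f" if "f \<in> \<Phi>" for f using that f unfolding \<Phi>_def by blast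
  have vlt: "a g \<bullet> v < b g" if "g facet_of P" "g \<notin> \<Phi>" for g
  proof -
    have "a g \<bullet> v \<le> b g" using Peq vP that(1) by blast
    moreover have "a g \<bullet> v \<noteq> b g" using that f[OF that(1), of v] vP by (simp add: \<Phi>_def)
    ultimately show ?thesis by simp
  qed
  have near: "\<exists>t>0. \<forall>g. g facet_of P \<longrightarrow> g \<notin> \<Phi> \<longrightarrow> a g \<bullet> (v + t *\<^sub>R u) < b g" for u
  proof -
    have "\<forall>\<^sub>F t in at_right 0. \<forall>g\<in>{g. g facet_of P} - \<Phi>. a g \<bullet> (v + t *\<^sub>R u) < b g"
    proof (intro eventually_ball_finite ballI)
      fix g assume "g \<in> {g. g facet_of P} - \<Phi>"
      moreover have "((\<lambda>t. a g \<bullet> (v + t *\<^sub>R u)) \<longlongrightarrow> a g \<bullet> (v + 0 *\<^sub>R u)) (at_right 0)"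
        by (intro tendsto_intros)
      ultimately show "\<forall>\<^sub>F t in at_right 0. a g \<bullet> (v + t *\<^sub>R u) < b g"
        using vlt[of g] by (intro order_tendstoD(2)[where y = "a g \<bullet> v"]) auto
    qed (use fin in auto)
    then have "\<forall>\<^sub>F t in at_right 0. (\<forall>g\<in>{g. g facet_of P} - \<Phi>. a g \<bullet> (v + t *\<^sub>R u) < b g) \<and> 0 < t"
      by (intro eventually_conj eventually_at_right_less)
    from eventually_happens'[OF _ this] show ?thesis by auto
  qed
  have "{v} face_of P" using v(1) face_of_singleton by blast
  moreover have "{v} \<noteq> P" using dim aff_dim_sing[of v] by auto
  ultimately have "{v} = \<Inter>{f. f facet_of P \<and> {v} \<subseteq> f}"
    using face_of_polyhedron[OF poly] by blast
  then have v_eq: "\<Inter>\<Phi> = {v}" by (simp add: \<Phi>_def)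
  \<comment> \<open>A nonzero direction orthogonal to all normals at \<open>v\<close> would lead to
    further points of all facets through \<open>v\<close>, whose intersection is \<open>{v}\<close>.
    So the normals span, and being \<open>CARD('n)\<close> many they form a basis.\<close>
  have W: "u = 0" if u: "\<forall>f\<in>\<Phi>. a f \<bullet> u = 0" for u
  proof -
    obtain t where t: "t > 0" "\<And>g. g facet_of P \<Longrightarrow> g \<notin> \<Phi> \<Longrightarrow> a g \<bullet> (v + t *\<^sub>R u) < b g"
      using near[of u] by blast
    have eq: "a g \<bullet> (v + t *\<^sub>R u) = b g" if "g \<in> \<Phi>" for g using u v\<Phi> that by (simp add: inner_right_distrib)
    have "v + t *\<^sub>R u \<in> P" unfolding Peq using t(2) eq by (metis less_le order_refl)
    then have "v + t *\<^sub>R u \<in> \<Inter>\<Phi>" using eq f unfolding \<Phi>_def by blast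
    then show ?thesis using v_eq t(1) by auto
  qed
  have "dim {y \<in> UNIV. \<forall>x\<in>span (a ` \<Phi>). orthogonal x y} + dim (span (a ` \<Phi>)) = dim (UNIV :: (real ^ 'n) set)"
    by (intro dim_subspace_orthogonal_to_vectors) auto
  moreover have "{y \<in> UNIV. \<forall>x\<in>span (a ` \<Phi>). orthogonal x y} \<subseteq> {0}"
    using W by (auto simp: orthogonal_def intro: span_base)
  then have "dim {y \<in> UNIV. \<forall>x\<in>span (a ` \<Phi>). orthogonal x y} = 0" by (simp only: dim_eq_0)
  ultimately have "dim (a ` \<Phi>) = CARD('n)" by (simp only: dim_span add_0) simp
  moreover have "dim (a ` \<Phi>) \<le> card (a ` \<Phi>)" "card (a ` \<Phi>) \<le> card \<Phi>"
    using fin\<Phi> by (auto intro: dim_le_card' card_image_le)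
  ultimately have card: "card (a ` \<Phi>) = card \<Phi>" "dim (a ` \<Phi>) = card (a ` \<Phi>)" using v(2) by (auto simp: \<Phi>_def)
  have inj: "inj_on a \<Phi>" using fin\<Phi> card(1) by (intro eq_card_imp_inj_on)
  have ind: "independent (a ` \<Phi>)"
    using card(2) fin\<Phi> by (intro card_le_dim_spanning[where V = "span (a ` \<Phi>)"]) (auto intro: span_base)
  define L where "L = {x. \<forall>f\<in>\<Psi>. a f \<bullet> x = b f}"
  have \<Psi>\<Phi>: "\<Psi> \<subseteq> \<Phi>" using \<Psi> by (simp add: \<Phi>_def)
  have affL: "affine L" unfolding L_def affine_alt
    by (auto simp: inner_add_right inner_diff_right algebra_simps)
  have "L = (+) v ` {y \<in> UNIV. \<forall>x\<in>span (a ` \<Psi>). orthogonal x y}"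
  proof (intro subset_antisym subsetI)
    fix x assume x: "x \<in> L"
    have "orthogonal (x - v) y" if "y \<in> span (a ` \<Psi>)" for y
    proof (rule orthogonal_to_span[OF that])
      fix z assume "z \<in> a ` \<Psi>"
      then obtain f where "f \<in> \<Psi>" "z = a f" by blast
      then have "z \<bullet> x = b f" "z \<bullet> v = b f" using x v\<Phi>[of f] \<Psi>\<Phi> unfolding L_def by auto
      then show "orthogonal (x - v) z"
        by (simp add: orthogonal_def inner_diff_right inner_commute[of _ z])
    qed
    then have "\<forall>y\<in>span (a ` \<Psi>). orthogonal y (x - v)" by (simp add: orthogonal_commute)
    then show "x \<in> (+) v ` {y \<in> UNIV. \<forall>x\<in>span (a ` \<Psi>). orthogonal x y}"
      by (intro image_eqI[of _ _ "x - v"]) auto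
  next
    fix x assume "x \<in> (+) v ` {y \<in> UNIV. \<forall>x\<in>span (a ` \<Psi>). orthogonal x y}"
    then show "x \<in> L" using v\<Phi> \<Psi>\<Phi>
      by (auto simp: L_def orthogonal_def inner_add_right span_base subset_iff)
  qed
  then have "aff_dim L = aff_dim {y \<in> UNIV. \<forall>x\<in>span (a ` \<Psi>). orthogonal x y}"
    by (simp only: aff_dim_translation_eq)
  also have "\<dots> = int (dim {y \<in> UNIV. \<forall>x\<in>span (a ` \<Psi>). orthogonal x y})"
    by (intro aff_dim_zero hull_inc) (auto simp: orthogonal_def)
  also have "dim {y \<in> UNIV. \<forall>x\<in>span (a ` \<Psi>). orthogonal x y} + dim (span (a ` \<Psi>)) = dim (UNIV :: (real ^ 'n) set)"
    by (intro dim_subspace_orthogonal_to_vectors) auto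
  then have "int (dim {y \<in> UNIV. \<forall>x\<in>span (a ` \<Psi>). orthogonal x y}) = int CARD('n) - int (dim (a ` \<Psi>))"
    by (simp add: dim_UNIV)
  also have "dim (a ` \<Psi>) = card \<Psi>"
    using dim_eq_card_independent[OF independent_mono[OF ind image_mono[OF \<Psi>\<Phi>]]]
      card_image[OF inj_on_subset[OF inj \<Psi>\<Phi>]] by simp
  finally have dimL: "aff_dim L = int CARD('n) - int (card \<Psi>)" .
  \<comment> \<open>Independence lets the values of a functional on the normals be prescribed. Its
    vector \<open>u\<close> keeps to the facets in \<open>\<Psi>\<close> and moves strictly inside
    the other facets through \<open>v\<close>. Hence \<open>L\<close> meets the open set
    \<open>Q\<close>, and the face has the full dimension of \<open>L\<close>.\<close>
  obtain g :: "real ^ 'n \<Rightarrow> real" where g: "linear g" "\<And>x. x \<in> a ` \<Phi> \<Longrightarrow> g x = (if x \<in> a ` \<Psi> then 0 else -1)"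
    using linear_independent_extend[OF ind, of "\<lambda>x. if x \<in> a ` \<Psi> then 0 else -1 :: real"] by blast
  define u where "u = adjoint g 1"
  have gu: "x \<bullet> u = g x" for x using adjoint_works[OF g(1), of x 1] by (simp add: u_def)
  obtain t where t: "t > 0" "\<And>g. g facet_of P \<Longrightarrow> g \<notin> \<Phi> \<Longrightarrow> a g \<bullet> (v + t *\<^sub>R u) < b g"
    using near[of u] by blast
  define Q where "Q = (\<Inter>f\<in>{f. f facet_of P} - \<Psi>. {x. a f \<bullet> x < b f})"
  have "open Q" unfolding Q_def using fin by (intro open_INT ballI open_halfspace_lt) auto
  have au: "a f \<bullet> u = (if f \<in> \<Psi> then 0 else -1)" if "f \<in> \<Phi>" for f
    using that \<Psi>\<Phi> inj_on_image_mem_iff[OF inj that \<Psi>\<Phi>] by (simp add: gu g(2))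
  have "v + t *\<^sub>R u \<in> L"
    using au v\<Phi> \<Psi>\<Phi> by (auto simp: L_def inner_add_right subset_iff)
  moreover have "a f \<bullet> (v + t *\<^sub>R u) < b f" if "f facet_of P" "f \<notin> \<Psi>" for f
    using t au[of f] v\<Phi>[of f] that by (cases "f \<in> \<Phi>") (auto simp: inner_add_right)
  then have "v + t *\<^sub>R u \<in> Q" by (auto simp: Q_def)
  ultimately have "L \<inter> Q \<noteq> {}" by blast
  then have hull: "affine hull (L \<inter> Q) = L"
    using affine_hull_affine_Int_open[OF affL \<open>open Q\<close>] affL by (simp add: affine_hull_eq)
  have "L \<inter> Q \<subseteq> P \<inter> \<Inter>\<Psi>"
  proof
    fix x assume x: "x \<in> L \<inter> Q"
    then have "a f \<bullet> x \<le> b f" if "f facet_of P" for f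
      using that unfolding L_def Q_def by (cases "f \<in> \<Psi>") (auto intro: less_imp_le)
    then have "x \<in> P" using Peq by blast
    moreover have "x \<in> f" if "f \<in> \<Psi>" for f
      using that x f[of f] \<Psi> \<open>x \<in> P\<close> unfolding L_def by blast
    ultimately show "x \<in> P \<inter> \<Inter>\<Psi>" by blast
  qed
  moreover have "P \<inter> \<Inter>\<Psi> \<subseteq> L"
    using f \<Psi> unfolding L_def by blast
  ultimately have "aff_dim (P \<inter> \<Inter>\<Psi>) = aff_dim L"
    using aff_dim_subset[of "L \<inter> Q" "P \<inter> \<Inter>\<Psi>"] aff_dim_subset[of "P \<inter> \<Inter>\<Psi>" L]
      aff_dim_affine_hull[of "L \<inter> Q"] hull by force
  then show ?thesis using dimL by simp
qed

lemma Inter_facets_face_of: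
  assumes "convex P" "\<Psi> \<subseteq> {f. f facet_of P}"
  shows "P \<inter> \<Inter>\<Psi> face_of P"
proof -
  have "\<Inter>(insert P \<Psi>) face_of P"
    using assms by (intro face_of_Inter) (auto simp: face_of_refl dest: facet_of_imp_face_of)
  then show ?thesis by simp
qed

text \<open>Any vertex of the smallest face through \<open>y\<close> lies in all facets of
  \<open>\<Phi>\<close>, which reduces the dimension formula to a vertex. The formula then separates
  subfamilies: two with the same face share it with their union, hence have the cardinality of the
  union.\<close>

lemma simple_polytope_faces:
  fixes P :: "(real ^ 'n) set"
  assumes P: "polytope P" and dim: "aff_dim P = int CARD('n)" and simple: "simple_polytope P"
    and y: "y \<in> P"
  defines "\<Phi> \<equiv> {f. f facet_of P \<and> y \<in> f}"
  shows aff_dim_simple_face: "\<Psi> \<subseteq> \<Phi> \<Longrightarrow> aff_dim (P \<inter> \<Inter>\<Psi>) = int CARD('n) - int (card \<Psi>)"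
    and bij_simple_faces: "bij_betw (\<lambda>\<Psi>. P \<inter> \<Inter>\<Psi>) (Pow \<Phi>) {F. F face_of P \<and> y \<in> F}"
proof -
  have conv: "convex P" using P by (rule polytope_imp_convex)
  have face: "P \<inter> \<Inter>\<Psi> face_of P" if "\<Psi> \<subseteq> \<Phi>" for \<Psi>
    using that by (intro Inter_facets_face_of[OF conv]) (auto simp: \<Phi>_def)
  have fin: "finite \<Phi>" using finite_polytope_facets[OF P] by (simp add: \<Phi>_def)
  have "y \<in> P \<inter> \<Inter>\<Phi>" using y by (auto simp: \<Phi>_def)
  moreover have "compact (P \<inter> \<Inter>\<Phi>)" "convex (P \<inter> \<Inter>\<Phi>)"
    using face_of_imp_compact[OF conv polytope_imp_compact[OF P] face[of \<Phi>]] face_of_imp_convex[OF face[of \<Phi>]] by auto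
  ultimately obtain v where "v extreme_point_of (P \<inter> \<Inter>\<Phi>)"
    using extreme_point_exists_convex by blast
  then have v: "v extreme_point_of P" "v \<in> P \<inter> \<Inter>\<Phi>"
    using extreme_point_of_face[OF face[of \<Phi>]] by auto
  have card: "card {f. f facet_of P \<and> v \<in> f} = CARD('n)"
    using simple v(1) unfolding simple_polytope_def by blast
  have sub: "\<Phi> \<subseteq> {f. f facet_of P \<and> v \<in> f}" using v(2) by (auto simp: \<Phi>_def)
  show dimF: "aff_dim (P \<inter> \<Inter>\<Psi>) = int CARD('n) - int (card \<Psi>)" if "\<Psi> \<subseteq> \<Phi>" for \<Psi>
    using aff_dim_Inter_facets[OF P dim v(1) card] that sub by (meson subset_trans)
  show "bij_betw (\<lambda>\<Psi>. P \<inter> \<Inter>\<Psi>) (Pow \<Phi>) {F. F face_of P \<and> y \<in> F}"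
    unfolding bij_betw_def
  proof
    show "inj_on (\<lambda>\<Psi>. P \<inter> \<Inter>\<Psi>) (Pow \<Phi>)"
    proof (rule inj_onI)
      fix \<Psi>1 \<Psi>2 assume *: "\<Psi>1 \<in> Pow \<Phi>" "\<Psi>2 \<in> Pow \<Phi>" "P \<inter> \<Inter>\<Psi>1 = P \<inter> \<Inter>\<Psi>2"
      then have "P \<inter> \<Inter>(\<Psi>1 \<union> \<Psi>2) = P \<inter> \<Inter>\<Psi>1" "P \<inter> \<Inter>(\<Psi>1 \<union> \<Psi>2) = P \<inter> \<Inter>\<Psi>2" by blast+
      then have "card (\<Psi>1 \<union> \<Psi>2) = card \<Psi>1" "card (\<Psi>1 \<union> \<Psi>2) = card \<Psi>2"
        using dimF[of "\<Psi>1 \<union> \<Psi>2"] dimF[of \<Psi>1] dimF[of \<Psi>2] * by auto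
      moreover have "finite (\<Psi>1 \<union> \<Psi>2)" using * fin finite_subset by blast
      ultimately have "\<Psi>1 = \<Psi>1 \<union> \<Psi>2" "\<Psi>2 = \<Psi>1 \<union> \<Psi>2"
        by (metis Un_upper1 card_subset_eq, metis Un_upper2 card_subset_eq)
      then show "\<Psi>1 = \<Psi>2" by simp
    qed
    show "(\<lambda>\<Psi>. P \<inter> \<Inter>\<Psi>) ` Pow \<Phi> = {F. F face_of P \<and> y \<in> F}"
    proof (intro subset_antisym subsetI)
      fix F assume "F \<in> (\<lambda>\<Psi>. P \<inter> \<Inter>\<Psi>) ` Pow \<Phi>"
      then show "F \<in> {F. F face_of P \<and> y \<in> F}" using face y by (auto simp: \<Phi>_def)
    next
      fix F assume "F \<in> {F. F face_of P \<and> y \<in> F}"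
      then have F: "F face_of P" "y \<in> F" by auto
      show "F \<in> (\<lambda>\<Psi>. P \<inter> \<Inter>\<Psi>) ` Pow \<Phi>"
      proof (cases "F = P")
        case True
        then show ?thesis by (intro image_eqI[of _ _ "{}"]) auto
      next
        case False
        have "F = \<Inter>{f. f facet_of P \<and> F \<subseteq> f}"
          using face_of_polyhedron[OF polytope_imp_polyhedron[OF P] F(1)] F(2) False by blast
        then have "F = P \<inter> \<Inter>{f. f facet_of P \<and> F \<subseteq> f}"
          using face_of_imp_subset[OF F(1)] by blast
        moreover have "{f. f facet_of P \<and> F \<subseteq> f} \<in> Pow \<Phi>" using F(2) by (auto simp: \<Phi>_def)
        ultimately show ?thesis by (rule image_eqI)
      qed
    qed
  qed
qed

lemma codeg_le_add_facets:
  fixes P :: "(real ^ 'n) set"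
  assumes P: "lattice_polytope P" and dim: "aff_dim P = int CARD('n)"
    and k: "k \<ge> 1" and y: "y \<in> P" "real k *\<^sub>R y \<in> integer_points"
  shows "codeg P \<le> k + card {f. f facet_of P \<and> y \<in> f}"
proof -
  define \<Phi> where "\<Phi> = {f. f facet_of P \<and> y \<in> f}"
  obtain S where S: "finite S" "S \<subseteq> integer_points" "P = convex hull S"
    using P by (auto simp: lattice_polytope_def)
  have pol: "polytope P" using S by (auto simp: polytope_def)
  have fin: "finite \<Phi>" using finite_polytope_facets[OF pol] by (simp add: \<Phi>_def)
  have int: "interior P \<noteq> {}"
    using dim by (intro interior_nonempty_full_dim polytope_imp_convex pol) simp
  obtain a b where f: "\<And>f x. f facet_of P \<Longrightarrow> x \<in> f \<longleftrightarrow> x \<in> P \<and> a f \<bullet> x = b f"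
    and Peq: "\<And>x. x \<in> P \<longleftrightarrow> (\<forall>f. f facet_of P \<longrightarrow> a f \<bullet> x \<le> b f)"
    using polytope_halfspaces[OF pol int] by metis
  have "\<exists>s\<in>S. s \<notin> f" if "f \<in> \<Phi>" for f
  proof (rule ccontr)
    assume "\<not> ?thesis"
    moreover have ff: "f facet_of P" using that by (simp add: \<Phi>_def)
    then have "convex f" using facet_of_imp_face_of face_of_imp_convex by blast
    ultimately have "P \<subseteq> f" unfolding S(3) by (intro hull_minimal) auto
    then have "f = P" using facet_of_imp_subset[OF ff] by blast
    then show False using ff by (simp add: facet_of_def)
  qed
  then obtain s where s: "\<And>f. f \<in> \<Phi> \<Longrightarrow> s f \<in> S \<and> s f \<notin> f" by metis
  have sP: "s f \<in> P" if "f \<in> \<Phi>" for f using s[OF that] S(3) hull_inc by metis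
  define m where "m = k + card \<Phi>"
  define w where "w = real k *\<^sub>R y + (\<Sum>f\<in>\<Phi>. s f)"
  define z where "z = (1 / real m) *\<^sub>R w"
  have m: "real m > 0" using k by (simp add: m_def)
  have lt: "a g \<bullet> z < b g" if g: "g facet_of P" for g
  proof -
    have ys: "a g \<bullet> y \<le> b g" "\<And>f. f \<in> \<Phi> \<Longrightarrow> a g \<bullet> s f \<le> b g" using Peq y(1) sP g by blast+
    have ky: "real k * (a g \<bullet> y) \<le> real k * b g" using ys(1) by (intro mult_left_mono) auto
    have sum: "(\<Sum>f\<in>\<Phi>. a g \<bullet> s f) \<le> (\<Sum>f\<in>\<Phi>. b g)" using ys(2) by (rule sum_mono)
    \<comment> \<open>A facet through \<open>y\<close> gets its strictness from its own summand
      \<open>s g\<close>, any other facet from \<open>y\<close>.\<close>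
    have "a g \<bullet> w < real k * b g + (\<Sum>f\<in>\<Phi>. b g)"
    proof (cases "g \<in> \<Phi>")
      case True
      have "a g \<bullet> s g \<noteq> b g" using f[OF g] s[OF True] sP[OF True] by blast
      then have "(\<Sum>f\<in>\<Phi>. a g \<bullet> s f) < (\<Sum>f\<in>\<Phi>. b g)"
        using ys(2) True by (intro sum_strict_mono_ex1[OF fin]) force+
      then show ?thesis using ky by (simp add: w_def inner_add_right inner_sum_right)
    next
      case False
      then have "a g \<bullet> y \<noteq> b g" using f[OF g] y(1) g by (simp add: \<Phi>_def)
      then have "real k * (a g \<bullet> y) < real k * b g" using ys(1) k by simp
      then show ?thesis using sum by (simp add: w_def inner_add_right inner_sum_right)
    qed
    also have "\<dots> = real m * b g" by (simp add: m_def algebra_simps)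
    finally show ?thesis using m by (simp add: z_def field_simps)
  qed
  have "z \<in> P" using lt Peq by (simp add: less_imp_le)
  moreover have "z \<notin> g" if "g facet_of P" for g using lt[OF that] f[OF that] by auto
  ultimately have "z \<in> rel_interior P"
    using rel_boundary_of_polyhedron[OF polytope_imp_polyhedron[OF pol]] by blast
  then have "z \<in> interior P" using int by (simp add: rel_interior_nonempty_interior)
  then have "real m *\<^sub>R z \<in> interior (dilate m P)"
    unfolding dilate_def using m by (subst interior_injective_linear_image) (auto simp: inj_on_def)
  moreover have "real m *\<^sub>R z = w" using m by (simp add: z_def)
  moreover have "w \<in> integer_points"
    unfolding w_def using y(2) s S(2) by (auto simp: integer_points_def intro!: Ints_add Ints_sum)
  ultimately have "1 \<le> m \<and> interior (dilate m P) \<inter> integer_points \<noteq> {}"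
    using k by (auto simp: m_def)
  then show ?thesis unfolding codeg_def m_def \<Phi>_def by (rule Least_le)
qed

section \<open>Normalized volume and lattice point counts\<close>

lemma emeasure_lborel_divide:
  fixes k :: real
  assumes "k > 0" and [measurable]: "A \<in> sets borel"
  shows "emeasure lborel {x. x / k \<in> A} = ennreal k * emeasure lborel A"
proof -
  have "emeasure lborel {x. x / k \<in> A} =
      emeasure (density (distr lborel borel (\<lambda>x. 0 + k * x)) (\<lambda>_. ennreal \<bar>k\<bar>)) {x. x / k \<in> A}"
    using lborel_real_affine[of k 0] assms(1) by simp
  also have "\<dots> = ennreal k * emeasure (distr lborel borel (\<lambda>x. 0 + k * x)) {x. x / k \<in> A}"
    using assms(1) by (subst emeasure_density) (auto simp: nn_integral_cmult)
  also have "emeasure (distr lborel borel (\<lambda>x. 0 + k * x)) {x. x / k \<in> A} = emeasure lborel A"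
    using assms(1) by (subst emeasure_distr) (auto simp: vimage_def)
  finally show ?thesis .
qed

lemma emeasure_PiM_lborel_divide:
  fixes I :: "'i set" and k :: real
  assumes I: "finite I" and k: "k > 0" and X: "X \<in> sets (Pi\<^sub>M I (\<lambda>_. lborel))"
  shows "emeasure (Pi\<^sub>M I (\<lambda>_. lborel)) {t \<in> space (Pi\<^sub>M I (\<lambda>_. lborel)). (\<lambda>i\<in>I. t i / k) \<in> X} =
    ennreal (k ^ card I) * emeasure (Pi\<^sub>M I (\<lambda>_. lborel)) X"
proof -
  interpret product_sigma_finite "\<lambda>_ :: 'i. lborel :: real measure" by standard
  let ?M = "Pi\<^sub>M I (\<lambda>_. lborel :: real measure)"
  let ?T = "\<lambda>t. \<lambda>i\<in>I. t i / k"
  have T[measurable]: "?T \<in> measurable ?M ?M" by measurable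
  let ?D = "scale_measure (ennreal (1 / k ^ card I)) (distr ?M ?M ?T)"
  have "?D = ?M"
  proof (rule PiM_eqI[OF I])
    fix A :: "'i \<Rightarrow> real set" assume A: "\<And>i. i \<in> I \<Longrightarrow> A i \<in> sets lborel"
    have eq: "?T -` Pi\<^sub>E I A \<inter> space ?M = Pi\<^sub>E I (\<lambda>i. {x. x / k \<in> A i})"
      by (auto simp: space_PiM PiE_iff)
    have "emeasure ?D (Pi\<^sub>E I A) = ennreal (1 / k ^ card I) * emeasure ?M (Pi\<^sub>E I (\<lambda>i. {x. x / k \<in> A i}))"
      using A I by (simp add: emeasure_distr[OF T] sets_PiM_I_finite eq)
    also have "emeasure ?M (Pi\<^sub>E I (\<lambda>i. {x. x / k \<in> A i})) = (\<Prod>i\<in>I. emeasure lborel {x. x / k \<in> A i})"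
    proof (rule emeasure_PiM[OF I])
      fix i assume "i \<in> I"
      then have [measurable]: "A i \<in> sets borel" using A by simp
      show "{x. x / k \<in> A i} \<in> sets lborel" by measurable
    qed
    also have "\<dots> = (\<Prod>i\<in>I. ennreal k * emeasure lborel (A i))"
      using A k by (intro prod.cong emeasure_lborel_divide) auto
    also have "\<dots> = ennreal (k ^ card I) * (\<Prod>i\<in>I. emeasure lborel (A i))"
      using k by (simp add: prod.distrib ennreal_power)
    also have "ennreal (1 / k ^ card I) * \<dots> = (\<Prod>i\<in>I. emeasure lborel (A i))"
      using k by (simp add: mult.assoc[symmetric] ennreal_mult[symmetric])
    finally show "emeasure ?D (Pi\<^sub>E I A) = (\<Prod>i\<in>I. emeasure lborel (A i))" .
  qed simp
  then have "emeasure ?M X = ennreal (1 / k ^ card I) * emeasure (distr ?M ?M ?T) X"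
    by (metis emeasure_scale_measure)
  then have "ennreal (k ^ card I) * emeasure ?M X = emeasure (distr ?M ?M ?T) X"
    using k by (simp add: mult.assoc[symmetric] ennreal_mult[symmetric])
  also have "\<dots> = emeasure ?M (?T -` X \<inter> space ?M)" by (rule emeasure_distr[OF T X])
  also have "?T -` X \<inter> space ?M = {t \<in> space ?M. ?T t \<in> X}" by auto
  finally show ?thesis by simp
qed

text \<open>Unit cubes at the lattice points of \<open>kX\<close> lie in a translate of \<open>(k + r)X\<close>, and those at the
  lattice points of \<open>(k + r)X\<close> cover a translate of \<open>kX\<close>, as soon as \<open>rX\<close> contains the cube of
  side length 2 about the lattice point \<open>a\<close>.\<close>
lemma lattice_count_volume:
  fixes I :: "'i set" and X :: "('i \<Rightarrow> real) set" and a :: "'i \<Rightarrow> int" and r :: nat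
  defines "M \<equiv> Pi\<^sub>M I (\<lambda>_. lborel :: real measure)"
  defines "Z \<equiv> \<lambda>k. {z \<in> Pi\<^sub>E I (\<lambda>_. \<int>). (\<lambda>i\<in>I. z i / real k) \<in> X}"
  assumes I: "finite I" and X: "X \<in> sets M"
    and conv: "\<And>x y u. x \<in> X \<Longrightarrow> y \<in> X \<Longrightarrow> 0 \<le> u \<Longrightarrow> u \<le> 1 \<Longrightarrow> (\<lambda>i\<in>I. (1 - u) * x i + u * y i) \<in> X"
    and r: "r \<ge> 1" "\<And>t. (\<And>i. i \<in> I \<Longrightarrow> \<bar>t i\<bar> \<le> 1) \<Longrightarrow> (\<lambda>i\<in>I. (of_int (a i) + t i) / real r) \<in> X"
    and fin: "\<And>k. k \<ge> 1 \<Longrightarrow> finite (Z k)" and k: "k \<ge> 1"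
  shows "real (card (Z k)) \<le> real (k + r) ^ card I * measure M X" (is ?A)
    and "real k ^ card I * measure M X \<le> real (card (Z (k + r)))" (is ?B)
proof -
  interpret product_sigma_finite "\<lambda>_ :: 'i. lborel :: real measure" by standard
  define S where "S k = {t \<in> space M. (\<lambda>i\<in>I. t i / real k) \<in> X}" for k :: nat
  define cube where "cube z = Pi\<^sub>E I (\<lambda>i. {z i..<z i + (1::real)})" for z
  have space: "space M = Pi\<^sub>E I (\<lambda>_. UNIV)" by (simp add: M_def space_PiM)
  have emS: "emeasure M (S m) = ennreal (real m ^ card I) * emeasure M X" if "m \<ge> 1" for m
    using emeasure_PiM_lborel_divide[OF I _ X[unfolded M_def], of "real m"] that
    unfolding S_def M_def by simp
  have shift: "t \<in> S (k + r)"
    if s: "s \<in> S k" and t: "t \<in> Pi\<^sub>E I (\<lambda>_. UNIV)" "\<And>i. i \<in> I \<Longrightarrow> \<bar>t i - s i - of_int (a i)\<bar> \<le> 1" for s t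
  proof -
    define x where "x = (\<lambda>i\<in>I. s i / real k)"
    define y where "y = (\<lambda>i\<in>I. (of_int (a i) + (t i - s i - of_int (a i))) / real r)"
    \<comment> \<open>With this weight t / (k + r) is the convex combination of s / k and (t - s) /
      r, both of which lie in \<open>X\<close>.\<close>
    define u where "u = real r / real (k + r)"
    have "x \<in> X" using s by (simp add: S_def x_def)
    moreover have "y \<in> X" unfolding y_def by (rule r(2)) (rule t(2))
    moreover have "0 \<le> u" "u \<le> 1" by (auto simp: u_def divide_le_eq_1)
    ultimately have "(\<lambda>i\<in>I. (1 - u) * x i + u * y i) \<in> X" by (rule conv)
    moreover have "(\<lambda>i\<in>I. (1 - u) * x i + u * y i) = (\<lambda>i\<in>I. t i / real (k + r))"
    proof (rule restrict_ext)
      fix i assume "i \<in> I"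
      have "(1 - u) * x i = s i / real (k + r)"
        using k r(1) \<open>i \<in> I\<close> by (simp add: x_def u_def field_simps)
      moreover have "u * y i = (t i - s i) / real (k + r)"
        using r(1) \<open>i \<in> I\<close> by (simp add: y_def u_def)
      ultimately show "(1 - u) * x i + u * y i = t i / real (k + r)"
        by (simp add: add_divide_distrib[symmetric])
    qed
    ultimately show ?thesis using t(1) by (simp add: S_def space)
  qed
  have cube_M: "cube z \<in> sets M" for z unfolding cube_def M_def using I by (intro sets_PiM_I_finite) auto
  have em_cube: "emeasure M (cube z) = 1" for z
    unfolding cube_def M_def using I by (subst emeasure_PiM) auto
  have disj: "disjoint_family_on (\<lambda>z. cube (\<lambda>i. z i + of_int (c i))) (Z m)" for c :: "'i \<Rightarrow> int" and m
    unfolding disjoint_family_on_def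
  proof (intro ballI impI, rule ccontr)
    fix z w assume zw: "z \<in> Z m" "w \<in> Z m" "z \<noteq> w"
      "cube (\<lambda>i. z i + of_int (c i)) \<inter> cube (\<lambda>i. w i + of_int (c i)) \<noteq> {}"
    then obtain t where t: "t \<in> cube (\<lambda>i. z i + of_int (c i))" "t \<in> cube (\<lambda>i. w i + of_int (c i))" by blast
    have "z i = w i" if i: "i \<in> I" for i
    proof -
      have "z i \<in> \<int>" "w i \<in> \<int>" using zw(1,2) i by (auto simp: Z_def PiE_iff)
      moreover have "\<bar>z i - w i\<bar> < 1"
        using t i unfolding cube_def PiE_iff by fastforce
      ultimately show ?thesis by (metis Ints_diff Ints_nonzero_abs_less1 eq_iff_diff_eq_0)
    qed
    then have "z = w" using zw(1,2) PiE_ext[of z I "\<lambda>_. \<int>" w] unfolding Z_def by blast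
    then show False using zw(3) by simp
  qed
  have em_union: "emeasure M (\<Union>z\<in>Z m. cube (\<lambda>i. z i + of_int (c i))) = ennreal (real (card (Z m)))"
    if "m \<ge> 1" for c :: "'i \<Rightarrow> int" and m
  proof -
    have "(\<Sum>z\<in>Z m. emeasure M (cube (\<lambda>i. z i + of_int (c i)))) =
        emeasure M (\<Union>z\<in>Z m. cube (\<lambda>i. z i + of_int (c i)))"
      using cube_M by (intro sum_emeasure disj fin that) auto
    then show ?thesis by (simp add: em_cube ennreal_of_nat_eq_real_of_nat)
  qed
  have SM: "S m \<in> sets M" for m
  proof -
    have "(\<lambda>t. \<lambda>i\<in>I. t i / real m) \<in> measurable M M" unfolding M_def by measurable
    from measurable_sets[OF this X] show ?thesis
      unfolding S_def by (simp add: vimage_def Int_def conj_commute)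
  qed
  have "(\<Union>z\<in>Z k. cube (\<lambda>i. z i + of_int (a i))) \<subseteq> S (k + r)"
  proof (rule UN_least)
    fix z assume z: "z \<in> Z k"
    then have "z \<in> S k" by (auto simp: Z_def S_def space PiE_iff)
    then show "cube (\<lambda>i. z i + of_int (a i)) \<subseteq> S (k + r)"
    proof (intro subsetI shift[OF \<open>z \<in> S k\<close>])
      fix t assume t: "t \<in> cube (\<lambda>i. z i + of_int (a i))"
      then show "t \<in> Pi\<^sub>E I (\<lambda>_. UNIV)" by (simp add: cube_def PiE_iff)
      show "\<bar>t i - z i - of_int (a i)\<bar> \<le> 1" if "i \<in> I" for i
      proof -
        have "t i \<in> {z i + of_int (a i)..<z i + of_int (a i) + 1}"
          using t that unfolding cube_def by (rule PiE_mem)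
        then show ?thesis by auto
      qed
    qed
  qed
  then have "emeasure M (\<Union>z\<in>Z k. cube (\<lambda>i. z i + of_int (a i))) \<le> emeasure M (S (k + r))"
    using SM by (rule emeasure_mono)
  then have "ennreal (real (card (Z k))) \<le> emeasure M (S (k + r))"
    by (simp only: em_union[OF k])
  then have A: "ennreal (real (card (Z k))) \<le> ennreal (real (k + r) ^ card I) * emeasure M X"
    by (simp only: emS[OF trans_le_add1[OF k]])
  have "S k \<subseteq> (\<Union>z\<in>Z (k + r). cube (\<lambda>i. z i + of_int (- a i)))"
  proof
    fix t assume t: "t \<in> S k"
    \<comment> \<open>Rounding down and translating by \<open>a\<close>: the cube at
      \<open>z\<close> shifted by \<open>- a\<close> contains \<open>t\<close>, while z - t - a has
      coordinates of size at most 1.\<close>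
    define z where "z = (\<lambda>i\<in>I. of_int (\<lfloor>t i\<rfloor> + a i) :: real)"
    have "z \<in> S (k + r)"
    proof (rule shift[OF t])
      show "\<bar>z i - t i - of_int (a i)\<bar> \<le> 1" if "i \<in> I" for i
        using that by (simp add: z_def) linarith
    qed (auto simp: z_def)
    then have "z \<in> Z (k + r)" by (auto simp: Z_def S_def z_def)
    moreover have "t \<in> cube (\<lambda>i. z i + of_int (- a i))"
      using t by (auto simp: cube_def z_def S_def space PiE_iff)
    ultimately show "t \<in> (\<Union>z\<in>Z (k + r). cube (\<lambda>i. z i + of_int (- a i)))" by blast
  qed
  then have "emeasure M (S k) \<le> emeasure M (\<Union>z\<in>Z (k + r). cube (\<lambda>i. z i + of_int (- a i)))"
    using cube_M fin k by (intro emeasure_mono sets.finite_UN) auto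
  also have "\<dots> = ennreal (real (card (Z (k + r))))" using k by (intro em_union) simp
  finally have B: "ennreal (real k ^ card I) * emeasure M X \<le> ennreal (real (card (Z (k + r))))"
    using emS[OF k] by simp
  \<comment> \<open>The finite lattice count on the right of \<open>B\<close> bounds a positive
    multiple of the measure, so the computation may pass from \<open>ennreal\<close> to
    reals.\<close>
  have "emeasure M X \<noteq> \<infinity>"
  proof
    assume "emeasure M X = \<infinity>"
    then show False using B k by (simp add: ennreal_mult_top top_unique)
  qed
  then have em: "emeasure M X = ennreal (measure M X)" by (simp add: emeasure_eq_ennreal_measure)
  show ?A using A by (simp add: em ennreal_mult[symmetric])
  show ?B using B by (simp add: em ennreal_mult[symmetric])
qed

section \<open>Bases of the affine lattice of a face\<close>

lemma basis_element_sum: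
  fixes b :: "'a::real_vector"
  assumes "b \<in> B" "finite B"
  shows "b = (\<Sum>c\<in>B. of_int (if c = b then 1 else 0) *\<^sub>R c)"
proof -
  have "(\<Sum>c\<in>B. of_int (if c = b then 1 else 0) *\<^sub>R c) = (\<Sum>c\<in>B. if c = b then c else 0)"
    by (intro sum.cong) auto
  then show ?thesis using assms by simp
qed

text \<open>Induction on the coordinates that may be nonzero. If the subgroup with vanishing i-th
  coordinate is proper, its basis is completed by a vector \<open>g\<close> of least positive i-th
  coordinate: division with remainder by that coordinate brings every element into the
  subgroup.\<close>

lemma integer_subgroup_basis:
  fixes G :: "(real ^ 'n) set"
  assumes "G \<subseteq> integer_points" "0 \<in> G" "\<And>x y. x \<in> G \<Longrightarrow> y \<in> G \<Longrightarrow> x - y \<in> G"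
    and "\<And>x i. x \<in> G \<Longrightarrow> i \<notin> K \<Longrightarrow> x $ i = 0"
  shows "\<exists>B. independent B \<and> {\<Sum>b\<in>B. of_int (m b) *\<^sub>R b | m :: real ^ 'n \<Rightarrow> int. True} = G"
proof -
  have "finite K" by simp
  then show ?thesis using assms
  proof (induction K arbitrary: G rule: finite_induct)
    case empty
    then have "G = {0}" by (auto simp: vec_eq_iff)
    then show ?case by (intro exI[of _ "{}"]) (auto simp: independent_empty)
  next
    case (insert i K)
    note G = insert.prems
    have G_neg: "- x \<in> G" if "x \<in> G" for x using G(3)[OF G(2) that] by simp
    have G_add: "x + y \<in> G" if "x \<in> G" "y \<in> G" for x y using G(3)[OF that(1) G_neg[OF that(2)]] by simp
    have G_nat: "real m *\<^sub>R x \<in> G" if "x \<in> G" for m x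
      by (induction m) (auto simp: G(2) scaleR_add_left intro: G_add that)
    have G_int: "of_int m *\<^sub>R x \<in> G" if "x \<in> G" for m :: int and x
      using G_nat[OF that, of "nat m"] G_neg[OF G_nat[OF that, of "nat (- m)"]]
      by (cases "0 \<le> m") auto
    define G' where "G' = {x \<in> G. x $ i = 0}"
    have "\<exists>B. independent B \<and> {\<Sum>b\<in>B. of_int (m b) *\<^sub>R b | m :: real ^ 'n \<Rightarrow> int. True} = G'"
    proof (rule insert.IH)
      show "x $ j = 0" if "x \<in> G'" "j \<notin> K" for x :: "real ^ 'n" and j
        using that G(4)[of x j] by (cases "j = i") (auto simp: G'_def)
    qed (use G in \<open>auto simp: G'_def\<close>)
    then obtain B where B: "independent B"
      "{\<Sum>b\<in>B. of_int (m b) *\<^sub>R b | m :: real ^ 'n \<Rightarrow> int. True} = G'" by blast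
    have finB: "finite B" using B(1) by (rule independent_imp_finite)
    show ?case
    proof (cases "G' = G")
      case True
      then show ?thesis using B by blast
    next
      case False
      then obtain x0 where x0: "x0 \<in> G" "x0 $ i \<noteq> 0" by (auto simp: G'_def)
      have floor: "of_int \<lfloor>x $ i\<rfloor> = x $ i" if "x \<in> G" for x :: "real ^ 'n"
        using that G(1) by (auto simp: integer_points_def elim!: Ints_cases)
      define pos where "pos x \<longleftrightarrow> x \<in> G \<and> 0 < x $ i" for x :: "real ^ 'n"
      have "pos x0 \<or> pos (- x0)" using x0 G_neg by (auto simp: pos_def)
      then obtain g where g: "pos g" "\<And>x. pos x \<Longrightarrow> nat \<lfloor>g $ i\<rfloor> \<le> nat \<lfloor>x $ i\<rfloor>"
        using ex_has_least_nat[of pos _ "\<lambda>x. nat \<lfloor>x $ i\<rfloor>"] by blast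
      have gG: "g \<in> G" "0 < g $ i" using g(1) by (auto simp: pos_def)
      have red: "\<exists>q :: int. x - of_int q *\<^sub>R g \<in> G'" if x: "x \<in> G" for x
      proof -
        define q where "q = \<lfloor>x $ i\<rfloor> div \<lfloor>g $ i\<rfloor>"
        define y where "y = x - of_int q *\<^sub>R g"
        have yG: "y \<in> G" unfolding y_def using x gG G_int G(3) by blast
        have "y $ i = of_int \<lfloor>x $ i\<rfloor> - of_int q * of_int \<lfloor>g $ i\<rfloor>"
          unfolding floor[OF x] floor[OF gG(1)] by (simp add: y_def)
        also have "\<dots> = of_int (\<lfloor>x $ i\<rfloor> mod \<lfloor>g $ i\<rfloor>)"
          by (simp add: q_def minus_div_mult_eq_mod[symmetric])
        finally have yi: "y $ i = of_int (\<lfloor>x $ i\<rfloor> mod \<lfloor>g $ i\<rfloor>)" .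
        have gpos: "0 < \<lfloor>g $ i\<rfloor>" using floor[OF gG(1)] gG(2) by linarith
        have "\<not> pos y"
        proof
          assume "pos y"
          from g(2)[OF this] have "nat \<lfloor>g $ i\<rfloor> \<le> nat (\<lfloor>x $ i\<rfloor> mod \<lfloor>g $ i\<rfloor>)" by (simp add: yi)
          then show False using gpos pos_mod_bound[OF gpos, of "\<lfloor>x $ i\<rfloor>"] by linarith
        qed
        moreover have "0 \<le> y $ i" using gpos by (simp add: yi)
        ultimately have "y \<in> G'" using yG by (auto simp: pos_def G'_def)
        then show ?thesis by (auto simp: y_def)
      qed
      have "span B \<subseteq> {x. x $ i = 0}"
      proof (rule span_minimal)
        show "B \<subseteq> {x. x $ i = 0}"
        proof
          fix b assume b: "b \<in> B"
          have "b \<in> {\<Sum>b\<in>B. of_int (m b) *\<^sub>R b | m :: real ^ 'n \<Rightarrow> int. True}"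
            by (intro CollectI exI[of _ "\<lambda>c. if c = b then 1 else 0"] conjI TrueI basis_element_sum b finB)
          then have "b \<in> G'" unfolding B(2) .
          then show "b \<in> {x. x $ i = 0}" by (simp add: G'_def)
        qed
        show "subspace {x :: real ^ 'n. x $ i = 0}" by (auto simp: subspace_def)
      qed
      then have ng: "g \<notin> span B" using gG by auto
      then have gB: "g \<notin> B" using span_base by blast
      have "independent (insert g B)" using ng B(1) by (simp add: independent_insert)
      moreover have "{\<Sum>b\<in>insert g B. of_int (m b) *\<^sub>R b | m :: real ^ 'n \<Rightarrow> int. True} = G"
      proof (intro subset_antisym subsetI)
        fix x assume "x \<in> {\<Sum>b\<in>insert g B. of_int (m b) *\<^sub>R b | m :: real ^ 'n \<Rightarrow> int. True}"
        then obtain m :: "real ^ 'n \<Rightarrow> int" where "x = (\<Sum>b\<in>insert g B. of_int (m b) *\<^sub>R b)" by blast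
        then have "x = of_int (m g) *\<^sub>R g + (\<Sum>b\<in>B. of_int (m b) *\<^sub>R b)" using finB gB by simp
        moreover have "(\<Sum>b\<in>B. of_int (m b) *\<^sub>R b) \<in> G'" using B(2) by blast
        ultimately show "x \<in> G" using G_add G_int gG by (auto simp: G'_def)
      next
        fix x assume "x \<in> G"
        then obtain q :: int where "x - of_int q *\<^sub>R g \<in> G'" using red by blast
        then obtain m :: "real ^ 'n \<Rightarrow> int" where m: "x - of_int q *\<^sub>R g = (\<Sum>b\<in>B. of_int (m b) *\<^sub>R b)"
          using B(2) by blast
        have "x = (\<Sum>b\<in>insert g B. of_int ((m(g := q)) b) *\<^sub>R b)"
        proof -
          have "(\<Sum>b\<in>B. of_int ((m(g := q)) b) *\<^sub>R b) = (\<Sum>b\<in>B. of_int (m b) *\<^sub>R b)"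
            using gB by (intro sum.cong) auto
          then show ?thesis using finB gB m by (simp add: algebra_simps)
        qed
        then show "x \<in> {\<Sum>b\<in>insert g B. of_int (m b) *\<^sub>R b | m :: real ^ 'n \<Rightarrow> int. True}" by blast
      qed
      ultimately show ?thesis by blast
    qed
  qed
qed

text \<open>Guarantees that the choice of \<open>B\<close> in \<open>Vol_Z\<close> is a genuine one.
  Differences form a group because x + (y' - y) is again a lattice point of the affine hull.\<close>

lemma lattice_basis_exists:
  fixes F :: "(real ^ 'n) set"
  assumes p: "p \<in> affine hull F \<inter> integer_points"
  shows "\<exists>B. is_lattice_basis F B"
  unfolding is_lattice_basis_def
proof (rule integer_subgroup_basis[where K = UNIV])
  let ?A = "affine hull F \<inter> integer_points"
  let ?G = "{x - y | x y. x \<in> ?A \<and> y \<in> ?A}"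
  show "?G \<subseteq> integer_points" using integer_points_diff by blast
  have "p - p \<in> ?G" using p by blast
  then show "0 \<in> ?G" by simp
  show "u - v \<in> ?G" if uv: "u \<in> ?G" "v \<in> ?G" for u v
  proof -
    obtain x y x' y' where *: "u = x - y" "v = x' - y'" "x \<in> ?A" "y \<in> ?A" "x' \<in> ?A" "y' \<in> ?A"
      using uv by blast
    have "x + 1 *\<^sub>R (y' - y) \<in> affine hull F"
      using mem_affine_3_minus[OF affine_affine_hull, of x F y' y 1] * by auto
    then have "x + (y' - y) \<in> ?A"
      using * by (auto intro!: integer_points_add integer_points_diff)
    moreover have "u - v = (x + (y' - y)) - x'" using * by simp
    ultimately show ?thesis using *(5) by blast
  qed
qed auto

text \<open>The points of \<open>S\<close> are lattice points, so their differences from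
  \<open>p\<close> are integer combinations of \<open>B\<close>; this gives the lattice full rank in
  the direction space.\<close>

lemma lattice_basis_affine_hull:
  fixes S :: "(real ^ 'n) set"
  assumes S: "S \<subseteq> integer_points" and B: "is_lattice_basis (convex hull S) B"
    and p: "p \<in> affine hull S \<inter> integer_points"
  shows "affine hull S = (+) p ` span B" and "int (card B) = aff_dim S"
proof -
  let ?V = "span ((\<lambda>x. - p + x) ` S)"
  have hull: "affine hull S = (+) p ` ?V" using p by (intro affine_hull_span_gen) auto
  have ind: "independent B" using B by (simp add: is_lattice_basis_def)
  have finB: "finite B" using ind by (rule independent_imp_finite)
  let ?G = "{x - y | x y. x \<in> affine hull S \<inter> integer_points \<and> y \<in> affine hull S \<inter> integer_points}"
  have G: "{\<Sum>b\<in>B. of_int (m b) *\<^sub>R b | m :: real ^ 'n \<Rightarrow> int. True} = ?G"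
    using B by (simp add: is_lattice_basis_def affine_hull_convex_hull)
  have "?V \<subseteq> span B"
  proof (rule span_minimal)
    show "(\<lambda>x. - p + x) ` S \<subseteq> span B"
    proof (rule image_subsetI)
      fix x assume "x \<in> S"
      then have "x \<in> affine hull S \<inter> integer_points" using S by (auto intro: hull_inc)
      then have "x - p \<in> ?G" using p by blast
      then obtain m :: "real ^ 'n \<Rightarrow> int" where "x - p = (\<Sum>b\<in>B. of_int (m b) *\<^sub>R b)" using G by blast
      moreover have "(\<Sum>b\<in>B. of_int (m b) *\<^sub>R b) \<in> span B" by (intro span_sum span_scale span_base)
      ultimately show "- p + x \<in> span B" by simp
    qed
  qed simp
  moreover have "B \<subseteq> ?V"
  proof
    fix b assume b: "b \<in> B"
    have "b \<in> {\<Sum>b\<in>B. of_int (m b) *\<^sub>R b | m :: real ^ 'n \<Rightarrow> int. True}"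
      by (intro CollectI exI[of _ "\<lambda>c. if c = b then 1 else 0"] conjI TrueI basis_element_sum b finB)
    then have "b \<in> ?G" unfolding G .
    then obtain x y where "b = x - y" "x \<in> affine hull S" "y \<in> affine hull S" by blast
    then show "b \<in> ?V" unfolding hull using span_diff by fastforce
  qed
  then have "span B \<subseteq> ?V" by (intro span_minimal) auto
  ultimately have eq: "span B = ?V" by blast
  show "affine hull S = (+) p ` span B" using hull eq by simp
  have "aff_dim S = int (dim ((\<lambda>x. - p + x) ` S))"
    using p aff_dim_eq_dim[of p S] by simp
  also have "dim ((\<lambda>x. - p + x) ` S) = card B"
    using dim_eq_card[OF eq ind] .
  finally show "int (card B) = aff_dim S" by simp
qed

section \<open>Growth of coefficients and the normalized volume\<close>

lemma fps_binomial_one_minus_X: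
  "Abs_fps (\<lambda>n. int ((n + m) choose m)) * (1 - fps_X) ^ (m + 1) = 1"
proof (induction m)
  case 0
  show ?case by (rule fps_ext) (auto simp: right_diff_distrib fps_X_mult_right_nth)
next
  case (Suc m)
  have "Abs_fps (\<lambda>n. int ((n + Suc m) choose Suc m)) * (1 - fps_X) = Abs_fps (\<lambda>n. int ((n + m) choose m))"
  proof (rule fps_ext)
    fix n
    show "fps_nth (Abs_fps (\<lambda>n. int ((n + Suc m) choose Suc m)) * (1 - fps_X)) n =
      fps_nth (Abs_fps (\<lambda>n. int ((n + m) choose m))) n"
      by (cases n) (auto simp: right_diff_distrib fps_X_mult_right_nth)
  qed
  then show ?case using Suc.IH by (simp add: mult.assoc[symmetric])
qed

lemma binomial_shift_asymptotic:
  "(\<lambda>k. real ((k - i + D) choose D) / real k ^ D) \<longlonglongrightarrow> 1 / fact D"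
proof (induction D)
  case 0
  show ?case by simp
next
  case (Suc D)
  have "(\<lambda>k. real (k - i + Suc D) / real k) \<longlonglongrightarrow> 1"
  proof (rule Lim_transform_eventually)
    show "(\<lambda>k. (real k - real i + real (Suc D)) / real k) \<longlonglongrightarrow> 1" by real_asymp
    show "\<forall>\<^sub>F k in sequentially. (real k - real i + real (Suc D)) / real k = real (k - i + Suc D) / real k"
      using eventually_ge_at_top[of i] by eventually_elim (simp add: of_nat_diff)
  qed
  from tendsto_mult[OF this tendsto_divide[OF Suc.IH tendsto_const[of "real (Suc D)"]]]
  have "(\<lambda>k. real (k - i + Suc D) / real k * (real ((k - i + D) choose D) / real k ^ D / real (Suc D)))
      \<longlonglongrightarrow> 1 * (1 / fact D / real (Suc D))" by simp
  moreover have "real ((k - i + Suc D) choose Suc D) / real k ^ Suc D =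
      real (k - i + Suc D) / real k * (real ((k - i + D) choose D) / real k ^ D / real (Suc D))" for k
  proof -
    have "Suc D * (Suc (k - i + D) choose Suc D) = Suc (k - i + D) * ((k - i + D) choose D)"
      by (rule Suc_times_binomial)
    then have "real (Suc D) * real ((k - i + Suc D) choose Suc D) = real (k - i + Suc D) * real ((k - i + D) choose D)"
      by (metis add_Suc_right of_nat_mult)
    then have "real ((k - i + Suc D) choose Suc D) = real (k - i + Suc D) * real ((k - i + D) choose D) / real (Suc D)"
      by (simp add: field_simps del: binomial_Suc_Suc of_nat_Suc)
    then show ?thesis by (simp del: binomial_Suc_Suc of_nat_Suc add: mult.commute)
  qed
  moreover have "1 * (1 / fact D / real (Suc D)) = 1 / (fact (Suc D) :: real)" by simp
  ultimately show ?case by (simp only:)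
qed

text \<open>For k \<ge> D the coefficient is the combination with weights \<open>h i\<close> of the
  binomials k - i + D over D, each of which grows like k^D / D!.\<close>

lemma rational_series_asymptotic:
  fixes f h :: "nat \<Rightarrow> int"
  assumes f: "Abs_fps f * (1 - fps_X) ^ (D + 1) = Abs_fps h" and h: "\<And>k. D < k \<Longrightarrow> h k = 0"
  shows "(\<lambda>k. of_int (f k) / real k ^ D) \<longlonglongrightarrow> of_int (\<Sum>i\<le>D. h i) / fact D"
proof (rule Lim_transform_eventually)
  show "(\<lambda>k. \<Sum>i\<le>D. of_int (h i) * (real ((k - i + D) choose D) / real k ^ D))
      \<longlonglongrightarrow> of_int (\<Sum>i\<le>D. h i) / fact D"
  proof -
    have "(\<lambda>k. \<Sum>i\<le>D. of_int (h i) * (real ((k - i + D) choose D) / real k ^ D))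
        \<longlonglongrightarrow> (\<Sum>i\<le>D. of_int (h i) * (1 / fact D))"
      by (intro tendsto_sum tendsto_mult tendsto_const binomial_shift_asymptotic)
    then show ?thesis by (simp add: sum_divide_distrib)
  qed
  have "Abs_fps f * ((1 - fps_X) ^ (D + 1) * Abs_fps (\<lambda>n. int ((n + D) choose D))) =
      Abs_fps h * Abs_fps (\<lambda>n. int ((n + D) choose D))"
    unfolding f[symmetric] by (simp only: mult.assoc)
  then have eq: "Abs_fps f = Abs_fps h * Abs_fps (\<lambda>n. int ((n + D) choose D))"
    unfolding mult.commute[of "(1 - fps_X) ^ (D + 1)"] fps_binomial_one_minus_X by (simp only: mult_1_right)
  have fk: "f k = (\<Sum>i\<le>D. h i * int ((k - i + D) choose D))" if "D \<le> k" for k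
  proof -
    have "f k = fps_nth (Abs_fps h * Abs_fps (\<lambda>n. int ((n + D) choose D))) k" by (simp flip: eq)
    also have "\<dots> = (\<Sum>i=0..k. h i * int ((k - i + D) choose D))" by (simp add: fps_mult_nth)
    also have "\<dots> = (\<Sum>i\<le>D. h i * int ((k - i + D) choose D))"
      using that h by (intro sum.mono_neutral_right) auto
    finally show ?thesis .
  qed
  show "\<forall>\<^sub>F k in sequentially. (\<Sum>i\<le>D. of_int (h i) * (real ((k - i + D) choose D) / real k ^ D)) =
      of_int (f k) / real k ^ D"
    using eventually_ge_at_top[of D]
  proof eventually_elim
    case (elim k)
    have "real_of_int (f k) = (\<Sum>i\<le>D. of_int (h i) * real ((k - i + D) choose D))"
      unfolding fk[OF elim] of_int_sum of_int_mult of_int_of_nat_eq ..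
    then show ?case by (simp only: sum_divide_distrib times_divide_eq_right)
  qed
qed

lemma sandwich_count_limit:
  fixes N :: "nat \<Rightarrow> real"
  assumes lim: "(\<lambda>k. N k / real k ^ D) \<longlonglongrightarrow> l"
    and up: "\<And>k. k \<ge> 1 \<Longrightarrow> N k \<le> real (k + r) ^ D * v"
    and low: "\<And>k. k \<ge> 1 \<Longrightarrow> real k ^ D * v \<le> N (k + r)"
  shows "v = l"
proof (rule antisym)
  have 1: "(\<lambda>k. (real (k + r) / real k) ^ D) \<longlonglongrightarrow> 1 ^ D"
    by (intro tendsto_power) real_asymp
  show "l \<le> v"
  proof (rule tendsto_le[OF sequentially_bot _ lim])
    show "(\<lambda>k. (real (k + r) / real k) ^ D * v) \<longlonglongrightarrow> v"
      using tendsto_mult[OF 1 tendsto_const[of v]] by simp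
    show "\<forall>\<^sub>F k in sequentially. N k / real k ^ D \<le> (real (k + r) / real k) ^ D * v"
      using eventually_ge_at_top[of 1]
      by eventually_elim (use up in \<open>simp add: power_divide divide_right_mono\<close>)
  qed
  show "v \<le> l"
  proof (rule tendsto_le[OF sequentially_bot _ tendsto_const])
    have "(\<lambda>k. N (k + r) / real (k + r) ^ D * (real (k + r) / real k) ^ D) \<longlonglongrightarrow> l * 1 ^ D"
      by (intro tendsto_mult 1 LIMSEQ_ignore_initial_segment[OF lim])
    then show "(\<lambda>k. N (k + r) / real (k + r) ^ D * (real (k + r) / real k) ^ D) \<longlonglongrightarrow> l" by simp
    show "\<forall>\<^sub>F k in sequentially. v \<le> N (k + r) / real (k + r) ^ D * (real (k + r) / real k) ^ D"
      using eventually_ge_at_top[of 1]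
    proof eventually_elim
      case (elim k)
      then have "v * real k ^ D \<le> N (k + r)" using low[of k] by (simp add: mult.commute)
      then have "v \<le> N (k + r) / real k ^ D" using elim by (simp add: pos_le_divide_eq)
      also have "\<dots> = N (k + r) / real (k + r) ^ D * (real (k + r) / real k) ^ D"
        using elim by (simp add: power_divide)
      finally show ?case .
    qed
  qed
qed

text \<open>Both sides are D! times the leading coefficient of the lattice point count of kF: the
  numerator yields it through the series, the measure through unit cubes in the coordinates of a
  lattice basis.\<close>

theorem Vol_Z_eq_sum_h_star:
  fixes S :: "(real ^ 'n) set"
  assumes S: "finite S" "S \<subseteq> integer_points" "S \<noteq> {}" and F: "F = convex hull S"
  shows "Vol_Z F = of_int (\<Sum>i\<le>nat (aff_dim F). h_star F i)"
proof -
  define p where "p = (SOME p. p \<in> affine hull F \<inter> integer_points)"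
  define B where "B = (SOME B. is_lattice_basis F B)"
  define M where "M = Pi\<^sub>M B (\<lambda>_. lborel :: real measure)"
  define D where "D = nat (aff_dim F)"
  define \<psi> where "\<psi> t = (\<Sum>b\<in>B. t b *\<^sub>R b)" for t :: "real ^ 'n \<Rightarrow> real"
  define X where "X = {t \<in> space M. p + \<psi> t \<in> F}"
  have affF: "affine hull F = affine hull S" unfolding F by (rule affine_hull_convex_hull)
  have "\<exists>p. p \<in> affine hull F \<inter> integer_points" using S(2,3) unfolding affF by (auto intro: hull_inc)
  then have p: "p \<in> affine hull S \<inter> integer_points" unfolding p_def affF by (rule someI_ex)
  have B: "is_lattice_basis F B"
    unfolding B_def using lattice_basis_exists[of p F] p affF by (metis someI_ex)
  note hull = lattice_basis_affine_hull[OF S(2) B[unfolded F] p]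
  have ind: "independent B" using B by (simp add: is_lattice_basis_def)
  have finB: "finite B" using ind by (rule independent_imp_finite)
  have card: "card B = D" using hull(2) by (simp add: D_def F aff_dim_convex_hull)
  have space: "space M = Pi\<^sub>E B (\<lambda>_. UNIV)" by (simp add: M_def space_PiM)
  have \<psi>_restrict: "\<psi> (\<lambda>b\<in>B. t b) = \<psi> t" for t by (simp add: \<psi>_def)
  have \<psi>_add: "\<psi> (\<lambda>b. s b + t b) = \<psi> s + \<psi> t" and \<psi>_scale: "\<psi> (\<lambda>b. c * t b) = c *\<^sub>R \<psi> t" for s t c
    by (simp_all add: \<psi>_def scaleR_add_left sum.distrib scaleR_sum_right)
  have \<psi>_inj: "s = t" if "s \<in> Pi\<^sub>E B (\<lambda>_. UNIV)" "t \<in> Pi\<^sub>E B (\<lambda>_. UNIV)" "\<psi> s = \<psi> t" for s t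
  proof (rule PiE_ext[OF that(1,2)])
    fix b assume b: "b \<in> B"
    have "(\<Sum>b\<in>B. (s b - t b) *\<^sub>R b) = 0" using that(3) by (simp add: \<psi>_def scaleR_diff_left sum_subtractf)
    from independentD[OF ind finB order_refl this b] show "s b = t b" by simp
  qed
  have F_conv: "convex F" and F_closed: "closed F"
    using S(1) unfolding F by (auto intro: compact_imp_closed finite_imp_compact_convex_hull)
  have X_M: "X \<in> sets M"
  proof -
    have "(\<lambda>t. p + \<psi> t) \<in> borel_measurable M" unfolding \<psi>_def M_def by measurable
    from measurable_sets[OF this borel_closed[OF F_closed]] show ?thesis
      by (simp add: X_def vimage_def Int_def conj_commute)
  qed
  have in_X: "(\<lambda>b\<in>B. t b) \<in> X \<longleftrightarrow> p + \<psi> t \<in> F" for t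
    by (simp add: X_def space \<psi>_restrict)
  define Z where "Z k = {z \<in> Pi\<^sub>E B (\<lambda>_. \<int>). (\<lambda>b\<in>B. z b / real k) \<in> X}" for k :: nat
  \<comment> \<open>Coordinates on the dilate are centred at k p rather than \<open>p\<close>: the
    affine hull of kF passes through k p, which is a lattice point as well.\<close>
  have bij: "bij_betw (\<lambda>z. real k *\<^sub>R p + \<psi> z) (Z k) (dilate k F \<inter> integer_points)" if k: "k \<ge> 1" for k
    unfolding bij_betw_def
  proof
    show "inj_on (\<lambda>z. real k *\<^sub>R p + \<psi> z) (Z k)"
    proof (rule inj_onI)
      fix z w assume zw: "z \<in> Z k" "w \<in> Z k" "real k *\<^sub>R p + \<psi> z = real k *\<^sub>R p + \<psi> w"
      show "z = w"
      proof (rule \<psi>_inj)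
        show "z \<in> Pi\<^sub>E B (\<lambda>_. UNIV)" "w \<in> Pi\<^sub>E B (\<lambda>_. UNIV)" using zw(1,2) by (auto simp: Z_def PiE_iff)
      qed (use zw(3) in simp)
    qed
    show "(\<lambda>z. real k *\<^sub>R p + \<psi> z) ` Z k = dilate k F \<inter> integer_points"
    proof (intro subset_antisym subsetI)
      fix x assume "x \<in> (\<lambda>z. real k *\<^sub>R p + \<psi> z) ` Z k"
      then obtain z where z: "x = real k *\<^sub>R p + \<psi> z" "\<And>b. b \<in> B \<Longrightarrow> z b \<in> \<int>" "(\<lambda>b\<in>B. z b / real k) \<in> X"
        by (auto simp: Z_def PiE_iff)
      have "p + \<psi> (\<lambda>b. 1 / real k * z b) \<in> F" using z(3) in_X[of "\<lambda>b. z b / real k"] by simp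
      moreover have "x = real k *\<^sub>R (p + \<psi> (\<lambda>b. 1 / real k * z b))"
        unfolding \<psi>_scale z(1) using k by (simp add: scaleR_add_right)
      ultimately have "x \<in> dilate k F" unfolding dilate_def by blast
      moreover have "x \<in> integer_points"
      proof -
        have "b \<in> integer_points" if b: "b \<in> B" for b
        proof -
          have "b \<in> {\<Sum>b\<in>B. of_int (m b) *\<^sub>R b | m :: real ^ 'n \<Rightarrow> int. True}"
            by (intro CollectI exI[of _ "\<lambda>c. if c = b then 1 else 0"] conjI TrueI basis_element_sum b finB)
          then have "b \<in> {x - y | x y. x \<in> affine hull F \<inter> integer_points \<and> y \<in> affine hull F \<inter> integer_points}"
            using B unfolding is_lattice_basis_def by blast
          then show ?thesis using integer_points_diff by blast
        qed
        then show ?thesis unfolding z(1) \<psi>_def using z(2) p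
          by (intro integer_points_add integer_points_sum integer_points_scale) auto
      qed
      ultimately show "x \<in> dilate k F \<inter> integer_points" by blast
    next
      fix x assume x: "x \<in> dilate k F \<inter> integer_points"
      then obtain y where y: "y \<in> F" "x = real k *\<^sub>R y" unfolding dilate_def by blast
      have "y \<in> affine hull S" using y(1) affF hull_inc by metis
      then have "y - p \<in> span B" using hull(1) by auto
      then have "x - real k *\<^sub>R p \<in> span B" using span_scale[of "y - p" B "real k"] y(2) by (simp add: scaleR_diff_right)
      then have "p + (x - real k *\<^sub>R p) \<in> affine hull F" unfolding affF hull(1) by blast
      moreover have "p + (x - real k *\<^sub>R p) \<in> integer_points"
        using p x by (intro integer_points_add integer_points_diff integer_points_scale) auto
      ultimately have "(p + (x - real k *\<^sub>R p)) - p \<in> {x - y | x y. x \<in> affine hull F \<inter> integer_points \<and> y \<in> affine hull F \<inter> integer_points}"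
        using p affF by blast
      then have "x - real k *\<^sub>R p \<in> {\<Sum>b\<in>B. of_int (m b) *\<^sub>R b | m :: real ^ 'n \<Rightarrow> int. True}"
        using B unfolding is_lattice_basis_def by simp
      then obtain m :: "real ^ 'n \<Rightarrow> int" where m: "x - real k *\<^sub>R p = (\<Sum>b\<in>B. of_int (m b) *\<^sub>R b)" by blast
      define z where "z = (\<lambda>b\<in>B. real_of_int (m b))"
      have xz: "x = real k *\<^sub>R p + \<psi> z" using m by (simp add: z_def \<psi>_restrict \<psi>_def algebra_simps)
      have "y = p + \<psi> (\<lambda>b. 1 / real k * z b)"
      proof -
        have "y = (1 / real k) *\<^sub>R x" using y(2) k by simp
        then show ?thesis unfolding xz \<psi>_scale using k by (simp add: scaleR_add_right)
      qed
      then have "(\<lambda>b\<in>B. z b / real k) \<in> X" using in_X[of "\<lambda>b. z b / real k"] y(1) by simp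
      then have "z \<in> Z k" by (auto simp: Z_def z_def)
      then show "x \<in> (\<lambda>z. real k *\<^sub>R p + \<psi> z) ` Z k" using xz by blast
    qed
  qed
  have bounded: "bounded (dilate k F)" for k
    unfolding dilate_def F using S(1)
    by (intro bounded_scaling compact_imp_bounded finite_imp_compact_convex_hull)
  have fin: "finite (Z k)" if "k \<ge> 1" for k
    using bij_betw_finite[OF bij[OF that]] finite_bounded_integer_points[OF bounded] by simp
  have conv: "(\<lambda>b\<in>B. (1 - u) * x b + u * y b) \<in> X" if "x \<in> X" "y \<in> X" "0 \<le> u" "u \<le> 1" for x y u
  proof -
    have "(1 - u) *\<^sub>R (p + \<psi> x) + u *\<^sub>R (p + \<psi> y) \<in> F"
      using that F_conv by (intro convexD) (auto simp: X_def)
    moreover have "p + \<psi> (\<lambda>b. (1 - u) * x b + u * y b) = (1 - u) *\<^sub>R (p + \<psi> x) + u *\<^sub>R (p + \<psi> y)"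
      unfolding \<psi>_add \<psi>_scale by (simp add: algebra_simps)
    ultimately show ?thesis by (simp add: in_X)
  qed
  obtain y where y: "y \<in> rel_interior F"
    using rel_interior_eq_empty[OF F_conv] S(3) F by auto
  then obtain e where e: "e > 0" "ball y e \<inter> affine hull F \<subseteq> F" and yF: "y \<in> F" by (auto simp: mem_rel_interior_ball)
  have "y \<in> affine hull F" using yF by (rule hull_inc)
  then have "y - p \<in> span B" unfolding affF hull(1) by auto
  then have yc: "y = p + \<psi> (representation B (y - p))"
    using sum_representation_eq[OF ind _ finB order_refl, of "y - p"] by (simp add: \<psi>_def)
  define c where "c = representation B (y - p)"
  have yc': "y = p + \<psi> c" unfolding c_def by (rule yc)
  \<comment> \<open>In each coordinate, rounding r c down to \<open>a\<close> and the free shift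
    \<open>t\<close> cost at most 1 each. After division by \<open>r\<close> the point moves by at
    most K / r, and \<open>r\<close> is taken so large that it stays in the ball around
    \<open>y\<close>.\<close>
  define K where "K = 2 * (\<Sum>b\<in>B. norm b)"
  obtain r :: nat where r: "r \<ge> 1" "K < real r * e"
  proof -
    obtain r0 :: nat where "K < real r0 * e" using reals_Archimedean3[OF e(1)] by blast
    also have "\<dots> \<le> real (Suc r0) * e" using e(1) by (intro mult_right_mono) auto
    finally show ?thesis by (intro that[of "Suc r0"]) auto
  qed
  define a where "a b = \<lfloor>real r * c b\<rfloor>" for b
  have cube: "(\<lambda>b\<in>B. (of_int (a b) + t b) / real r) \<in> X" if t: "\<And>b. b \<in> B \<Longrightarrow> \<bar>t b\<bar> \<le> 1" for t
  proof -
    define s where "s b = (of_int (a b) + t b) / real r" for b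
    have "p + \<psi> s - y = \<psi> s + (-1) *\<^sub>R \<psi> c" by (subst yc') simp
    also have "\<dots> = \<psi> (\<lambda>b. s b + (-1) * c b)" by (simp only: \<psi>_add \<psi>_scale)
    finally have eq: "p + \<psi> s - y = (\<Sum>b\<in>B. (s b - c b) *\<^sub>R b)" by (simp add: \<psi>_def)
    have sc: "\<bar>s b - c b\<bar> \<le> 2 / real r" if b: "b \<in> B" for b
    proof -
      have "\<bar>of_int (a b) + t b - real r * c b\<bar> \<le> 2" using t[OF b] unfolding a_def by linarith
      moreover have "s b - c b = (of_int (a b) + t b - real r * c b) / real r"
        using r(1) by (simp add: s_def field_simps)
      ultimately show ?thesis using r(1) by (simp add: divide_right_mono)
    qed
    have "norm (p + \<psi> s - y) \<le> (\<Sum>b\<in>B. 2 / real r * norm b)"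
      unfolding eq
    proof (rule sum_norm_le)
      fix b assume "b \<in> B"
      then show "norm ((s b - c b) *\<^sub>R b) \<le> 2 / real r * norm b"
        unfolding norm_scaleR by (intro mult_right_mono sc) auto
    qed
    also have "\<dots> = K / real r" by (simp add: K_def sum_distrib_left sum_divide_distrib)
    also have "\<dots> < e" using r by (simp add: divide_less_eq mult.commute)
    finally have "p + \<psi> s \<in> ball y e" by (simp add: dist_norm norm_minus_commute)
    moreover have "p + \<psi> s \<in> affine hull F"
      unfolding affF hull(1) \<psi>_def by (intro imageI span_sum span_scale span_base)
    ultimately have "p + \<psi> s \<in> F" using e(2) by blast
    then show ?thesis using in_X[of s] by (simp add: s_def)
  qed
  have NZ: "card (Z k) = card (dilate k F \<inter> integer_points)" if "k \<ge> 1" for k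
    by (rule bij_betw_same_card[OF bij[OF that]])
  have sandwich: "real (card (Z k)) \<le> real (k + r) ^ D * measure M X"
      "real k ^ D * measure M X \<le> real (card (Z (k + r)))" if "k \<ge> 1" for k
    unfolding Z_def M_def card[symmetric]
    by (rule lattice_count_volume[where a = a], fact finB, fact X_M[unfolded M_def], fact conv,
        fact r(1), fact cube, fact fin[unfolded Z_def], fact that)+
  have "measure M X = of_int (\<Sum>i\<le>D. h_star F i) / fact D"
  proof (rule sandwich_count_limit)
    have "(\<lambda>k. of_int (int (card (dilate k F \<inter> integer_points))) / real k ^ D)
        \<longlonglongrightarrow> of_int (\<Sum>i\<le>D. h_star F i) / fact D"
      using h_star_series[OF S F] h_star_le[OF S F]
      unfolding ehrhart_series_def D_def by (intro rational_series_asymptotic) (auto simp: not_le[symmetric])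
    then show "(\<lambda>k. real (card (dilate k F \<inter> integer_points)) / real k ^ D)
        \<longlonglongrightarrow> of_int (\<Sum>i\<le>D. h_star F i) / fact D" by simp
    show "real (card (dilate k F \<inter> integer_points)) \<le> real (k + r) ^ D * measure M X" if "k \<ge> 1" for k
      using sandwich(1)[OF that] NZ[OF that] by simp
    show "real k ^ D * measure M X \<le> real (card (dilate (k + r) F \<inter> integer_points))" if "k \<ge> 1" for k
      using sandwich(2)[OF that] NZ[of "k + r"] that by simp
  qed
  then have "fact D * measure M X = of_int (\<Sum>i\<le>D. h_star F i)" by simp
  moreover have "Vol_Z F = fact D * measure M X"
    unfolding Vol_Z_def Let_def p_def[symmetric] B_def[symmetric] X_def M_def D_def \<psi>_def ..
  ultimately show ?thesis by (simp add: D_def)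
qed

section \<open>The alternating sum over faces\<close>

lemma fps_X_power_dvd_nth_0:
  fixes f :: "'a::comm_ring_1 fps"
  shows "fps_X ^ N dvd f \<Longrightarrow> i < N \<Longrightarrow> fps_nth f i = 0"
  by (auto simp: dvd_def fps_X_power_mult_nth)

lemma fps_X_power_dvd_deriv:
  fixes f :: "'a::comm_ring_1 fps"
  assumes "fps_X ^ N dvd f"
  shows "fps_X ^ (N - 1) dvd fps_deriv f"
proof -
  obtain g where f: "f = fps_X ^ N * g" using assms by (elim dvdE)
  have "fps_X ^ N * fps_deriv g = fps_X ^ (N - 1) * ((if N = 0 then 1 else fps_X) * fps_deriv g)"
    by (cases N) (auto simp: mult_ac)
  moreover have "fps_deriv (fps_X ^ N) * g = fps_X ^ (N - 1) * (of_nat N * g)"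
    by (simp add: fps_deriv_power' mult_ac)
  ultimately have "fps_deriv f = fps_X ^ (N - 1) * ((if N = 0 then 1 else fps_X) * fps_deriv g + of_nat N * g)"
    unfolding f fps_deriv_mult by (simp only: distrib_left)
  then show ?thesis by (rule dvdI)
qed

lemma sum_nth_one_minus_X_mult:
  fixes f :: "'a::comm_ring_1 fps"
  shows "(\<Sum>k<Suc q. fps_nth ((1 - fps_X) * f) k) = fps_nth f q"
  by (induction q) (auto simp: left_diff_distrib fps_X_mult_nth)

text \<open>With \<open>E\<^sub>k = \<Sum>\<^sub>F c\<^sub>F(k) (X - 1)\<^bsup>dim F\<^esup>\<close>, the alternating sums of the numerators are
  \<open>(1 - X) \<Sum>\<^sub>k X\<^sup>k E\<^sub>k\<close> and, weighted by dimension, \<open>-(1 - X)\<^sup>2 \<Sum>\<^sub>k X\<^sup>k E\<^sub>k'\<close>; in low degrees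
  only \<open>E\<^sub>0\<close> contributes, and its contributions cancel.\<close>
lemma truncated_numerator_identity:
  fixes c h :: "'f \<Rightarrow> nat \<Rightarrow> int" and dm :: "'f \<Rightarrow> nat"
  assumes h: "\<And>F. F \<in> \<F> \<Longrightarrow> Abs_fps (c F) * (1 - fps_X) ^ (dm F + 1) = Abs_fps (h F)"
    and dvd: "\<And>k. 1 \<le> k \<Longrightarrow> k \<le> m \<Longrightarrow>
      fps_X ^ (m + 1 - k) dvd (\<Sum>F\<in>\<F>. fps_const (c F k) * (fps_X - 1) ^ dm F)"
    and m: "m \<ge> 1"
  shows "(\<Sum>F\<in>\<F>. (-1) ^ dm F * (int m * h F m + (int (dm F) + 1) * (\<Sum>k<m. h F k))) = 0"
proof -
  define E where "E k = (\<Sum>F\<in>\<F>. fps_const (c F k) * (fps_X - 1) ^ dm F)" for k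
  have deriv_E: "fps_deriv (E k) = (\<Sum>F\<in>\<F>. fps_const (c F k) * (of_nat (dm F) * (fps_X - 1) ^ (dm F - 1)))" for k
    unfolding E_def fps_deriv_sum by (intro sum.cong) (simp_all add: fps_deriv_power')
  have dvdE: "fps_X ^ (m + 1) dvd fps_X ^ k * E k" if "1 \<le> k" "k < m + 1" for k
  proof -
    have "fps_X ^ k * fps_X ^ (m + 1 - k) dvd fps_X ^ k * E k"
      unfolding E_def using that by (intro mult_dvd_mono dvd dvd_refl) auto
    then show ?thesis using that by (simp flip: power_add)
  qed
  \<comment> \<open>Differentiation costs one power of X, which does no harm: the sum weighted by
    dimension is only read off below degree m.\<close>
  have dvdE': "fps_X ^ m dvd fps_X ^ k * fps_deriv (E k)" if "1 \<le> k" "k < m" for k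
  proof -
    have "fps_X ^ (m + 1 - k - 1) dvd fps_deriv (E k)"
      unfolding E_def using that by (intro fps_X_power_dvd_deriv dvd) auto
    then have "fps_X ^ k * fps_X ^ (m + 1 - k - 1) dvd fps_X ^ k * fps_deriv (E k)"
      by (rule mult_dvd_mono[OF dvd_refl])
    then show ?thesis using that by (simp flip: power_add)
  qed
  \<comment> \<open>Modulo X^N the counting series are cut off at k < N, and the hypothesis removes
    every term except k = 0.\<close>
  have trunc: "fps_X ^ N dvd (\<Sum>F\<in>\<F>. Abs_fps (c F) * g F) - (\<Sum>F\<in>\<F>. fps_const (c F 0) * g F)"
    if N: "N \<ge> 1" and g: "\<And>k. 1 \<le> k \<Longrightarrow> k < N \<Longrightarrow> fps_X ^ N dvd fps_X ^ k * (\<Sum>F\<in>\<F>. fps_const (c F k) * g F)"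
    for N and g :: "'f \<Rightarrow> int fps"
  proof -
    have *: "Abs_fps f = (\<Sum>k<N. fps_X ^ k * fps_const (f k)) + fps_X ^ N * fps_shift N (Abs_fps f)" for f :: "nat \<Rightarrow> int"
    proof -
      have "(\<Sum>k<N. fps_X ^ k * fps_const (f k)) = fps_cutoff N (Abs_fps f)"
      proof (rule fps_ext)
        fix n
        have "fps_nth (\<Sum>k<N. fps_X ^ k * fps_const (f k)) n = (\<Sum>k<N. if n = k then f k else 0)"
          unfolding fps_sum_nth by (intro sum.cong) (auto simp: fps_X_power_mult_nth)
        then show "fps_nth (\<Sum>k<N. fps_X ^ k * fps_const (f k)) n = fps_nth (fps_cutoff N (Abs_fps f)) n"
          by simp
      qed
      then show ?thesis using fps_shift_cutoff'[of N "Abs_fps f"] by (simp add: add.commute)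
    qed
    have "(\<Sum>F\<in>\<F>. Abs_fps (c F) * g F) =
        (\<Sum>F\<in>\<F>. (\<Sum>k<N. fps_X ^ k * (fps_const (c F k) * g F)) + fps_X ^ N * (fps_shift N (Abs_fps (c F)) * g F))"
      by (subst *) (simp only: distrib_right sum_distrib_right mult.assoc)
    also have "\<dots> = (\<Sum>k<N. fps_X ^ k * (\<Sum>F\<in>\<F>. fps_const (c F k) * g F)) +
        fps_X ^ N * (\<Sum>F\<in>\<F>. fps_shift N (Abs_fps (c F)) * g F)"
      unfolding sum.distrib by (subst sum.swap) (simp only: sum_distrib_left)
    also have "(\<Sum>k<N. fps_X ^ k * (\<Sum>F\<in>\<F>. fps_const (c F k) * g F)) =
        (\<Sum>F\<in>\<F>. fps_const (c F 0) * g F) + (\<Sum>k\<in>{1..<N}. fps_X ^ k * (\<Sum>F\<in>\<F>. fps_const (c F k) * g F))"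
    proof -
      have "{..<N} = insert 0 {1..<N}" using N by auto
      then show ?thesis by simp
    qed
    finally have "(\<Sum>F\<in>\<F>. Abs_fps (c F) * g F) - (\<Sum>F\<in>\<F>. fps_const (c F 0) * g F) =
        (\<Sum>k\<in>{1..<N}. fps_X ^ k * (\<Sum>F\<in>\<F>. fps_const (c F k) * g F)) +
        fps_X ^ N * (\<Sum>F\<in>\<F>. fps_shift N (Abs_fps (c F)) * g F)" by simp
    also have "fps_X ^ N dvd \<dots>"
      using g by (intro dvd_add dvd_sum dvd_triv_left) auto
    finally show ?thesis .
  qed
  have sign: "(-1) ^ j * (1 - fps_X) ^ (j + 1) = (1 - fps_X) * (fps_X - 1 :: int fps) ^ j" for j
  proof -
    have "(fps_X - 1 :: int fps) ^ j = (-1) ^ j * (1 - fps_X) ^ j"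
      using power_minus[of "1 - fps_X :: int fps" j] by simp
    then show ?thesis by (simp add: mult_ac)
  qed
  define S where "S = (\<Sum>F\<in>\<F>. (-1) ^ dm F * Abs_fps (h F))"
  define T where "T = (\<Sum>F\<in>\<F>. (-1) ^ dm F * (of_nat (dm F) * Abs_fps (h F)))"
  have S: "S = (1 - fps_X) * (\<Sum>F\<in>\<F>. Abs_fps (c F) * (fps_X - 1) ^ dm F)"
    unfolding S_def sum_distrib_left
  proof (intro sum.cong refl)
    fix F assume "F \<in> \<F>"
    from h[OF this] have "(-1) ^ dm F * Abs_fps (h F) = Abs_fps (c F) * ((-1) ^ dm F * (1 - fps_X) ^ (dm F + 1))"
      by (metis mult.left_commute)
    then show "(-1) ^ dm F * Abs_fps (h F) = (1 - fps_X) * (Abs_fps (c F) * (fps_X - 1) ^ dm F)"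
      unfolding sign by (simp only: mult_ac)
  qed
  \<comment> \<open>The weight dim F appears through the derivative of (X - 1)^(dim F), at the price
    of a further factor X - 1.\<close>
  have T: "T = (1 - fps_X) * (fps_X - 1) * (\<Sum>F\<in>\<F>. Abs_fps (c F) * (of_nat (dm F) * (fps_X - 1) ^ (dm F - 1)))"
    unfolding T_def sum_distrib_left
  proof (intro sum.cong refl)
    fix F assume "F \<in> \<F>"
    from h[OF this] have "(-1) ^ dm F * (of_nat (dm F) * Abs_fps (h F)) =
        of_nat (dm F) * (Abs_fps (c F) * ((-1) ^ dm F * (1 - fps_X) ^ (dm F + 1)))"
      by (metis mult.left_commute)
    also have "\<dots> = (1 - fps_X) * Abs_fps (c F) * (of_nat (dm F) * (fps_X - 1) ^ dm F)"
      unfolding sign by (simp only: mult_ac)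
    also have "of_nat (dm F) * (fps_X - 1) ^ dm F = (fps_X - 1) * (of_nat (dm F) * (fps_X - 1 :: int fps) ^ (dm F - 1))"
      by (cases "dm F") (simp_all add: mult_ac)
    finally show "(-1) ^ dm F * (of_nat (dm F) * Abs_fps (h F)) =
        (1 - fps_X) * (fps_X - 1) * (Abs_fps (c F) * (of_nat (dm F) * (fps_X - 1) ^ (dm F - 1)))"
      by (simp only: mult_ac)
  qed
  have "fps_X ^ (m + 1) dvd (\<Sum>F\<in>\<F>. Abs_fps (c F) * (fps_X - 1) ^ dm F) - E 0"
    unfolding E_def by (rule trunc) (use dvdE in \<open>auto simp: E_def\<close>)
  then have "fps_X ^ (m + 1) dvd S - (1 - fps_X) * E 0"
    unfolding S right_diff_distrib[symmetric] by (rule dvd_mult)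
  from fps_X_power_dvd_nth_0[OF this] have S_nth: "fps_nth S i = fps_nth ((1 - fps_X) * E 0) i" if "i \<le> m" for i
    using that by simp
  have "fps_X ^ m dvd (\<Sum>F\<in>\<F>. Abs_fps (c F) * (of_nat (dm F) * (fps_X - 1) ^ (dm F - 1))) - fps_deriv (E 0)"
    unfolding deriv_E by (rule trunc) (use dvdE' m in \<open>auto simp: deriv_E\<close>)
  then have "fps_X ^ m dvd T - (1 - fps_X) * (fps_X - 1) * fps_deriv (E 0)"
    unfolding T right_diff_distrib[symmetric] by (rule dvd_mult)
  from fps_X_power_dvd_nth_0[OF this]
  have T_nth: "fps_nth T i = fps_nth ((1 - fps_X) * ((fps_X - 1) * fps_deriv (E 0))) i" if "i < m" for i
    using that by (simp add: mult.assoc)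
  obtain q where q: "m = Suc q" using m by (cases m) auto
  have sign_nth: "fps_nth ((-1) ^ j * f) k = (-1) ^ j * fps_nth f k" for j k and f :: "int fps"
    by (cases "even j") simp_all
  have nthS: "fps_nth S k = (\<Sum>F\<in>\<F>. (-1) ^ dm F * h F k)" for k
    by (simp add: S_def fps_sum_nth sign_nth)
  have nthT: "fps_nth T k = (\<Sum>F\<in>\<F>. (-1) ^ dm F * (int (dm F) * h F k))" for k
    by (simp add: T_def fps_sum_nth sign_nth fps_of_nat[symmetric])
  have "(\<Sum>F\<in>\<F>. (-1) ^ dm F * (int m * h F m + (int (dm F) + 1) * (\<Sum>k<m. h F k))) =
      int m * fps_nth S m + (\<Sum>k<m. fps_nth S k + fps_nth T k)"
  proof -
    have "(\<Sum>k<m. fps_nth S k + fps_nth T k) =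
        (\<Sum>F\<in>\<F>. \<Sum>k<m. (-1) ^ dm F * ((int (dm F) + 1) * h F k))"
      unfolding nthS nthT sum.distrib[symmetric] by (subst sum.swap) (simp add: algebra_simps)
    also have "\<dots> = (\<Sum>F\<in>\<F>. (-1) ^ dm F * ((int (dm F) + 1) * (\<Sum>k<m. h F k)))"
      by (simp only: sum_distrib_left)
    finally show ?thesis by (simp add: nthS sum_distrib_left sum.distrib[symmetric] algebra_simps)
  qed
  also have "(\<Sum>k<m. fps_nth S k + fps_nth T k) =
      (\<Sum>k<Suc q. fps_nth ((1 - fps_X) * (E 0 + (fps_X - 1) * fps_deriv (E 0))) k)"
    unfolding q[symmetric] by (intro sum.cong) (simp_all add: S_nth T_nth distrib_left)
  also have "\<dots> = fps_nth (E 0 + (fps_X - 1) * fps_deriv (E 0)) q"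
    by (rule sum_nth_one_minus_X_mult)
  \<comment> \<open>With m = q + 1 the right side is m times the coefficient of \<open>E 0\<close>
    at q minus the one at m, the exact negative of what m times the coefficient of \<open>S\<close>
    at m contributes.\<close>
  also have "\<dots> = fps_nth (E 0) q + int q * fps_nth (E 0) q - int (Suc q) * fps_nth (E 0) (Suc q)"
    by (cases q) (auto simp: left_diff_distrib fps_X_mult_nth)
  also have "int m * fps_nth S m = int (Suc q) * (fps_nth (E 0) (Suc q) - fps_nth (E 0) q)"
    using S_nth[of m] by (simp add: q left_diff_distrib fps_X_mult_nth)
  finally show ?thesis by (simp add: algebra_simps)
qed

section \<open>Lattice counts over the faces of a simple polytope\<close>

lemma sum_faces_of_dim:
  fixes P :: "(real ^ 'n) set"
  assumes P: "polytope P"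
  shows "(\<Sum>j=0..CARD('n). \<Sum>F\<in>faces_of_dim P j. g j F) =
    (\<Sum>F\<in>{F. F face_of P \<and> F \<noteq> {}}. g (nat (aff_dim F)) F)"
proof -
  let ?\<F> = "{F. F face_of P \<and> F \<noteq> {}}"
  have fin: "finite ?\<F>" using finite_polytope_faces[OF P] by (rule rev_finite_subset) auto
  \<comment> \<open>The empty face has dimension -1, which \<open>nat\<close> would count as 0;
    hence its exclusion.\<close>
  have "F \<noteq> {} \<longleftrightarrow> 0 \<le> aff_dim F" for F :: "(real ^ 'n) set"
    by (metis aff_dim_negative_iff not_le)
  then have eq: "faces_of_dim P j = {F \<in> ?\<F>. nat (aff_dim F) = j}" for j
    by (auto simp: faces_of_dim_def)
  have "(\<lambda>F. nat (aff_dim F)) ` ?\<F> \<subseteq> {0..CARD('n)}"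
  proof (rule image_subsetI)
    fix F :: "(real ^ 'n) set"
    show "nat (aff_dim F) \<in> {0..CARD('n)}" using aff_dim_le_DIM[of F] by simp
  qed
  from sum.group[OF fin _ this, of "\<lambda>F. g (nat (aff_dim F)) F"]
  show ?thesis unfolding eq by simp
qed

text \<open>The faces through \<open>y\<close> correspond to the subsets of \<open>\<Phi>\<close>,
  and the sum is the expansion of a product of factors 1 + w. At w = X - 1 these factors are X, the
  source of the divisibility.\<close>

lemma sum_faces_through_point:
  fixes P :: "(real ^ 'n) set" and w :: "'a::comm_ring_1"
  assumes P: "polytope P" and dim: "aff_dim P = int CARD('n)" and simple: "simple_polytope P"
    and y: "y \<in> P"
  defines "\<Phi> \<equiv> {f. f facet_of P \<and> y \<in> f}"
  shows "(\<Sum>F\<in>{F. F face_of P \<and> y \<in> F}. w ^ nat (aff_dim F)) =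
    w ^ (CARD('n) - card \<Phi>) * (1 + w) ^ card \<Phi>"
proof -
  have fin: "finite \<Phi>" using finite_polytope_facets[OF P] by (simp add: \<Phi>_def)
  note dimF = aff_dim_simple_face[OF P dim simple y, folded \<Phi>_def]
  have "y \<in> P \<inter> \<Inter>\<Phi>" using y by (auto simp: \<Phi>_def)
  then have "0 \<le> aff_dim (P \<inter> \<Inter>\<Phi>)" by (metis aff_dim_negative_iff empty_iff not_le)
  then have le: "card \<Phi> \<le> CARD('n)" using dimF[of \<Phi>] by simp
  have "(\<Sum>F\<in>{F. F face_of P \<and> y \<in> F}. w ^ nat (aff_dim F)) =
      (\<Sum>\<Psi>\<in>Pow \<Phi>. w ^ nat (aff_dim (P \<inter> \<Inter>\<Psi>)))"
    unfolding \<Phi>_def by (rule sum.reindex_bij_betw[OF bij_simple_faces[OF P dim simple y], symmetric])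
  also have "\<dots> = (\<Sum>\<Psi>\<in>Pow \<Phi>. w ^ (CARD('n) - card \<Phi>) * ((\<Prod>x\<in>\<Psi>. 1) * (\<Prod>x\<in>\<Phi> - \<Psi>. w)))"
  proof (intro sum.cong refl)
    fix \<Psi> assume "\<Psi> \<in> Pow \<Phi>"
    then have sub: "\<Psi> \<subseteq> \<Phi>" by simp
    then have "card \<Psi> \<le> card \<Phi>" "card (\<Phi> - \<Psi>) = card \<Phi> - card \<Psi>"
      using fin by (auto intro: card_mono simp: card_Diff_subset finite_subset)
    then have "nat (aff_dim (P \<inter> \<Inter>\<Psi>)) = (CARD('n) - card \<Phi>) + card (\<Phi> - \<Psi>)"
      using dimF[OF sub] le by simp
    then show "w ^ nat (aff_dim (P \<inter> \<Inter>\<Psi>)) = w ^ (CARD('n) - card \<Phi>) * ((\<Prod>x\<in>\<Psi>. 1) * (\<Prod>x\<in>\<Phi> - \<Psi>. w))"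
      by (simp add: power_add)
  qed
  also have "\<dots> = w ^ (CARD('n) - card \<Phi>) * (\<Prod>x\<in>\<Phi>. 1 + w)"
    by (simp only: prod_add[OF fin] sum_distrib_left)
  finally show ?thesis by simp
qed

lemma fps_const_sum: "fps_const (sum f A) = (\<Sum>x\<in>A. fps_const (f x :: 'a::comm_ring_1))"
  by (induction A rule: infinite_finite_induct) (simp_all flip: fps_const_add)

lemma card_dilate_face:
  fixes P :: "(real ^ 'n) set"
  assumes "bounded P" "F \<subseteq> P" "k \<ge> 1"
  shows "int (card (dilate k F \<inter> integer_points)) =
    (\<Sum>x\<in>dilate k P \<inter> integer_points. if (1 / real k) *\<^sub>R x \<in> F then 1 else 0)"
proof -
  have mem: "x \<in> dilate k G \<longleftrightarrow> (1 / real k) *\<^sub>R x \<in> G" for x and G :: "(real ^ 'n) set"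
    using assms(3) unfolding dilate_def by (auto intro!: image_eqI[of _ _ "(1 / real k) *\<^sub>R x"])
  have "bounded (dilate k P)" unfolding dilate_def by (rule bounded_scaling) fact
  then have "finite (dilate k P \<inter> integer_points)" by (rule finite_bounded_integer_points)
  then have "(\<Sum>x\<in>dilate k P \<inter> integer_points. if (1 / real k) *\<^sub>R x \<in> F then 1 else (0::int)) =
      int (card {x \<in> dilate k P \<inter> integer_points. (1 / real k) *\<^sub>R x \<in> F})"
    by (simp add: sum.If_cases Int_def)
  also have "{x \<in> dilate k P \<inter> integer_points. (1 / real k) *\<^sub>R x \<in> F} = dilate k F \<inter> integer_points"
    using assms(2) by (auto simp: mem)
  finally show ?thesis by simp
qed

text \<open>After exchanging the sums, each lattice point of kP contributes a multiple of X^c, where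
  c counts the facets through it and is at least codeg P - k. For k \<ge> codeg P the truncated
  exponent is 0 and the claim is trivial.\<close>

lemma face_count_dvd:
  fixes P :: "(real ^ 'n) set"
  assumes P: "lattice_polytope P" and dim: "aff_dim P = int CARD('n)" and simple: "simple_polytope P"
    and k: "k \<ge> 1"
  shows "fps_X ^ (codeg P - k) dvd (\<Sum>F\<in>{F. F face_of P \<and> F \<noteq> {}}.
    fps_const (int (card (dilate k F \<inter> integer_points))) * (fps_X - 1) ^ nat (aff_dim F))"
proof -
  have pol: "polytope P" using P by (auto simp: lattice_polytope_def polytope_def)
  let ?\<F> = "{F. F face_of P \<and> F \<noteq> {}}"
  let ?Q = "dilate k P \<inter> integer_points"
  let ?w = "fps_X - 1 :: int fps"
  let ?y = "\<lambda>x. (1 / real k) *\<^sub>R x"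
  have fin: "finite ?\<F>" using finite_polytope_faces[OF pol] by (rule rev_finite_subset) auto
  have "(\<Sum>F\<in>?\<F>. fps_const (int (card (dilate k F \<inter> integer_points))) * ?w ^ nat (aff_dim F)) =
      (\<Sum>F\<in>?\<F>. \<Sum>x\<in>?Q. if ?y x \<in> F then ?w ^ nat (aff_dim F) else 0)"
  proof (intro sum.cong refl)
    fix F assume "F \<in> ?\<F>"
    then have "F \<subseteq> P" using face_of_imp_subset by blast
    then have *: "int (card (dilate k F \<inter> integer_points)) = (\<Sum>x\<in>?Q. if ?y x \<in> F then 1 else 0)"
      by (rule card_dilate_face[OF polytope_imp_bounded[OF pol] _ k])
    have "fps_const (\<Sum>x\<in>?Q. if ?y x \<in> F then 1 else (0::int)) = (\<Sum>x\<in>?Q. if ?y x \<in> F then 1 else 0)"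
      unfolding fps_const_sum by (intro sum.cong) auto
    then show "fps_const (int (card (dilate k F \<inter> integer_points))) * ?w ^ nat (aff_dim F) =
        (\<Sum>x\<in>?Q. if ?y x \<in> F then ?w ^ nat (aff_dim F) else 0)"
      unfolding * by (simp only: sum_distrib_right) (intro sum.cong, auto)
  qed
  also have "\<dots> = (\<Sum>x\<in>?Q. \<Sum>F\<in>?\<F>. if ?y x \<in> F then ?w ^ nat (aff_dim F) else 0)"
    by (rule sum.swap)
  also have "fps_X ^ (codeg P - k) dvd \<dots>"
  proof (rule dvd_sum)
    fix x assume x: "x \<in> ?Q"
    then have yP: "?y x \<in> P" using k by (auto simp: dilate_def)
    have xi: "real k *\<^sub>R ?y x \<in> integer_points" using x k by simp
    have "(\<Sum>F\<in>?\<F>. if ?y x \<in> F then ?w ^ nat (aff_dim F) else 0) =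
        (\<Sum>F\<in>{F. F face_of P \<and> ?y x \<in> F}. ?w ^ nat (aff_dim F))"
      by (subst sum.inter_filter[OF fin, symmetric]) (intro sum.cong, auto)
    also have "\<dots> = ?w ^ (CARD('n) - card {f. f facet_of P \<and> ?y x \<in> f}) *
        fps_X ^ card {f. f facet_of P \<and> ?y x \<in> f}"
      using sum_faces_through_point[OF pol dim simple yP, of ?w] by simp
    also have "fps_X ^ (codeg P - k) dvd \<dots>"
      using codeg_le_add_facets[OF P dim k yP xi] by (intro dvd_mult le_imp_power_dvd) simp
    finally show "fps_X ^ (codeg P - k) dvd (\<Sum>F\<in>?\<F>. if ?y x \<in> F then ?w ^ nat (aff_dim F) else 0)" .
  qed
  finally show ?thesis .
qed

lemma lattice_polytope_face:
  assumes "lattice_polytope P" "F face_of P" "F \<noteq> {}"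
  obtains S where "finite S" "S \<subseteq> integer_points" "S \<noteq> {}" "F = convex hull S"
proof -
  obtain S where S: "finite S" "S \<subseteq> integer_points" "P = convex hull S"
    using assms(1) by (auto simp: lattice_polytope_def)
  obtain S' where S': "S' \<subseteq> S" "F = convex hull S'"
    using face_of_convex_hull_subset[OF finite_imp_compact[OF S(1)]] assms(2) S(3) by metis
  show thesis
  proof
    show "finite S'" using S'(1) S(1) by (rule finite_subset)
    show "S' \<noteq> {}" using S'(2) assms(3) by auto
  qed (use S' S in auto)
qed

text \<open>A nonzero coefficient \<open>h\<^sup>*\<^sub>k(F)\<close> gives a lattice point in the relative interior of
  \<open>(dim F + 1 - k) F\<close>, and such a point lies in exactly \<open>n - dim F\<close> facets of the dilate of \<open>P\<close>.\<close>
lemma h_star_face_bound: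
  fixes P :: "(real ^ 'n) set"
  assumes P: "lattice_polytope P" and dim: "aff_dim P = int CARD('n)" and simple: "simple_polytope P"
    and F: "F face_of P" "F \<noteq> {}" and h: "h_star F k \<noteq> 0"
  shows "codeg P + k \<le> CARD('n) + 1"
proof -
  have pol: "polytope P" using P by (auto simp: lattice_polytope_def polytope_def)
  have int: "interior P \<noteq> {}"
    using dim by (intro interior_nonempty_full_dim polytope_imp_convex pol) simp
  obtain S where S: "finite S" "S \<subseteq> integer_points" "S \<noteq> {}" "F = convex hull S"
    using lattice_polytope_face[OF P F] by blast
  define D where "D = nat (aff_dim F)"
  have D: "aff_dim F = int D" using F(2) by (metis D_def aff_dim_negative_iff int_nat_eq not_le)
  have kD: "k \<le> D" using h_star_le[OF S h] by (simp add: D_def)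
  obtain c where c: "\<forall>s\<in>S. 0 < c s" "sum c S = real (D + 1 - k)" "(\<Sum>s\<in>S. c s *\<^sub>R s) \<in> integer_points"
    using h_star_pos_point[OF S h] by (auto simp: D_def)
  define K where "K = D + 1 - k"
  have K: "K \<ge> 1" using kD by (simp add: K_def)
  define y where "y = (\<Sum>s\<in>S. (c s / real K) *\<^sub>R s)"
  have sum1: "(\<Sum>s\<in>S. c s / real K) = 1"
    using c(2) K by (simp add: sum_divide_distrib[symmetric] K_def)
  have "y \<in> F"
    unfolding S(4) convex_hull_finite[OF S(1)] y_def using c(1) sum1
    by (intro CollectI exI[of _ "\<lambda>s. c s / real K"]) (auto intro: less_imp_le)
  then have yP: "y \<in> P" using face_of_imp_subset[OF F(1)] by blast
  have Ky: "real K *\<^sub>R y \<in> integer_points"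
    using c(3) K by (simp add: y_def scaleR_sum_right)
  obtain a b where f: "\<And>f x. f facet_of P \<Longrightarrow> x \<in> f \<longleftrightarrow> x \<in> P \<and> a f \<bullet> x = b f"
    and Peq: "\<And>x. x \<in> P \<longleftrightarrow> (\<forall>f. f facet_of P \<longrightarrow> a f \<bullet> x \<le> b f)"
    using polytope_halfspaces[OF pol int] by metis
  have SP: "S \<subseteq> P" using hull_subset[of S convex] face_of_imp_subset[OF F(1)] S(4) by auto
  \<comment> \<open>The slack of \<open>g\<close> at K y is a sum of slacks at the points of
    \<open>S\<close> with strictly positive weights; if it is 0, every point of \<open>S\<close>
    lies in \<open>g\<close>.\<close>
  have sub: "F \<subseteq> g" if g: "g facet_of P" "y \<in> g" for g
  proof -
    have nonneg: "0 \<le> c s * (b g - a g \<bullet> s)" if "s \<in> S" for s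
      using that c(1) SP Peq g(1) by (intro mult_nonneg_nonneg) (auto intro: less_imp_le)
    have "(\<Sum>s\<in>S. c s * (b g - a g \<bullet> s)) = sum c S * b g - a g \<bullet> (\<Sum>s\<in>S. c s *\<^sub>R s)"
      by (simp add: right_diff_distrib sum_subtractf sum_distrib_right inner_sum_right)
    also have "(\<Sum>s\<in>S. c s *\<^sub>R s) = real K *\<^sub>R y" using K by (simp add: y_def scaleR_sum_right)
    also have "sum c S * b g - a g \<bullet> (real K *\<^sub>R y) = 0" using f[OF g(1), of y] g(2) c(2) by (simp add: K_def)
    finally have "(\<Sum>s\<in>S. c s * (b g - a g \<bullet> s)) = 0" .
    then have zero: "\<forall>s\<in>S. c s * (b g - a g \<bullet> s) = 0"
      by (simp only: sum_nonneg_eq_0_iff[OF S(1) nonneg])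
    have "S \<subseteq> g"
    proof
      fix s assume s: "s \<in> S"
      then have "a g \<bullet> s = b g" using zero c(1) by force
      then show "s \<in> g" using f[OF g(1), of s] SP s by blast
    qed
    moreover have "convex g" using g(1) facet_of_imp_face_of face_of_imp_convex by blast
    ultimately show ?thesis unfolding S(4) by (rule hull_minimal)
  qed
  define \<Phi> where "\<Phi> = {f. f facet_of P \<and> y \<in> f}"
  have "F \<in> {F. F face_of P \<and> y \<in> F}" using F(1) \<open>y \<in> F\<close> by simp
  then have "F \<in> (\<lambda>\<Psi>. P \<inter> \<Inter>\<Psi>) ` Pow \<Phi>"
    using bij_simple_faces[OF pol dim simple yP] unfolding bij_betw_def \<Phi>_def by blast
  then obtain \<Psi> where \<Psi>: "\<Psi> \<subseteq> \<Phi>" "F = P \<inter> \<Inter>\<Psi>" by blast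
  \<comment> \<open>\<open>F\<close> is cut out by some of the facets through \<open>y\<close> and
    contained in all of them, so the whole of \<open>\<Phi>\<close> cuts it out, and simplicity
    gives dim F = n - |\<Phi>|.\<close>
  have "F \<subseteq> P \<inter> \<Inter>\<Phi>" using sub face_of_imp_subset[OF F(1)] by (auto simp: \<Phi>_def)
  then have "F = P \<inter> \<Inter>\<Phi>" using \<Psi> by blast
  then have "int D = int CARD('n) - int (card \<Phi>)"
    using aff_dim_simple_face[OF pol dim simple yP, of \<Phi>] D by (simp add: \<Phi>_def)
  moreover have "codeg P \<le> K + card \<Phi>"
    using codeg_le_add_facets[OF P dim K yP Ky] by (simp add: \<Phi>_def)
  ultimately show ?thesis using kD by (simp add: K_def)
qed

lemma alternating_h_star_sum:
  fixes P :: "(real ^ 'n) set"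
  assumes P: "lattice_polytope P" and dim: "aff_dim P = int CARD('n)" and simple: "simple_polytope P"
    and m: "codeg P = m + 1" "m \<ge> 1"
  shows "(\<Sum>F\<in>{F. F face_of P \<and> F \<noteq> {}}. (-1) ^ nat (aff_dim F) *
    (int m * h_star F m + (int (nat (aff_dim F)) + 1) * (\<Sum>k<m. h_star F k))) = 0"
proof (rule truncated_numerator_identity[OF _ _ m(2)])
  fix F assume "F \<in> {F. F face_of P \<and> F \<noteq> {}}"
  then obtain S where S: "finite S" "S \<subseteq> integer_points" "S \<noteq> {}" "F = convex hull S"
    using lattice_polytope_face[OF P] by blast
  show "Abs_fps (\<lambda>k. int (card (dilate k F \<inter> integer_points))) * (1 - fps_X) ^ (nat (aff_dim F) + 1) =
      Abs_fps (h_star F)"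
    using h_star_series[OF S] by (simp only: ehrhart_series_def)
next
  fix k :: nat assume "1 \<le> k"
  from face_count_dvd[OF P dim simple this]
  show "fps_X ^ (m + 1 - k) dvd (\<Sum>F\<in>{F. F face_of P \<and> F \<noteq> {}}.
      fps_const (int (card (dilate k F \<inter> integer_points))) * (fps_X - 1) ^ nat (aff_dim F))"
    by (simp only: m(1))
qed

theorem theorem2p1:
  fixes P :: "(real ^ 'n) set" and n d :: nat
  assumes n_def: "n = CARD('n)" and n_ge: "n \<ge> 2"
    and lattice: "lattice_polytope P" and full_dim: "aff_dim P = int n"
    and simple: "simple_polytope P"
    and d_def: "d = lattice_deg P" and d_less: "d < n"
  shows "(d < n - d \<longleftrightarrow> real d \<le> (real n - 1) / 2) \<and>
         (d < n - d \<longleftrightarrow> real (codeg P) \<ge> (real n + 3) / 2) \<and>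
         (d < n - d \<longrightarrow> c_inv P = 0) \<and>
         (d \<ge> n - d \<longrightarrow>
           (\<Sum>j=0..n. (-1) ^ j *
             (\<Sum>F\<in>faces_of_dim P j.
               int (n - d) * h_star F (n - d) +
               (int j + 1) * (\<Sum>k<n - d. h_star F k))) = 0)"
proof -
  have dim: "aff_dim P = int CARD('n)" using full_dim n_def by simp
  have pol: "polytope P" using lattice by (auto simp: lattice_polytope_def polytope_def)
  have "codeg P \<le> n + 1" using codeg_le[OF lattice dim] n_def by simp
  then have codeg: "codeg P = n + 1 - d" using d_def n_def by (simp add: lattice_deg_def)
  define m where "m = n - d"
  have m: "codeg P = m + 1" "m \<ge> 1" using codeg d_less by (auto simp: m_def)
  let ?\<F> = "{F. F face_of P \<and> F \<noteq> {}}"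
  note zero = alternating_h_star_sum[OF lattice dim simple m]
  have ii: "(\<Sum>j=0..n. (-1) ^ j * (\<Sum>F\<in>faces_of_dim P j.
      int m * h_star F m + (int j + 1) * (\<Sum>k<m. h_star F k))) = 0"
    using zero unfolding sum_distrib_left n_def sum_faces_of_dim[OF pol] .
  have i: "c_inv P = 0" if "d < m"
  proof -
    \<comment> \<open>A nonzero coefficient would have index at most d, hence below m.\<close>
    have vanish: "h_star F k = 0" if F: "F \<in> ?\<F>" and "m \<le> k" for F k
    proof (rule ccontr)
      assume "h_star F k \<noteq> 0"
      then have "codeg P + k \<le> n + 1"
        using h_star_face_bound[OF lattice dim simple _ _ \<open>h_star F k \<noteq> 0\<close>] F n_def by simp
      then show False using codeg \<open>m \<le> k\<close> \<open>d < m\<close> d_less by simp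
    qed
    have vol: "Vol_Z F = of_int (\<Sum>k<m. h_star F k)" if F: "F \<in> ?\<F>" for F
    proof -
      obtain S where S: "finite S" "S \<subseteq> integer_points" "S \<noteq> {}" "F = convex hull S"
        using lattice_polytope_face[OF lattice] F by blast
      \<comment> \<open>Either of dim F and m may be the larger one; both ranges contain the support
        of \<open>h_star F\<close>, so the sum passes through their union.\<close>
      have "(\<Sum>i\<le>nat (aff_dim F). h_star F i) = (\<Sum>i\<in>{..nat (aff_dim F)} \<union> {..<m}. h_star F i)"
        using h_star_le[OF S] by (intro sum.mono_neutral_left) force+
      also have "\<dots> = (\<Sum>k<m. h_star F k)"
        using vanish[OF F] by (intro sum.mono_neutral_right) auto
      finally show ?thesis using Vol_Z_eq_sum_h_star[OF S] by simp
    qed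
    have "c_inv P = (\<Sum>j=0..CARD('n). \<Sum>F\<in>faces_of_dim P j. (-1) ^ (n - j) * (real j + 1) * Vol_Z F)"
      by (simp add: c_inv_def n_def sum_distrib_left)
    also have "\<dots> = (\<Sum>F\<in>?\<F>. (-1) ^ (n - nat (aff_dim F)) * (real (nat (aff_dim F)) + 1) * Vol_Z F)"
      by (rule sum_faces_of_dim[OF pol])
    \<comment> \<open>As \<open>h_star F m\<close> vanishes too, the summand of (ii) is the volume
      summand up to the common sign (-1)^n.\<close>
    also have "\<dots> = (\<Sum>F\<in>?\<F>. (-1) ^ n * of_int ((-1) ^ nat (aff_dim F) *
      (int m * h_star F m + (int (nat (aff_dim F)) + 1) * (\<Sum>k<m. h_star F k))))"
    proof (intro sum.cong refl)
      fix F assume F: "F \<in> ?\<F>"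
      have "nat (aff_dim F) \<le> n" using aff_dim_le_DIM[of F] n_def by simp
      then have "(-1 :: real) ^ (n - nat (aff_dim F)) = (-1) ^ n * (-1) ^ nat (aff_dim F)"
        by (simp add: uminus_power_if)
      then show "(-1) ^ (n - nat (aff_dim F)) * (real (nat (aff_dim F)) + 1) * Vol_Z F =
        (-1) ^ n * of_int ((-1) ^ nat (aff_dim F) *
          (int m * h_star F m + (int (nat (aff_dim F)) + 1) * (\<Sum>k<m. h_star F k)))"
        using vanish[OF F, of m] by (simp add: vol[OF F])
    qed
    also have "\<dots> = (-1) ^ n * of_int (\<Sum>F\<in>?\<F>. (-1) ^ nat (aff_dim F) *
      (int m * h_star F m + (int (nat (aff_dim F)) + 1) * (\<Sum>k<m. h_star F k)))"
      by (simp only: sum_distrib_left[symmetric] of_int_sum)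
    also have "\<dots> = 0" by (simp only: zero)
    finally show ?thesis by simp
  qed
  have lt: "d < n - d \<longleftrightarrow> 2 * d + 1 \<le> n" by auto
  have "real (2 * d + 1) \<le> real n \<longleftrightarrow> real d \<le> (real n - 1) / 2" by (simp add: field_simps)
  then have "d < n - d \<longleftrightarrow> real d \<le> (real n - 1) / 2" unfolding lt of_nat_le_iff .
  moreover have "real (2 * d + 1) \<le> real n \<longleftrightarrow> real (codeg P) \<ge> (real n + 3) / 2"
    using d_less by (simp add: codeg field_simps of_nat_diff)
  then have "d < n - d \<longleftrightarrow> real (codeg P) \<ge> (real n + 3) / 2" unfolding lt of_nat_le_iff .
  ultimately show ?thesis using i ii by (simp add: m_def)
qed

end
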